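(* Let $K\ge 1$ and consider the Gaussian interference channel with $K+1$ transmitter-receiver pairs, gains $g_{jl}\in\mathbb{C}$ ($j,l\in[0:K]$) and power constraint $Q>0$. The capacity region of this channel with Gaussian point-to-point (G-ptp) codes equals $$\mathcal{C}=\bigcap_{j=0}^{K}\mathcal{C}_j,\qquad \mathcal{C}_j=\{\mathbf{R}\in\mathbb{R}_{\ge0}^{K+1}:\ R_{\mathcal S}\in\mathcal{A}_j(\mathcal S)\text{ for some }\mathcal S\subseteq[0:K]\text{ with } j\in\mathcal S\},$$ where, for $j\in\mathcal S\subseteq[0:K]$ and $\mathcal S^c=[0:K]\setminus\mathcal S$, $$\mathcal{A}_j(\mathcal S)=\left\{R_{\mathcal S}:\ \sum_{l\in\mathcal T}R_l\le C\!\left(\frac{\sum_{l\in\mathcal T}P_{jl}}{1+\sum_{l\in\mathcal S^c}P_{jl}}\right)\text{ for every }\mathcal T\subseteq\mathcal S\right\},\qquad P_{jl}=|g_{jl}|^2Q .$$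
   Context: Notation: $[a:b]=\{a,a+1,\dots,b\}$; $C(x)=\log_2(1+x)$ for $x\ge0$; for a vector $\mathbf R=(R_0,\dots,R_K)$ of nonnegative rates and $\mathcal S\subseteq[0:K]$, $R_{\mathcal S}=(R_l)_{l\in\mathcal S}$. $\mathcal{CN}(0,\sigma^2)$ is the circularly symmetric complex Gaussian law with variance $\sigma^2$. Channel: at each time, when the complex symbols $(X_0,\dots,X_K)$ are sent, receiver $j$ observes $Y_j=\sum_{l=0}^K g_{jl}X_l+Z_j$, with $Z_j\sim\mathcal{CN}(0,1)$ i.i.d. over time and independent of the messages and codebooks. Transmitter $j$ has a message $M_j$ uniform on $[1:2^{nR_j}]$ ($2^{nR_j}$ rounded up to an integer), with the messages independent, and sends it to receiver $j$ over $n$ channel uses. G-ptp code: an $(n,2^{nR_0},\dots,2^{nR_K})$ G-ptp code is a random collection of codewords $x_j^n(m_j)\in\mathbb{C}^n$, $m_j\in[1:2^{nR_j}]$, $j\in[0:K]$, generated independently, each with i.i.d. $\mathcal{CN}(0,\sigma^2)$ entries, for some $0<\sigma^2\le Q$ (common to all transmitters). Transmitter $j$ sends $x_j^n(M_j)$. The realized codebooks are known to all receivers; receiver $j$ forms an estimate $\hat M_j=\hat m_j(Y_j^n)\in[1:2^{nR_j}]$, where the decoding function is arbitrary and may depend on the codebooks. No time sharing or power control is allowed. The probability of error of a realized code is $p_n=\frac1{K+1}\sum_{j=0}^K P\{\hat M_j\ne M_j\}$, and $\bar p_n$ is its average over the random codebooks. A rate tuple $\mathbf R$ is achievable if there is a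 sequence (in $n$) of $(n,2^{nR_0},\dots,2^{nR_K})$ G-ptp codes and decoders with $\bar p_n\to0$. The capacity region with G-ptp codes is the closure of the set of achievable rate tuples. *)

theory Defs
  imports "HOL-Probability.Probability"
begin

text \<open>
  The users \<open>[0:K]\<close> are the elements of a finite type \<open>'k\<close> with \<open>K + 1\<close> elements, so that rate
  tuples are vectors in \<open>real ^ 'k\<close>.  The gain \<open>g j l\<close> is the one from transmitter \<open>l\<close> to
  receiver \<open>j\<close>.
\<close>

definition cap :: "real \<Rightarrow> real" where
  "cap x = log 2 (1 + x)"

text \<open>
  Circularly symmetric complex Gaussian law of variance \<open>v\<close>: real and imaginary parts are
  independent, centred normal, each of variance \<open>v / 2\<close>.
\<close>

definition complex_gaussian :: "real \<Rightarrow> complex measure" where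
  "complex_gaussian v =
     (let N = density lborel (\<lambda>x. ennreal (normal_density 0 (sqrt (v / 2)) x))
      in distr (N \<Otimes>\<^sub>M N) borel (\<lambda>(x, y). Complex x y))"

lemma sets_complex_gaussian [simp, measurable_cong]: "sets (complex_gaussian v) = sets borel"
  by (simp add: complex_gaussian_def Let_def)

lemma space_complex_gaussian [simp]: "space (complex_gaussian v) = UNIV"
  by (simp add: complex_gaussian_def Let_def)

lemma prob_space_complex_gaussian:
  assumes "v > 0"
  shows "prob_space (complex_gaussian v)"
proof -
  let ?N = "density lborel (\<lambda>x. ennreal (normal_density 0 (sqrt (v / 2)) x))"
  interpret N: prob_space ?N
    using assms by (intro prob_space_normal_density) simp
  interpret NN: pair_prob_space ?N ?N ..
  have "(\<lambda>(x, y). Complex x y) \<in> borel_measurable (?N \<Otimes>\<^sub>M ?N)"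
    by (simp add: Complex_eq split_beta)
  then show ?thesis
    unfolding complex_gaussian_def Let_def by (rule NN.prob_space_distr)
qed


subsection \<open>Gaussian point-to-point codes\<close>

definition num_messages :: "nat \<Rightarrow> real \<Rightarrow> nat" where
  "num_messages n r = nat \<lceil>2 powr (real n * r)\<rceil>"

text \<open>
  A realized collection of codebooks is a function \<open>x\<close>, where \<open>x (j, m, i)\<close> is the \<open>i\<close>-th symbol of
  the codeword of transmitter \<open>j\<close> for message \<open>m\<close>.
\<close>

type_synonym 'k codebooks = "'k \<times> nat \<times> nat \<Rightarrow> complex"

definition gptp_codebooks :: "nat \<Rightarrow> real ^ 'k \<Rightarrow> real \<Rightarrow> ('k::finite) codebooks measure" where
  "gptp_codebooks n R v =
     PiM (SIGMA j:UNIV. {1..num_messages n (R $ j)} \<times> {..<n}) (\<lambda>_. complex_gaussian v)"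

definition message_pmf :: "nat \<Rightarrow> real ^ 'k \<Rightarrow> ('k::finite \<Rightarrow> nat) pmf" where
  "message_pmf n R = Pi_pmf UNIV 0 (\<lambda>j. pmf_of_set {1..num_messages n (R $ j)})"

definition noise :: "nat \<Rightarrow> (nat \<Rightarrow> complex) measure" where
  "noise n = PiM {..<n} (\<lambda>_. complex_gaussian 1)"

definition received ::
  "('k::finite \<Rightarrow> 'k \<Rightarrow> complex) \<Rightarrow> nat \<Rightarrow> 'k codebooks \<Rightarrow> 'k
     \<Rightarrow> ('k \<Rightarrow> nat) \<Rightarrow> (nat \<Rightarrow> complex) \<Rightarrow> nat \<Rightarrow> complex" where
  "received g n x j w z = (\<lambda>i\<in>{..<n}. (\<Sum>l\<in>UNIV. g j l * x (l, w l, i)) + z i)"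

text \<open>
  The decoder of receiver \<open>j\<close> maps the realized codebooks of all transmitters and the output
  sequence to a message estimate.  Joint measurability is required only so that the error
  probability and its average over the codebooks are defined.
\<close>

definition decoders ::
  "nat \<Rightarrow> real ^ 'k \<Rightarrow> real \<Rightarrow> ('k::finite \<Rightarrow> 'k codebooks \<times> (nat \<Rightarrow> complex) \<Rightarrow> nat) set" where
  "decoders n R v = {d. \<forall>j. d j \<in>
     measurable (gptp_codebooks n R v \<Otimes>\<^sub>M PiM {..<n} (\<lambda>_. borel))
       (count_space {1..num_messages n (R $ j)})}"

text \<open>
  The events for different receivers are evaluated separately, so only the law of the noise at
  each single receiver enters and no joint law across receivers has to be fixed.
\<close>

definition error_prob ::
  "('k::finite \<Rightarrow> 'k \<Rightarrow> complex) \<Rightarrow> nat \<Rightarrow> real ^ 'k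
     \<Rightarrow> ('k \<Rightarrow> 'k codebooks \<times> (nat \<Rightarrow> complex) \<Rightarrow> nat) \<Rightarrow> 'k codebooks \<Rightarrow> real" where
  "error_prob g n R d x =
     (\<Sum>j\<in>UNIV. measure (measure_pmf (message_pmf n R) \<Otimes>\<^sub>M noise n)
                  {(w, z) \<in> UNIV \<times> space (noise n). d j (x, received g n x j w z) \<noteq> w j})
     / real CARD('k)"

definition avg_error_prob ::
  "('k::finite \<Rightarrow> 'k \<Rightarrow> complex) \<Rightarrow> nat \<Rightarrow> real ^ 'k \<Rightarrow> real
     \<Rightarrow> ('k \<Rightarrow> 'k codebooks \<times> (nat \<Rightarrow> complex) \<Rightarrow> nat) \<Rightarrow> real" where
  "avg_error_prob g n R v d = (\<integral>x. error_prob g n R d x \<partial>gptp_codebooks n R v)"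

text \<open>The codebook variance \<open>v n\<close> belongs to the code and may change with the block length.\<close>

definition achievable :: "('k::finite \<Rightarrow> 'k \<Rightarrow> complex) \<Rightarrow> real \<Rightarrow> real ^ 'k \<Rightarrow> bool" where
  "achievable g Q R \<longleftrightarrow>
     (\<forall>j. 0 \<le> R $ j) \<and>
     (\<exists>v d. (\<forall>n. 0 < v n \<and> v n \<le> Q) \<and> (\<forall>n. d n \<in> decoders n R (v n)) \<and>
            (\<lambda>n. avg_error_prob g n R (v n) (d n)) \<longlonglongrightarrow> 0)"

definition gptp_capacity_region ::
  "('k::finite \<Rightarrow> 'k \<Rightarrow> complex) \<Rightarrow> real \<Rightarrow> (real ^ 'k) set" where
  "gptp_capacity_region g Q = closure {R. achievable g Q R}"


subsection \<open>The explicit region\<close>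

definition rx_power :: "('k \<Rightarrow> 'k \<Rightarrow> complex) \<Rightarrow> real \<Rightarrow> 'k \<Rightarrow> 'k \<Rightarrow> real" where
  "rx_power g Q j l = (cmod (g j l))\<^sup>2 * Q"

definition mac_region ::
  "('k::finite \<Rightarrow> 'k \<Rightarrow> complex) \<Rightarrow> real \<Rightarrow> 'k \<Rightarrow> 'k set \<Rightarrow> ('k \<Rightarrow> real) set" where
  "mac_region g Q j S =
     {r \<in> S \<rightarrow>\<^sub>E {0..}. \<forall>T\<subseteq>S.
        (\<Sum>l\<in>T. r l) \<le> cap ((\<Sum>l\<in>T. rx_power g Q j l) / (1 + (\<Sum>l\<in>- S. rx_power g Q j l)))}"

definition receiver_region ::
  "('k::finite \<Rightarrow> 'k \<Rightarrow> complex) \<Rightarrow> real \<Rightarrow> 'k \<Rightarrow> (real ^ 'k) set" where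
  "receiver_region g Q j =
     {R. (\<forall>l. 0 \<le> R $ l) \<and> (\<exists>S. j \<in> S \<and> (\<lambda>l\<in>S. R $ l) \<in> mac_region g Q j S)}"

end

theory Submission
  imports Defs
begin

text \<open>
  Both directions rest on the same two facts about one receiver.  Let \<open>lik U w\<close> be the likelihood of
  the messages \<open>w\<close> of the users outside \<open>U\<close> when the users in \<open>U\<close> are treated as Gaussian noise.
  If \<open>U \<subseteq> V\<close> and \<open>w'\<close> differs from the true \<open>w\<close> exactly on \<open>V - U\<close>, then \<open>lik U w' / lik V w\<close> has
  mean one, because averaging over the independent codewords of \<open>w'\<close> convolves Gaussian densities.
  Moreover \<open>lik V w\<close> concentrates (Chernoff) around \<open>(\<pi> e \<sigma>\<^sub>V)\<^sup>-\<^sup>n\<close>, where \<open>\<sigma>\<^sub>V = 1 + (\<Sum>l\<in>V. P\<^sub>l)\<close>.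

  Achievability decodes the users in \<open>S\<close> by comparing \<open>lik (- S)\<close> with \<open>lik (- S \<union> T)\<close>, for all
  \<open>T \<subseteq> S\<close>, against a threshold; Markov's inequality bounds the probability of a false candidate.

  For the converse, put \<open>\<phi> U = R(- U) + log \<sigma>\<^sub>U\<close>.  If \<open>\<phi>\<close> has a global minimizer \<open>U\<close> with \<open>j \<notin> U\<close>, then
  \<open>S = - U\<close> witnesses that \<open>R\<close> lies in the region of receiver \<open>j\<close>.  Otherwise some \<open>U\<close> containing \<open>j\<close>
  beats every \<open>T\<close> avoiding \<open>j\<close>.  Give the receiver the messages outside \<open>U\<close>.  The first fact, with
  Markov's inequality, bounds the density of the output given \<open>M\<^sub>j\<close> from above by the sum over
  \<open>T \<subseteq> U - {j}\<close> of the contributions of messages that are wrong exactly on \<open>T\<close>; compared with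
  \<open>lik U\<close> this is too small for \<open>M\<^sub>j\<close> to be decoded.
\<close>

subsection \<open>Complex Gaussian laws\<close>

text \<open>Heuristically, the minimum of \<phi> over all sets is, up to the constant log (pi e),
  the entropy rate of the output given the codebooks; the minimum over the sets avoiding j, reduced
  by R_j, is the entropy rate when M_j is known too. They differ by R_j, so that M_j can be decoded,
  exactly when a global minimizer avoids j. This is the origin of the dichotomy in the converse.

  Codewords of w' are independent of the true ones only at the users where the two tuples differ.
  Errors are therefore always sorted by the exact set of disagreement.

  Two asymptotic obstacles remain. The variance may change with the block length and tend to 0, so
  the gap between values of \<phi> has to be uniform over the compact interval from 0 to Q; lowering
  the variance never relaxes a constraint of the region. And scaling a rate tuple by c < 1 leaves no
  slack where the sum rate is zero; but rate 0 means exactly one message after rounding, so such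
  users cannot be confused and their constraints are never invoked.\<close>

definition cgauss_density :: "real \<Rightarrow> complex \<Rightarrow> real" where
  "cgauss_density v z = exp (- (cmod z)\<^sup>2 / v) / (pi * v)"

lemma cgauss_density_pos: "v > 0 \<Longrightarrow> cgauss_density v z > 0"
  by (simp add: cgauss_density_def)

lemma cgauss_density_nonneg [simp]: "v \<ge> 0 \<Longrightarrow> cgauss_density v z \<ge> 0"
  by (simp add: cgauss_density_def)

lemma borel_measurable_cgauss_density [measurable]: "cgauss_density v \<in> borel_measurable borel"
  unfolding cgauss_density_def by measurable

lemma measurable_Complex_pair [measurable]:
  "(\<lambda>(x, y). Complex x y) \<in> borel_measurable (lborel \<Otimes>\<^sub>M lborel)"
  by (simp add: Complex_eq split_beta)

lemma measurable_Complex [measurable (raw)]: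
  assumes "f \<in> borel_measurable M" "g \<in> borel_measurable M"
  shows "(\<lambda>x. Complex (f x) (g x)) \<in> borel_measurable M"
  using assms by (simp add: Complex_eq)

text \<open>Lebesgue measure is determined by its values on boxes, and a box in the complex plane is
  a product of two intervals. Complex integrals can then be computed coordinatewise.\<close>

lemma lborel_complex: "(lborel :: complex measure) = distr (lborel \<Otimes>\<^sub>M lborel) borel (\<lambda>(x, y). Complex x y)"
proof (rule lborel_eqI)
  fix l u :: complex
  assume le: "\<And>b. b \<in> Basis \<Longrightarrow> l \<bullet> b \<le> u \<bullet> b"
  have "(\<lambda>(x, y). Complex x y) -` box l u \<inter> space (lborel \<Otimes>\<^sub>M lborel)
      = {Re l<..<Re u} \<times> {Im l<..<Im u}"
    by (auto simp: box_def Basis_complex_def space_pair_measure)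
  then have "emeasure (distr (lborel \<Otimes>\<^sub>M lborel) borel (\<lambda>(x, y). Complex x y)) (box l u)
     = emeasure (lborel \<Otimes>\<^sub>M lborel) ({Re l<..<Re u} \<times> {Im l<..<Im u})"
    by (subst emeasure_distr) auto
  also have "\<dots> = ennreal (Re u - Re l) * ennreal (Im u - Im l)"
    using le[of 1] le[of \<i>] by (subst lborel.emeasure_pair_measure_Times) (auto simp: Basis_complex_def)
  finally show "emeasure (distr (lborel \<Otimes>\<^sub>M lborel) borel (\<lambda>(x, y). Complex x y)) (box l u)
     = (\<Prod>b\<in>Basis. (u - l) \<bullet> b)"
    using le[of 1] le[of \<i>] by (simp add: Basis_complex_def ennreal_mult)
qed simp

lemma nn_integral_lborel_complex:
  assumes [measurable]: "f \<in> borel_measurable borel"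
  shows "(\<integral>\<^sup>+z. f z \<partial>lborel) = (\<integral>\<^sup>+a. \<integral>\<^sup>+b. f (Complex a b) \<partial>lborel \<partial>lborel)"
  by (subst lborel_complex) (simp add: nn_integral_distr split_beta lborel.nn_integral_fst[symmetric])

lemma nn_integral_lborel_complex':
  assumes [measurable]: "f \<in> borel_measurable borel"
  shows "(\<integral>\<^sup>+z. f z \<partial>lborel) = (\<integral>\<^sup>+b. \<integral>\<^sup>+a. f (Complex a b) \<partial>lborel \<partial>lborel)"
  by (subst nn_integral_lborel_complex, simp, rule lborel_pair.Fubini'[symmetric]) measurable

lemma cgauss_density_Complex:
  assumes "v > 0"
  shows "cgauss_density v (Complex a b)
    = normal_density 0 (sqrt (v / 2)) a * normal_density 0 (sqrt (v / 2)) b"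
proof -
  have "sqrt (2 * pi * (sqrt (v/2))\<^sup>2) = sqrt (pi * v)" using assms by simp
  then show ?thesis using assms
    by (simp add: cgauss_density_def normal_density_def cmod_power2 exp_add[symmetric] diff_divide_distrib)
qed

lemma complex_gaussian_eq_density:
  assumes v: "v > 0"
  shows "complex_gaussian v = density lborel (cgauss_density v)"
proof -
  let ?n = "\<lambda>x. ennreal (normal_density 0 (sqrt (v / 2)) x)"
  interpret N: prob_space "density lborel ?n"
    using v by (intro prob_space_normal_density) simp
  have "density lborel ?n \<Otimes>\<^sub>M density lborel ?n
      = density (lborel \<Otimes>\<^sub>M lborel) (\<lambda>(x, y). ?n x * ?n y)"
    by (intro pair_measure_density) (auto intro: lborel.sigma_finite_measure_axioms N.sigma_finite_measure_axioms)
  then have "complex_gaussian v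
     = distr (density (lborel \<Otimes>\<^sub>M lborel) (\<lambda>p. ennreal (cgauss_density v (case p of (x, y) \<Rightarrow> Complex x y)))) borel (\<lambda>(x, y). Complex x y)"
    using v by (simp add: complex_gaussian_def cgauss_density_Complex ennreal_mult case_prod_beta')
  also have "\<dots> = density (distr (lborel \<Otimes>\<^sub>M lborel) borel (\<lambda>(x, y). Complex x y)) (cgauss_density v)"
    by (rule density_distr[symmetric]) measurable
  finally show ?thesis by (simp add: lborel_complex[symmetric])
qed

lemma nn_integral_complex_gaussian:
  assumes "v > 0" and [measurable]: "f \<in> borel_measurable borel"
  shows "(\<integral>\<^sup>+z. f z \<partial>complex_gaussian v) = (\<integral>\<^sup>+z. ennreal (cgauss_density v z) * f z \<partial>lborel)"
  using assms(1) by (simp add: complex_gaussian_eq_density nn_integral_density)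

lemma nn_integral_lborel_translate:
  fixes c :: complex
  assumes [measurable]: "f \<in> borel_measurable borel"
  shows "(\<integral>\<^sup>+z. f (z - c) \<partial>lborel) = (\<integral>\<^sup>+z. f z \<partial>lborel)"
proof -
  have "(\<integral>\<^sup>+z. f z \<partial>lborel) = (\<integral>\<^sup>+z. f z \<partial>distr lborel borel ((+) (- c)))"
    by (subst lborel_distr_plus) simp
  then show ?thesis by (simp add: nn_integral_distr)
qed

text \<open>Multiplication by \<open>g\<close> is a linear map of the plane, split here into two
  one-dimensional affine substitutions, one per coordinate. Their factors \<open>k\<close> and
  \<open>c\<close> multiply to the determinant, the squared modulus of \<open>g\<close>; the
  splitting divides by the real part.\<close>

lemma nn_integral_lborel_complex_mult_aux:
  fixes g :: complex
  assumes Re: "Re g \<noteq> 0" and [measurable]: "f \<in> borel_measurable borel"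
  shows "(\<integral>\<^sup>+z. f z \<partial>lborel) = ennreal ((cmod g)\<^sup>2) * (\<integral>\<^sup>+z. f (g * z) \<partial>lborel)"
proof -
  define c s where "c = Re g" and "s = Im g"
  define k where "k = (s\<^sup>2 + c\<^sup>2) / c"
  have c: "c \<noteq> 0" and k: "k \<noteq> 0" using Re by (auto simp: c_def k_def sum_power2_eq_zero_iff)
  have "(\<integral>\<^sup>+z. f z \<partial>lborel) = (\<integral>\<^sup>+a. \<integral>\<^sup>+b. f (Complex a b) \<partial>lborel \<partial>lborel)"
    by (rule nn_integral_lborel_complex) simp
  also have "\<dots> = (\<integral>\<^sup>+a. ennreal \<bar>k\<bar> * (\<integral>\<^sup>+y. f (Complex a (s / c * a + k * y)) \<partial>lborel) \<partial>lborel)"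
    by (intro nn_integral_cong nn_integral_real_affine) (use k in measurable)
  also have "\<dots> = ennreal \<bar>k\<bar> * (\<integral>\<^sup>+a. (\<integral>\<^sup>+y. f (Complex a (s / c * a + k * y)) \<partial>lborel) \<partial>lborel)"
    by (rule nn_integral_cmult) measurable
  also have "\<dots> = ennreal \<bar>k\<bar> * (\<integral>\<^sup>+y. (\<integral>\<^sup>+a. f (Complex a (s / c * a + k * y)) \<partial>lborel) \<partial>lborel)"
    by (subst lborel_pair.Fubini') (auto simp: split_beta)
  also have "\<dots> = ennreal \<bar>k\<bar> * (\<integral>\<^sup>+y. ennreal \<bar>c\<bar> * (\<integral>\<^sup>+x. f (Complex (- s * y + c * x) (s / c * (- s * y + c * x) + k * y)) \<partial>lborel) \<partial>lborel)"
    by (intro arg_cong2[where f="(*)"] nn_integral_cong refl nn_integral_real_affine) (use c in measurable)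
  also have "\<dots> = ennreal \<bar>k\<bar> * (ennreal \<bar>c\<bar> * (\<integral>\<^sup>+y. (\<integral>\<^sup>+x. f (Complex (- s * y + c * x) (s / c * (- s * y + c * x) + k * y)) \<partial>lborel) \<partial>lborel))"
    by (subst nn_integral_cmult) measurable
  also have "\<dots> = ennreal (\<bar>k\<bar> * \<bar>c\<bar>) * (\<integral>\<^sup>+y. (\<integral>\<^sup>+x. f (g * Complex x y) \<partial>lborel) \<partial>lborel)"
  proof -
    have "Complex (- s * y + c * x) (s / c * (- s * y + c * x) + k * y) = g * Complex x y" for x y
      using c by (simp add: complex_eq_iff c_def s_def k_def field_simps power2_eq_square)
    then show ?thesis by (simp add: ennreal_mult mult.assoc)
  qed
  also have "\<bar>k\<bar> * \<bar>c\<bar> = (cmod g)\<^sup>2"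
    using c by (simp add: k_def c_def s_def cmod_power2 abs_mult[symmetric])
  finally show ?thesis by (simp add: nn_integral_lborel_complex'[of "\<lambda>z. f (g * z)"])
qed

lemma nn_integral_lborel_complex_mult:
  fixes g :: complex
  assumes g: "g \<noteq> 0" and [measurable]: "f \<in> borel_measurable borel"
  shows "(\<integral>\<^sup>+z. f z \<partial>lborel) = ennreal ((cmod g)\<^sup>2) * (\<integral>\<^sup>+z. f (g * z) \<partial>lborel)"
proof (cases "Re g = 0")
  case False
  then show ?thesis by (rule nn_integral_lborel_complex_mult_aux) simp
next
  case True
  \<comment> \<open>For imaginary \<open>g\<close>, both \<open>u\<close> and \<open>g * u\<close>
    have nonzero real part. The substitution by \<open>g * u\<close>, followed by undoing the one by
    \<open>u\<close>, leaves the one by \<open>g\<close>.\<close>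
  define u where "u = Complex 1 1"
  have u: "Re u \<noteq> 0" "u \<noteq> 0" by (auto simp: u_def complex_eq_iff)
  have "Re (g * u) \<noteq> 0" using g True by (auto simp: u_def complex_eq_iff)
  then have "(\<integral>\<^sup>+z. f z \<partial>lborel) = ennreal ((cmod (g * u))\<^sup>2) * (\<integral>\<^sup>+z. f ((g * u) * z) \<partial>lborel)"
    by (rule nn_integral_lborel_complex_mult_aux) simp
  also have "\<dots> = ennreal ((cmod g)\<^sup>2) * (ennreal ((cmod u)\<^sup>2) * (\<integral>\<^sup>+z. f (g * (u * z)) \<partial>lborel))"
    by (simp add: norm_mult power_mult_distrib ennreal_mult mult.assoc)
  also have "ennreal ((cmod u)\<^sup>2) * (\<integral>\<^sup>+z. f (g * (u * z)) \<partial>lborel) = (\<integral>\<^sup>+z. f (g * z) \<partial>lborel)"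
    by (rule nn_integral_lborel_complex_mult_aux[OF u(1), symmetric]) simp
  finally show ?thesis .
qed

text \<open>The density factors over real and imaginary part, and in each the real normal
  convolution adds the variances \<open>p / 2\<close> and \<open>v / 2\<close>.\<close>

lemma cgauss_density_convolution:
  assumes p: "p > 0" and v: "v > 0"
  shows "(\<integral>\<^sup>+x. ennreal (cgauss_density p (b - x)) * ennreal (cgauss_density v x) \<partial>lborel)
    = cgauss_density (p + v) b"
proof -
  let ?n = "\<lambda>v x. ennreal (normal_density 0 (sqrt (v / 2)) x)"
  have conv: "(\<integral>\<^sup>+y. ?n p (x - y) * ?n v y \<partial>lborel) = ?n (p + v) x" for x
    using fun_cong[OF conv_normal_density_zero_mean[of "sqrt (p/2)" "sqrt (v/2)"], of x] p v
    by (simp add: ennreal_mult add_divide_distrib)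
  have "(\<integral>\<^sup>+x. ennreal (cgauss_density p (b - x)) * ennreal (cgauss_density v x) \<partial>lborel)
    = (\<integral>\<^sup>+x. \<integral>\<^sup>+y. (?n p (Re b - x) * ?n v x) * (?n p (Im b - y) * ?n v y) \<partial>lborel \<partial>lborel)"
  proof (subst nn_integral_lborel_complex, simp, intro nn_integral_cong)
    fix x y
    have "b - Complex x y = Complex (Re b - x) (Im b - y)" by (simp add: complex_eq_iff)
    then show "ennreal (cgauss_density p (b - Complex x y)) * ennreal (cgauss_density v (Complex x y))
      = (?n p (Re b - x) * ?n v x) * (?n p (Im b - y) * ?n v y)"
      using p v by (simp add: cgauss_density_Complex ennreal_mult mult_ac)
  qed
  also have "\<dots> = (\<integral>\<^sup>+x. (?n p (Re b - x) * ?n v x) \<partial>lborel) * (\<integral>\<^sup>+y. (?n p (Im b - y) * ?n v y) \<partial>lborel)"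
    by (simp add: nn_integral_cmult nn_integral_multc)
  also have "\<dots> = cgauss_density (p + v) b"
    using cgauss_density_Complex[of "p + v" "Re b" "Im b"] p v by (simp add: conv ennreal_mult)
  finally show ?thesis .
qed

lemma nn_integral_cgauss_density_shift:
  assumes p: "p > 0" and v: "v > 0"
  shows "(\<integral>\<^sup>+x. ennreal (cgauss_density p (b - g * x)) \<partial>complex_gaussian v)
    = cgauss_density (p + (cmod g)\<^sup>2 * v) b"
proof (cases "g = 0")
  case True
  interpret prob_space "complex_gaussian v" by (rule prob_space_complex_gaussian[OF v])
  show ?thesis using True emeasure_space_1 by simp
next
  case False
  define q where "q = (cmod g)\<^sup>2 * v"
  have q: "q > 0" using False v by (simp add: q_def)
  \<comment> \<open>Circular symmetry: up to the Jacobian, the density of the input is the density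
    of \<open>g\<close> times the input, a Gaussian whose variance depends on the modulus of
    \<open>g\<close> alone.\<close>
  have dens: "cgauss_density v z = (cmod g)\<^sup>2 * cgauss_density q (g * z)" for z
    using False v by (simp add: cgauss_density_def q_def norm_mult power_mult_distrib field_simps)
  have "(\<integral>\<^sup>+x. ennreal (cgauss_density p (b - g * x)) \<partial>complex_gaussian v)
     = (\<integral>\<^sup>+x. ennreal ((cmod g)\<^sup>2) * (ennreal (cgauss_density p (b - g * x)) * ennreal (cgauss_density q (g * x))) \<partial>lborel)"
    using v q by (simp add: nn_integral_complex_gaussian dens ennreal_mult mult_ac)
  also have "\<dots> = ennreal ((cmod g)\<^sup>2) * (\<integral>\<^sup>+x. (ennreal (cgauss_density p (b - g * x)) * ennreal (cgauss_density q (g * x))) \<partial>lborel)"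
    by (rule nn_integral_cmult) measurable
  also have "\<dots> = (\<integral>\<^sup>+x. (ennreal (cgauss_density p (b - x)) * ennreal (cgauss_density q x)) \<partial>lborel)"
    by (rule nn_integral_lborel_complex_mult[OF False, symmetric]) measurable
  also have "\<dots> = cgauss_density (p + q) b" by (rule cgauss_density_convolution[OF p q])
  finally show ?thesis by (simp add: q_def)
qed

lemma nn_integral_complex_gaussian_add:
  assumes p: "p > 0" and v: "v > 0" and [measurable]: "f \<in> borel_measurable borel"
  shows "(\<integral>\<^sup>+x. \<integral>\<^sup>+z. f (g * x + z) \<partial>complex_gaussian p \<partial>complex_gaussian v)
    = (\<integral>\<^sup>+z. f z \<partial>complex_gaussian (p + (cmod g)\<^sup>2 * v))"
proof -
  interpret V: prob_space "complex_gaussian v" by (rule prob_space_complex_gaussian[OF v])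
  interpret pair_sigma_finite lborel "complex_gaussian v"
    by (rule pair_sigma_finite.intro) (unfold_locales)
  have "(\<integral>\<^sup>+x. \<integral>\<^sup>+z. f (g * x + z) \<partial>complex_gaussian p \<partial>complex_gaussian v)
     = (\<integral>\<^sup>+x. \<integral>\<^sup>+z. ennreal (cgauss_density p (z - g * x)) * f z \<partial>lborel \<partial>complex_gaussian v)"
  proof (intro nn_integral_cong)
    fix x
    have "(\<integral>\<^sup>+z. f (g * x + z) \<partial>complex_gaussian p)
      = (\<integral>\<^sup>+z. ennreal (cgauss_density p z) * f (g * x + z) \<partial>lborel)"
      using p by (simp add: nn_integral_complex_gaussian)
    also have "\<dots> = (\<integral>\<^sup>+z. ennreal (cgauss_density p (z - g * x)) * f (g * x + (z - g * x)) \<partial>lborel)"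
      by (rule nn_integral_lborel_translate[symmetric]) measurable
    finally show "(\<integral>\<^sup>+z. f (g * x + z) \<partial>complex_gaussian p) = (\<integral>\<^sup>+z. ennreal (cgauss_density p (z - g * x)) * f z \<partial>lborel)"
      by simp
  qed
  also have "\<dots> = (\<integral>\<^sup>+z. \<integral>\<^sup>+x. ennreal (cgauss_density p (z - g * x)) * f z \<partial>complex_gaussian v \<partial>lborel)"
    by (rule Fubini') measurable
  also have "\<dots> = (\<integral>\<^sup>+z. ennreal (cgauss_density (p + (cmod g)\<^sup>2 * v) z) * f z \<partial>lborel)"
    by (simp add: nn_integral_multc nn_integral_cgauss_density_shift[OF p v])
  also have "\<dots> = (\<integral>\<^sup>+z. f z \<partial>complex_gaussian (p + (cmod g)\<^sup>2 * v))"
    using p v by (subst nn_integral_complex_gaussian) (auto intro: add_pos_nonneg)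
  finally show ?thesis .
qed

text \<open>Exponential tilting: the weight turns the Gaussian density into
  \<open>1 / (1 - s)\<close> times the one of variance \<open>p / (1 - s)\<close>. In other words,
  the normalised squared modulus is a unit exponential variable.\<close>

lemma nn_integral_exp_cgauss:
  assumes p: "p > 0" and s: "s < 1"
  shows "(\<integral>\<^sup>+z. ennreal (exp (s * (cmod z)\<^sup>2 / p)) \<partial>complex_gaussian p) = ennreal (1 / (1 - s))"
proof -
  have q: "p / (1 - s) > 0" using p s by simp
  interpret prob_space "complex_gaussian (p / (1 - s))" by (rule prob_space_complex_gaussian[OF q])
  have eq: "cgauss_density p z * exp (s * (cmod z)\<^sup>2 / p) = 1 / (1 - s) * cgauss_density (p / (1 - s)) z" for z
  proof -
    have "exp (- (cmod z)\<^sup>2 / p) * exp (s * (cmod z)\<^sup>2 / p) = exp (- (cmod z)\<^sup>2 / (p / (1 - s)))"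
      using s p by (simp add: exp_add[symmetric] field_simps)
    then show ?thesis using s p by (simp add: cgauss_density_def field_simps)
  qed
  have "(\<integral>\<^sup>+z. ennreal (exp (s * (cmod z)\<^sup>2 / p)) \<partial>complex_gaussian p)
    = (\<integral>\<^sup>+z. ennreal (1 / (1 - s)) * ennreal (cgauss_density (p / (1 - s)) z) \<partial>lborel)"
    using p s q by (simp add: nn_integral_complex_gaussian ennreal_mult[symmetric] eq del: times_divide_eq_left)
  also have "\<dots> = ennreal (1 / (1 - s)) * (\<integral>\<^sup>+z. ennreal (cgauss_density (p / (1 - s)) z) * 1 \<partial>lborel)"
    by (subst nn_integral_cmult) auto
  also have "(\<integral>\<^sup>+z. ennreal (cgauss_density (p / (1 - s)) z) * 1 \<partial>lborel) = 1"
    using nn_integral_complex_gaussian[OF q, of "\<lambda>_. 1"] emeasure_space_1 by simp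
  finally show ?thesis by simp
qed

subsection \<open>Independent rows of a product measure\<close>

text \<open>Independence of the rows of a random matrix. The induction splits off one row at a time
  as a factor of the product measure.\<close>

lemma nn_integral_PiM_Times:
  assumes M: "prob_space M" and A: "finite A" and L: "finite L"
    and F: "\<And>a. a \<in> A \<Longrightarrow> F a \<in> borel_measurable (PiM L (\<lambda>_. M))"
  shows "(\<integral>\<^sup>+x. (\<Prod>a\<in>A. F a (\<lambda>k\<in>L. x (a, k))) \<partial>PiM (A \<times> L) (\<lambda>_. M))
    = (\<Prod>a\<in>A. \<integral>\<^sup>+u. F a u \<partial>PiM L (\<lambda>_. M))"
  using A F
proof (induction A rule: finite_induct)
  case empty
  interpret prob_space M by (rule M)
  interpret product_prob_space "\<lambda>_. M" by unfold_locales
  show ?case by (simp add: space_PiM)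
next
  case (insert a A)
  interpret prob_space M by (rule M)
  interpret product_prob_space "\<lambda>_. M" by unfold_locales
  have [measurable]: "F b \<in> borel_measurable (PiM L (\<lambda>_. M))" if "b = a \<or> b \<in> A" for b
    using insert.prems that by auto
  have row [measurable]: "(\<lambda>x. \<lambda>k\<in>L. x (b, k)) \<in> PiM (B \<times> L) (\<lambda>_. M) \<rightarrow>\<^sub>M PiM L (\<lambda>_. M)" if "b \<in> B" for b B
    by (rule measurable_restrict, rule measurable_component_singleton) (use that in auto)
  have distr: "distr (PiM ({a} \<times> L) (\<lambda>_. M)) (PiM L (\<lambda>_. M)) (\<lambda>x. \<lambda>k\<in>L. x (a, k)) = PiM L (\<lambda>_. M)"
    by (rule distr_PiM_reindex[of "{a} \<times> L" "\<lambda>_. M" "\<lambda>k. (a, k)" L]) (auto simp: M inj_on_def)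
  have rows: "(\<lambda>k\<in>L. merge ({a} \<times> L) (A \<times> L) (x, y) (b, k)) = (if b = a then (\<lambda>k\<in>L. x (a, k)) else (\<lambda>k\<in>L. y (b, k)))"
    if "b \<in> insert a A" for b x y
    using that by (auto simp: merge_def fun_eq_iff)
  have "(\<integral>\<^sup>+x. (\<Prod>b\<in>insert a A. F b (\<lambda>k\<in>L. x (b, k))) \<partial>PiM (insert a A \<times> L) (\<lambda>_. M))
    = (\<integral>\<^sup>+x. (\<Prod>b\<in>insert a A. F b (\<lambda>k\<in>L. x (b, k))) \<partial>PiM ({a} \<times> L \<union> A \<times> L) (\<lambda>_. M))"
    by (intro arg_cong2[where f=nn_integral] PiM_cong) auto
  also have "\<dots> = (\<integral>\<^sup>+x. \<integral>\<^sup>+y. (\<Prod>b\<in>insert a A. F b (\<lambda>k\<in>L. merge ({a} \<times> L) (A \<times> L) (x, y) (b, k)))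
      \<partial>PiM (A \<times> L) (\<lambda>_. M) \<partial>PiM ({a} \<times> L) (\<lambda>_. M))"
  proof (rule product_nn_integral_fold)
    show "({a} \<times> L) \<inter> (A \<times> L) = {}" using insert.hyps by auto
    show "(\<lambda>x. \<Prod>b\<in>insert a A. F b (\<lambda>k\<in>L. x (b, k))) \<in> borel_measurable (PiM ({a} \<times> L \<union> A \<times> L) (\<lambda>_. M))"
    proof (intro borel_measurable_prod_ennreal)
      fix b assume b: "b \<in> insert a A"
      have "(\<lambda>x. \<lambda>k\<in>L. x (b, k)) \<in> PiM ({a} \<times> L \<union> A \<times> L) (\<lambda>_. M) \<rightarrow>\<^sub>M PiM L (\<lambda>_. M)"
        by (rule measurable_restrict, rule measurable_component_singleton) (use b in auto)
      then show "(\<lambda>x. F b (\<lambda>k\<in>L. x (b, k))) \<in> borel_measurable (PiM ({a} \<times> L \<union> A \<times> L) (\<lambda>_. M))"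
        by (rule measurable_compose) (rule insert.prems[OF b])
    qed
  qed (use insert.hyps L in auto)
  also have "\<dots> = (\<integral>\<^sup>+x. F a (\<lambda>k\<in>L. x (a, k)) * (\<integral>\<^sup>+y. (\<Prod>b\<in>A. F b (\<lambda>k\<in>L. y (b, k))) \<partial>PiM (A \<times> L) (\<lambda>_. M)) \<partial>PiM ({a} \<times> L) (\<lambda>_. M))"
  proof (intro nn_integral_cong)
    fix x assume "x \<in> space (PiM ({a} \<times> L) (\<lambda>_. M))"
    have "(\<Prod>b\<in>insert a A. F b (\<lambda>k\<in>L. merge ({a} \<times> L) (A \<times> L) (x, y) (b, k)))
       = F a (\<lambda>k\<in>L. x (a, k)) * (\<Prod>b\<in>A. F b (\<lambda>k\<in>L. y (b, k)))" for y
      using insert.hyps by (subst prod.insert) (auto simp: rows intro!: arg_cong2[where f="(*)"] prod.cong)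
    moreover have "(\<lambda>y. \<Prod>b\<in>A. F b (\<lambda>k\<in>L. y (b, k))) \<in> borel_measurable (PiM (A \<times> L) (\<lambda>_. M))"
      by (intro borel_measurable_prod_ennreal measurable_compose[OF row]) auto
    ultimately show "(\<integral>\<^sup>+y. (\<Prod>b\<in>insert a A. F b (\<lambda>k\<in>L. merge ({a} \<times> L) (A \<times> L) (x, y) (b, k))) \<partial>PiM (A \<times> L) (\<lambda>_. M))
      = F a (\<lambda>k\<in>L. x (a, k)) * (\<integral>\<^sup>+y. (\<Prod>b\<in>A. F b (\<lambda>k\<in>L. y (b, k))) \<partial>PiM (A \<times> L) (\<lambda>_. M))"
      by (simp only:) (rule nn_integral_cmult)
  qed
  also have "\<dots> = (\<integral>\<^sup>+x. F a (\<lambda>k\<in>L. x (a, k)) \<partial>PiM ({a} \<times> L) (\<lambda>_. M)) * (\<Prod>b\<in>A. \<integral>\<^sup>+u. F b u \<partial>PiM L (\<lambda>_. M))"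
    using insert.prems
    by (subst nn_integral_multc) (auto intro!: measurable_compose[OF row] simp: insert.IH)
  also have "(\<integral>\<^sup>+x. F a (\<lambda>k\<in>L. x (a, k)) \<partial>PiM ({a} \<times> L) (\<lambda>_. M)) = (\<integral>\<^sup>+u. F a u \<partial>PiM L (\<lambda>_. M))"
    using nn_integral_distr[OF row[of a "{a}"], of "F a"] by (simp add: distr)
  finally show ?case using insert.hyps by simp
qed

text \<open>The injection \<open>f\<close> selects the relevant coordinates and arranges them into
  rows; all other coordinates integrate out. With rows indexed by time, this separates the channel
  uses.\<close>

lemma nn_integral_PiM_rows:
  assumes M: "prob_space M" and A: "finite A" and L: "finite L"
    and f: "inj_on f (A \<times> L)" "f \<in> A \<times> L \<rightarrow> I"
    and F: "\<And>a. a \<in> A \<Longrightarrow> F a \<in> borel_measurable (PiM L (\<lambda>_. M))"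
  shows "(\<integral>\<^sup>+x. (\<Prod>a\<in>A. F a (\<lambda>k\<in>L. x (f (a, k)))) \<partial>PiM I (\<lambda>_. M))
    = (\<Prod>a\<in>A. \<integral>\<^sup>+u. F a u \<partial>PiM L (\<lambda>_. M))"
proof -
  have distr: "distr (PiM I (\<lambda>_. M)) (PiM (A \<times> L) (\<lambda>_. M)) (\<lambda>x. \<lambda>k\<in>A \<times> L. x (f k)) = PiM (A \<times> L) (\<lambda>_. M)"
    by (rule distr_PiM_reindex) (use M f in auto)
  have [measurable]: "(\<lambda>x. \<lambda>k\<in>A \<times> L. x (f k)) \<in> PiM I (\<lambda>_. M) \<rightarrow>\<^sub>M PiM (A \<times> L) (\<lambda>_. M)"
    by (rule measurable_restrict, rule measurable_component_singleton) (use f in auto)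
  have [measurable]: "(\<lambda>x. \<Prod>a\<in>A. F a (\<lambda>k\<in>L. x (a, k))) \<in> borel_measurable (PiM (A \<times> L) (\<lambda>_. M))"
  proof (intro borel_measurable_prod_ennreal)
    fix a assume a: "a \<in> A"
    have "(\<lambda>x. \<lambda>k\<in>L. x (a, k)) \<in> PiM (A \<times> L) (\<lambda>_. M) \<rightarrow>\<^sub>M PiM L (\<lambda>_. M)"
      by (rule measurable_restrict, rule measurable_component_singleton) (use a in auto)
    then show "(\<lambda>x. F a (\<lambda>k\<in>L. x (a, k))) \<in> borel_measurable (PiM (A \<times> L) (\<lambda>_. M))"
      by (rule measurable_compose) (rule F[OF a])
  qed
  have "(\<integral>\<^sup>+x. (\<Prod>a\<in>A. F a (\<lambda>k\<in>L. x (f (a, k)))) \<partial>PiM I (\<lambda>_. M))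
     = (\<integral>\<^sup>+x. (\<Prod>a\<in>A. F a (\<lambda>k\<in>L. (\<lambda>k\<in>A \<times> L. x (f k)) (a, k))) \<partial>PiM I (\<lambda>_. M))"
    by (intro nn_integral_cong prod.cong refl arg_cong2[where f=F]) (auto simp: fun_eq_iff)
  also have "\<dots> = (\<integral>\<^sup>+x. (\<Prod>a\<in>A. F a (\<lambda>k\<in>L. x (a, k))) \<partial>PiM (A \<times> L) (\<lambda>_. M))"
    by (subst distr[symmetric], subst nn_integral_distr) auto
  also have "\<dots> = (\<Prod>a\<in>A. \<integral>\<^sup>+u. F a u \<partial>PiM L (\<lambda>_. M))"
    by (rule nn_integral_PiM_Times[OF M A L F])
  finally show ?thesis .
qed

subsection \<open>Sums of Gaussian inputs\<close>

lemma borel_measurable_linear_PiM [measurable]: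
  fixes c :: "'l \<Rightarrow> complex"
  assumes "A \<subseteq> L"
  shows "(\<lambda>u. \<Sum>k\<in>A. c k * u k) \<in> borel_measurable (PiM L (\<lambda>_. complex_gaussian v))"
proof (rule borel_measurable_sum)
  fix k assume "k \<in> A"
  then have "(\<lambda>u. u k) \<in> PiM L (\<lambda>_. complex_gaussian v) \<rightarrow>\<^sub>M complex_gaussian v"
    using assms by (intro measurable_component_singleton) auto
  then have "(\<lambda>u. u k) \<in> borel_measurable (PiM L (\<lambda>_. complex_gaussian v))"
    by (simp cong: measurable_cong_sets)
  then show "(\<lambda>u. c k * u k) \<in> borel_measurable (PiM L (\<lambda>_. complex_gaussian v))"
    by measurable
qed

lemma nn_integral_PiM_cgauss_density:
  assumes p: "p > 0" and v: "v > 0" and T: "finite T"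
  shows "(\<integral>\<^sup>+u. ennreal (cgauss_density p (b - (\<Sum>k\<in>T. c k * u k))) \<partial>PiM T (\<lambda>_. complex_gaussian v))
    = cgauss_density (p + (\<Sum>k\<in>T. (cmod (c k))\<^sup>2 * v)) b"
  using T
proof (induction T arbitrary: b rule: finite_induct)
  case empty
  interpret prob_space "complex_gaussian v" by (rule prob_space_complex_gaussian[OF v])
  interpret product_prob_space "\<lambda>_. complex_gaussian v" by unfold_locales
  show ?case by (simp add: space_PiM)
next
  case (insert a T)
  interpret prob_space "complex_gaussian v" by (rule prob_space_complex_gaussian[OF v])
  interpret product_prob_space "\<lambda>_. complex_gaussian v" by unfold_locales
  have [measurable]: "(\<lambda>u. \<Sum>k\<in>insert a T. c k * u k) \<in> borel_measurable (PiM (insert a T) (\<lambda>_. complex_gaussian v))"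
    by (rule borel_measurable_linear_PiM) simp
  have sum: "(\<Sum>k\<in>insert a T. c k * (u(a := y)) k) = c a * y + (\<Sum>k\<in>T. c k * u k)" for u y
  proof -
    have "(\<Sum>k\<in>T. c k * (u(a := y)) k) = (\<Sum>k\<in>T. c k * u k)"
      using insert.hyps by (intro sum.cong) auto
    then show ?thesis using insert.hyps by simp
  qed
  have "(\<integral>\<^sup>+u. ennreal (cgauss_density p (b - (\<Sum>k\<in>insert a T. c k * u k))) \<partial>PiM (insert a T) (\<lambda>_. complex_gaussian v))
    = (\<integral>\<^sup>+y. \<integral>\<^sup>+u. ennreal (cgauss_density p (b - c a * y - (\<Sum>k\<in>T. c k * u k))) \<partial>PiM T (\<lambda>_. complex_gaussian v) \<partial>complex_gaussian v)"
    by (subst product_nn_integral_insert_rev) (use insert.hyps in \<open>auto simp: sum diff_diff_eq simp del: sum.insert fun_upd_apply\<close>)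
  also have "\<dots> = (\<integral>\<^sup>+y. ennreal (cgauss_density (p + (\<Sum>k\<in>T. (cmod (c k))\<^sup>2 * v)) (b - c a * y)) \<partial>complex_gaussian v)"
    by (simp add: insert.IH)
  also have "\<dots> = cgauss_density (p + (\<Sum>k\<in>T. (cmod (c k))\<^sup>2 * v) + (cmod (c a))\<^sup>2 * v) b"
    using v p by (intro nn_integral_cgauss_density_shift add_pos_nonneg sum_nonneg) auto
  finally show ?case using insert.hyps by (simp add: ac_simps)
qed

lemma nn_integral_PiM_complex_gaussian_sum:
  assumes p: "p > 0" and v: "v > 0" and A: "finite A" and f [measurable]: "f \<in> borel_measurable borel"
  shows "(\<integral>\<^sup>+z. \<integral>\<^sup>+u. f ((\<Sum>k\<in>A. c k * u k) + z) \<partial>PiM A (\<lambda>_. complex_gaussian v) \<partial>complex_gaussian p)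
    = (\<integral>\<^sup>+z. f z \<partial>complex_gaussian (p + (\<Sum>k\<in>A. (cmod (c k))\<^sup>2 * v)))"
  using A f
proof (induction A arbitrary: f rule: finite_induct)
  case empty
  interpret prob_space "complex_gaussian v" by (rule prob_space_complex_gaussian[OF v])
  interpret product_prob_space "\<lambda>_. complex_gaussian v" by unfold_locales
  show ?case by (simp add: space_PiM)
next
  case (insert a A)
  note [measurable] = \<open>f \<in> borel_measurable borel\<close>
  interpret prob_space "complex_gaussian v" by (rule prob_space_complex_gaussian[OF v])
  interpret PP: prob_space "complex_gaussian p" by (rule prob_space_complex_gaussian[OF p])
  interpret product_prob_space "\<lambda>_. complex_gaussian v" by unfold_locales
  interpret FA: finite_product_sigma_finite "\<lambda>_. complex_gaussian v" A
    by unfold_locales (rule insert.hyps)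
  interpret VP: pair_sigma_finite "complex_gaussian v" "complex_gaussian p" by unfold_locales
  have [measurable]: "(\<lambda>u. \<Sum>k\<in>insert a A. c k * u k) \<in> borel_measurable (PiM (insert a A) (\<lambda>_. complex_gaussian v))"
     "(\<lambda>u. \<Sum>k\<in>A. c k * u k) \<in> borel_measurable (PiM A (\<lambda>_. complex_gaussian v))"
    by (rule borel_measurable_linear_PiM; simp)+
  have sum: "(\<Sum>k\<in>insert a A. c k * (u(a := y)) k) = (\<Sum>k\<in>A. c k * u k) + c a * y" for u y
  proof -
    have "(\<Sum>k\<in>A. c k * (u(a := y)) k) = (\<Sum>k\<in>A. c k * u k)"
      using insert.hyps by (intro sum.cong) auto
    then show ?thesis using insert.hyps by simp
  qed
  have "(\<integral>\<^sup>+z. \<integral>\<^sup>+u. f ((\<Sum>k\<in>insert a A. c k * u k) + z) \<partial>PiM (insert a A) (\<lambda>_. complex_gaussian v) \<partial>complex_gaussian p)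
    = (\<integral>\<^sup>+z. \<integral>\<^sup>+y. \<integral>\<^sup>+u. f ((\<Sum>k\<in>A. c k * u k) + c a * y + z) \<partial>PiM A (\<lambda>_. complex_gaussian v) \<partial>complex_gaussian v \<partial>complex_gaussian p)"
    by (intro nn_integral_cong, subst product_nn_integral_insert_rev) (use insert.hyps in \<open>auto simp: sum simp del: sum.insert fun_upd_apply\<close>)
  also have "\<dots> = (\<integral>\<^sup>+y. \<integral>\<^sup>+z. \<integral>\<^sup>+u. f ((\<Sum>k\<in>A. c k * u k) + (c a * y + z)) \<partial>PiM A (\<lambda>_. complex_gaussian v) \<partial>complex_gaussian p \<partial>complex_gaussian v)"
    by (subst VP.Fubini') (auto simp: add.assoc)
  also have "\<dots> = (\<integral>\<^sup>+z. \<integral>\<^sup>+u. f ((\<Sum>k\<in>A. c k * u k) + z) \<partial>PiM A (\<lambda>_. complex_gaussian v) \<partial>complex_gaussian (p + (cmod (c a))\<^sup>2 * v))"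
    by (rule nn_integral_complex_gaussian_add[OF p v, of "\<lambda>z. \<integral>\<^sup>+u. f ((\<Sum>k\<in>A. c k * u k) + z) \<partial>PiM A (\<lambda>_. complex_gaussian v)"]) measurable
  \<comment> \<open>The summand \<open>c a * y\<close>, just absorbed into the noise, is released
    again in front of the remaining sum, so that the induction hypothesis applies to the translate
    of \<open>f\<close> by \<open>c a * y\<close>.\<close>
  also have "\<dots> = (\<integral>\<^sup>+y. \<integral>\<^sup>+z. f (c a * y + z) \<partial>complex_gaussian (p + (\<Sum>k\<in>A. (cmod (c k))\<^sup>2 * v)) \<partial>complex_gaussian v)"
  proof -
    have "(\<integral>\<^sup>+z. \<integral>\<^sup>+u. f ((\<Sum>k\<in>A. c k * u k) + z) \<partial>PiM A (\<lambda>_. complex_gaussian v) \<partial>complex_gaussian (p + (cmod (c a))\<^sup>2 * v))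
       = (\<integral>\<^sup>+y. \<integral>\<^sup>+z. (\<integral>\<^sup>+u. f (c a * y + ((\<Sum>k\<in>A. c k * u k) + z)) \<partial>PiM A (\<lambda>_. complex_gaussian v)) \<partial>complex_gaussian p \<partial>complex_gaussian v)"
      by (subst nn_integral_complex_gaussian_add[OF p v, symmetric]) (auto simp: ac_simps)
    also have "\<dots> = (\<integral>\<^sup>+y. \<integral>\<^sup>+z. f (c a * y + z) \<partial>complex_gaussian (p + (\<Sum>k\<in>A. (cmod (c k))\<^sup>2 * v)) \<partial>complex_gaussian v)"
      by (intro nn_integral_cong insert.IH) measurable
    finally show ?thesis .
  qed
  also have "\<dots> = (\<integral>\<^sup>+z. f z \<partial>complex_gaussian (p + (\<Sum>k\<in>A. (cmod (c k))\<^sup>2 * v) + (cmod (c a))\<^sup>2 * v))"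
    using v p by (intro nn_integral_complex_gaussian_add add_pos_nonneg sum_nonneg) auto
  finally show ?case using insert.hyps by (simp add: ac_simps)
qed

text \<open>The optimal Chernoff bases for the mean of unit exponential variables, at the levels 1 +
  \<delta> from above and 1 - \<delta> from below.\<close>

definition chernoff_rate :: "real \<Rightarrow> real" where
  "chernoff_rate \<delta> = max ((1 + \<delta>) * exp (- \<delta>)) ((1 - \<delta>) * exp \<delta>)"

lemma chernoff_rate_less_1: "\<delta> \<noteq> 0 \<Longrightarrow> chernoff_rate \<delta> < 1"
proof -
  have less: "(1 + d) * exp (- d) < 1" if "d \<noteq> 0" for d :: real
  proof -
    have "1 + d < exp d" using exp_minus_greater[of "- d"] that by simp
    then have "(1 + d) * exp (- d) < exp d * exp (- d)" by (intro mult_strict_right_mono) auto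
    then show ?thesis by (simp add: exp_add[symmetric])
  qed
  assume "\<delta> \<noteq> 0"
  then show ?thesis using less[of \<delta>] less[of "- \<delta>"] by (simp add: chernoff_rate_def)
qed

lemma chernoff_rate_nonneg: "\<delta> > 0 \<Longrightarrow> chernoff_rate \<delta> \<ge> 0"
  by (simp add: chernoff_rate_def le_max_iff_disj)

section \<open>Averages over messages, thresholds, and the density of the output\<close>

lemma has_bochner_integral_pair_section:
  assumes "prob_space A" "prob_space B" and E [measurable]: "E \<in> sets (A \<Otimes>\<^sub>M B)"
  shows "has_bochner_integral A (\<lambda>x. measure B (Pair x -` E)) (measure (A \<Otimes>\<^sub>M B) E)"
proof (rule has_bochner_integral_nn_integral)
  interpret A: prob_space A by fact
  interpret B: prob_space B by fact
  interpret AB: pair_prob_space A B ..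
  show "(\<lambda>x. measure B (Pair x -` E)) \<in> borel_measurable A"
    using B.measurable_emeasure_Pair[OF E] unfolding measure_def by measurable
  show "(\<integral>\<^sup>+x. ennreal (measure B (Pair x -` E)) \<partial>A) = ennreal (measure (A \<Otimes>\<^sub>M B) E)"
    by (simp add: B.emeasure_pair_measure_alt[OF E] B.emeasure_eq_measure[symmetric] AB.P.emeasure_eq_measure[symmetric])
qed auto

text \<open>Because the message type is countable, measurability of every section already gives
  measurability of the joint event.\<close>

lemma measure_pair_pmf_of_set:
  fixes P :: "'w::countable \<Rightarrow> 'z \<Rightarrow> bool"
  assumes "prob_space B" and W: "finite W" "W \<noteq> {}"
    and P: "\<And>w. Measurable.pred B (P w)"
  shows "measure (measure_pmf (pmf_of_set W) \<Otimes>\<^sub>M B) {(w, z) \<in> UNIV \<times> space B. P w z}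
    = (\<Sum>w\<in>W. measure B {z \<in> space B. P w z}) / real (card W)"
proof -
  interpret B: prob_space B by fact
  let ?E = "{(w, z) \<in> UNIV \<times> space B. P w z}"
  have pair: "pair_prob_space (measure_pmf (pmf_of_set W)) B"
    by (intro pair_prob_space.intro pair_sigma_finite.intro measure_pmf.sigma_finite_measure_axioms
         B.sigma_finite_measure_axioms) (unfold_locales)
  interpret MB: pair_prob_space "measure_pmf (pmf_of_set W)" B by (rule pair)
  have "Measurable.pred (count_space UNIV \<Otimes>\<^sub>M B) (\<lambda>p. P (fst p) (snd p))"
    by (rule measurable_pair_measure_countable1) (use P in auto)
  then have "Measurable.pred (measure_pmf (pmf_of_set W) \<Otimes>\<^sub>M B) (\<lambda>p. P (fst p) (snd p))"
    by (simp cong: measurable_cong_sets sets_pair_measure_cong)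
  then have "{p \<in> space (measure_pmf (pmf_of_set W) \<Otimes>\<^sub>M B). P (fst p) (snd p)} \<in> sets (measure_pmf (pmf_of_set W) \<Otimes>\<^sub>M B)"
    by measurable
  moreover have "{p \<in> space (measure_pmf (pmf_of_set W) \<Otimes>\<^sub>M B). P (fst p) (snd p)} = ?E"
    by (auto simp: space_pair_measure)
  ultimately have E: "?E \<in> sets (measure_pmf (pmf_of_set W) \<Otimes>\<^sub>M B)" by simp
  have sec: "Pair w -` ?E = {z \<in> space B. P w z}" for w by auto
  have "has_bochner_integral (measure_pmf (pmf_of_set W)) (\<lambda>w. measure B {z \<in> space B. P w z}) (measure (measure_pmf (pmf_of_set W) \<Otimes>\<^sub>M B) ?E)"
    using has_bochner_integral_pair_section[OF measure_pmf.prob_space_axioms B.prob_space_axioms E] by (simp add: sec)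
  then have "measure (measure_pmf (pmf_of_set W) \<Otimes>\<^sub>M B) ?E = measure_pmf.expectation (pmf_of_set W) (\<lambda>w. measure B {z \<in> space B. P w z})"
    by (simp add: has_bochner_integral_integral_eq)
  also have "\<dots> = (\<Sum>w\<in>W. measure B {z \<in> space B. P w z}) / real (card W)"
    using W by (rule integral_pmf_of_set[rotated])
  finally show ?thesis .
qed

text \<open>Translates a comparison of noise powers into one of typical likelihoods. The factor
  \<open>exp (real n * (2 * \<delta>))\<close> pays for taking the two likelihoods at opposite ends
  of their typical windows.\<close>

lemma exp_threshold_less:
  fixes a b \<tau> \<delta> :: real
  assumes "a > 0" "b > 0" "\<tau> * exp (real n * (2 * \<delta>)) * a ^ n < b ^ n"
  shows "\<tau> * (exp (- (real n * (1 - \<delta>))) / (pi * b) ^ n) < exp (- (real n * (1 + \<delta>))) / (pi * a) ^ n"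
proof -
  have e: "exp (- (real n * (1 - \<delta>))) = exp (- (real n * (1 + \<delta>))) * exp (real n * (2 * \<delta>))"
    by (simp add: exp_add[symmetric] algebra_simps)
  have "exp (- (real n * (1 + \<delta>))) * (\<tau> * exp (real n * (2 * \<delta>)) * a ^ n) < exp (- (real n * (1 + \<delta>))) * b ^ n"
    using assms(3) by simp
  then show ?thesis using assms(1,2) unfolding e
    by (simp add: power_mult_distrib divide_simps ac_simps)
qed

lemma exp_threshold_le:
  fixes a b \<tau> \<delta> :: real
  assumes "a > 0" "b > 0" "\<tau> * exp (real n * (2 * \<delta>)) * a ^ n \<le> b ^ n"
  shows "\<tau> * (exp (- (real n * (1 - \<delta>))) / (pi * b) ^ n) \<le> exp (- (real n * (1 + \<delta>))) / (pi * a) ^ n"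
proof -
  have e: "exp (- (real n * (1 - \<delta>))) = exp (- (real n * (1 + \<delta>))) * exp (real n * (2 * \<delta>))"
    by (simp add: exp_add[symmetric] algebra_simps)
  have "exp (- (real n * (1 + \<delta>))) * (\<tau> * exp (real n * (2 * \<delta>)) * a ^ n) \<le> exp (- (real n * (1 + \<delta>))) * b ^ n"
    using assms(3) by simp
  then show ?thesis using assms(1,2) unfolding e
    by (simp add: power_mult_distrib divide_simps ac_simps)
qed

text \<open>The law of the shifted noise and the measure with the product density are both the
  product measure \<open>PiM {..<n} M\<close>, since they agree on rectangles.\<close>

lemma nn_integral_gaussian_noise_shift:
  fixes c :: "nat \<Rightarrow> complex"
  assumes f: "f \<in> borel_measurable (PiM {..<n} (\<lambda>_. borel))"
  shows "(\<integral>\<^sup>+z. f (\<lambda>i\<in>{..<n}. c i + z i) \<partial>noise n)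
    = (\<integral>\<^sup>+y. ennreal (\<Prod>i<n. cgauss_density 1 (y i - c i)) * f y \<partial>PiM {..<n} (\<lambda>_. lborel))"
proof -
  define M where "M i = density lborel (\<lambda>y. ennreal (cgauss_density 1 (y - c i)))" for i
  interpret G: prob_space "complex_gaussian 1" by (rule prob_space_complex_gaussian) simp
  interpret PG: product_sigma_finite "\<lambda>_::nat. complex_gaussian 1" by unfold_locales
  interpret FG: finite_product_sigma_finite "\<lambda>_::nat. complex_gaussian 1" "{..<n}" by unfold_locales simp
  interpret PL: product_sigma_finite "\<lambda>_::nat. lborel :: complex measure" by unfold_locales
  have M_eq: "M i = distr (complex_gaussian 1) borel ((+) (c i))" for i
  proof (rule measure_eqI)
    show "sets (M i) = sets (distr (complex_gaussian 1) borel ((+) (c i)))" by (simp add: M_def)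
    fix A assume "A \<in> sets (M i)"
    then have [measurable]: "A \<in> sets borel" by (simp add: M_def)
    have "emeasure (M i) A = (\<integral>\<^sup>+y. ennreal (cgauss_density 1 (y - c i)) * indicator A (c i + (y - c i)) \<partial>lborel)"
      unfolding M_def by (subst emeasure_density) auto
    also have "\<dots> = (\<integral>\<^sup>+y. ennreal (cgauss_density 1 y) * indicator A (c i + y) \<partial>lborel)"
      by (rule nn_integral_lborel_translate) measurable
    also have "\<dots> = (\<integral>\<^sup>+y. indicator A (c i + y) \<partial>complex_gaussian 1)"
      by (subst nn_integral_complex_gaussian) auto
    also have "\<dots> = (\<integral>\<^sup>+y. indicator A y \<partial>distr (complex_gaussian 1) borel ((+) (c i)))"
      by (subst nn_integral_distr) auto
    finally show "emeasure (M i) A = emeasure (distr (complex_gaussian 1) borel ((+) (c i))) A" by simp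
  qed
  have "prob_space (M i)" for i unfolding M_eq by (rule G.prob_space_distr) simp
  then interpret PM: product_sigma_finite M
    by (intro product_sigma_finite.intro prob_space_imp_sigma_finite)
  have "(\<lambda>z. \<lambda>i\<in>{..<n}. c i + z i) \<in> PiM {..<n} (\<lambda>_. complex_gaussian 1) \<rightarrow>\<^sub>M PiM {..<n} (\<lambda>_. borel)"
  proof (rule measurable_restrict)
    fix i assume "i \<in> {..<n}"
    then have "(\<lambda>z. z i) \<in> PiM {..<n} (\<lambda>_. complex_gaussian 1) \<rightarrow>\<^sub>M complex_gaussian 1" by simp
    then have [measurable]: "(\<lambda>z. z i) \<in> borel_measurable (PiM {..<n} (\<lambda>_. complex_gaussian 1))"
      by (simp cong: measurable_cong_sets)
    show "(\<lambda>z. c i + z i) \<in> borel_measurable (PiM {..<n} (\<lambda>_. complex_gaussian 1))" by measurable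
  qed
  then have shift: "(\<lambda>z. \<lambda>i\<in>{..<n}. c i + z i) \<in> noise n \<rightarrow>\<^sub>M PiM {..<n} (\<lambda>_. borel)"
    by (simp add: noise_def)
  have "distr (noise n) (PiM {..<n} (\<lambda>_. borel)) (\<lambda>z. \<lambda>i\<in>{..<n}. c i + z i) = PiM {..<n} M"
  proof (rule PM.PiM_eqI)
    show "sets (distr (noise n) (PiM {..<n} (\<lambda>_. borel)) (\<lambda>z. \<lambda>i\<in>{..<n}. c i + z i)) = sets (PiM {..<n} M)"
      by (auto simp: M_def intro!: sets_PiM_cong)
    fix A assume A: "\<And>i. i \<in> {..<n} \<Longrightarrow> A i \<in> sets (M i)"
    then have A': "A i \<in> sets borel" if "i < n" for i using that by (simp add: M_def)
    have "emeasure (distr (noise n) (PiM {..<n} (\<lambda>_. borel)) (\<lambda>z. \<lambda>i\<in>{..<n}. c i + z i)) (PiE {..<n} A)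
      = emeasure (noise n) ((\<lambda>z. \<lambda>i\<in>{..<n}. c i + z i) -` PiE {..<n} A \<inter> space (noise n))"
      by (rule emeasure_distr[OF shift], rule sets_PiM_I_finite) (use A' in auto)
    also have "(\<lambda>z. \<lambda>i\<in>{..<n}. c i + z i) -` PiE {..<n} A \<inter> space (noise n)
      = PiE {..<n} (\<lambda>i. (+) (c i) -` A i)"
      by (rule set_eqI) (simp add: noise_def space_PiM PiE_iff)
    also have "emeasure (noise n) (PiE {..<n} (\<lambda>i. (+) (c i) -` A i))
      = emeasure (PiM {..<n} (\<lambda>_. complex_gaussian 1)) (PiE {..<n} (\<lambda>i. (+) (c i) -` A i))"
      by (simp only: noise_def)
    also have "\<dots> = (\<Prod>i<n. emeasure (complex_gaussian 1) ((+) (c i) -` A i))"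
    proof (rule FG.measure_times)
      fix i assume "i \<in> {..<n}"
      then have "(+) (c i) -` A i \<inter> space borel \<in> sets borel"
        using A' by (intro measurable_sets[of _ borel borel]) auto
      then show "(+) (c i) -` A i \<in> sets (complex_gaussian 1)" by simp
    qed
    also have "\<dots> = (\<Prod>i<n. emeasure (M i) (A i))"
      using A' by (intro prod.cong refl) (simp add: M_eq emeasure_distr)
    finally show "emeasure (distr (noise n) (PiM {..<n} (\<lambda>_. borel)) (\<lambda>z. \<lambda>i\<in>{..<n}. c i + z i)) (PiE {..<n} A)
      = (\<Prod>i<n. emeasure (M i) (A i))" .
  qed simp
  moreover have dens_m: "(\<lambda>y. ennreal (\<Prod>i<n. cgauss_density 1 (y i - c i))) \<in> borel_measurable (PiM {..<n} (\<lambda>_. lborel))"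
  proof (intro measurable_compose[OF _ measurable_ennreal] borel_measurable_prod)
    fix i assume "i \<in> {..<n}"
    then have "(\<lambda>y. y i) \<in> PiM {..<n} (\<lambda>_. lborel) \<rightarrow>\<^sub>M (lborel :: complex measure)"
      by (rule measurable_component_singleton)
    then have [measurable]: "(\<lambda>y. y i) \<in> borel_measurable (PiM {..<n} (\<lambda>_. lborel :: complex measure))"
      by simp
    show "(\<lambda>y. cgauss_density 1 (y i - c i)) \<in> borel_measurable (PiM {..<n} (\<lambda>_. lborel))"
      by measurable
  qed
  moreover have "density (PiM {..<n} (\<lambda>_. lborel)) (\<lambda>y. ennreal (\<Prod>i<n. cgauss_density 1 (y i - c i))) = PiM {..<n} M"
  proof (rule PM.PiM_eqI)
    show "sets (density (PiM {..<n} (\<lambda>_. lborel)) (\<lambda>y. ennreal (\<Prod>i<n. cgauss_density 1 (y i - c i)))) = sets (PiM {..<n} M)"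
      by (auto simp: M_def intro!: sets_PiM_cong)
    fix A assume A: "\<And>i. i \<in> {..<n} \<Longrightarrow> A i \<in> sets (M i)"
    then have A' [measurable]: "A i \<in> sets borel" if "i < n" for i using that by (simp add: M_def)
    have "emeasure (density (PiM {..<n} (\<lambda>_. lborel)) (\<lambda>y. ennreal (\<Prod>i<n. cgauss_density 1 (y i - c i)))) (PiE {..<n} A)
      = (\<integral>\<^sup>+y. ennreal (\<Prod>i<n. cgauss_density 1 (y i - c i)) * indicator (PiE {..<n} A) y \<partial>PiM {..<n} (\<lambda>_. lborel))"
      by (rule emeasure_density[OF dens_m]) (auto intro!: sets_PiM_I_finite A')
    also have "\<dots> = (\<integral>\<^sup>+y. (\<Prod>i<n. ennreal (cgauss_density 1 (y i - c i)) * indicator (A i) (y i)) \<partial>PiM {..<n} (\<lambda>_. lborel))"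
    proof (intro nn_integral_cong)
      fix y :: "nat \<Rightarrow> complex" assume "y \<in> space (PiM {..<n} (\<lambda>_. lborel))"
      then have "indicator (PiE {..<n} A) y = (\<Prod>i<n. indicator (A i) (y i) :: ennreal)"
        by (auto simp: indicator_def space_PiM PiE_def Pi_def)
      then show "ennreal (\<Prod>i<n. cgauss_density 1 (y i - c i)) * indicator (PiE {..<n} A) y
        = (\<Prod>i<n. ennreal (cgauss_density 1 (y i - c i)) * indicator (A i) (y i))"
        by (simp add: prod.distrib prod_ennreal)
    qed
    also have "\<dots> = (\<Prod>i<n. \<integral>\<^sup>+y. ennreal (cgauss_density 1 (y - c i)) * indicator (A i) y \<partial>lborel)"
      by (rule PL.product_nn_integral_prod) auto
    also have "\<dots> = (\<Prod>i<n. emeasure (M i) (A i))"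
      unfolding M_def by (intro prod.cong refl emeasure_density[symmetric]) auto
    finally show "emeasure (density (PiM {..<n} (\<lambda>_. lborel)) (\<lambda>y. ennreal (\<Prod>i<n. cgauss_density 1 (y i - c i)))) (PiE {..<n} A)
      = (\<Prod>i<n. emeasure (M i) (A i))" .
  qed simp
  ultimately have eq: "distr (noise n) (PiM {..<n} (\<lambda>_. borel)) (\<lambda>z. \<lambda>i\<in>{..<n}. c i + z i)
     = density (PiM {..<n} (\<lambda>_. lborel)) (\<lambda>y. ennreal (\<Prod>i<n. cgauss_density 1 (y i - c i)))"
    by simp
  have f': "f \<in> borel_measurable (PiM {..<n} (\<lambda>_. lborel))"
    using f by (simp cong: measurable_cong_sets sets_PiM_cong)
  have "(\<integral>\<^sup>+z. f (\<lambda>i\<in>{..<n}. c i + z i) \<partial>noise n)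
    = (\<integral>\<^sup>+y. f y \<partial>distr (noise n) (PiM {..<n} (\<lambda>_. borel)) (\<lambda>z. \<lambda>i\<in>{..<n}. c i + z i))"
    by (rule nn_integral_distr[symmetric, OF shift]) (use f in \<open>simp cong: measurable_cong_sets\<close>)
  also have "\<dots> = (\<integral>\<^sup>+y. ennreal (\<Prod>i<n. cgauss_density 1 (y i - c i)) * f y \<partial>PiM {..<n} (\<lambda>_. lborel))"
    unfolding eq by (rule nn_integral_density[OF dens_m f'])
  finally show ?thesis .
qed

subsection \<open>The channel seen by one receiver\<close>

text \<open>One receiver at one block length. All bounds inside are nonasymptotic and hold for
  arbitrary positive message counts \<open>N\<close>; rates and rounding enter only when the locale
  is interpreted.\<close>

locale receiver =
  fixes h :: "'k::finite \<Rightarrow> complex" and v :: real and n :: nat and N :: "'k \<Rightarrow> nat"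
  assumes v_pos: "v > 0" and N_pos: "\<And>l. N l \<ge> 1"
begin

definition codebook :: "'k codebooks measure" where
  "codebook = PiM (SIGMA l:UNIV. {1..N l} \<times> {..<n}) (\<lambda>_. complex_gaussian v)"

definition msgs :: "('k \<Rightarrow> nat) set" where
  "msgs = {w. \<forall>l. w l \<in> {1..N l}}"

definition chan_out :: "'k codebooks \<Rightarrow> ('k \<Rightarrow> nat) \<Rightarrow> (nat \<Rightarrow> complex) \<Rightarrow> nat \<Rightarrow> complex" where
  "chan_out x w z = (\<lambda>i\<in>{..<n}. (\<Sum>l\<in>UNIV. h l * x (l, w l, i)) + z i)"

definition noise_power :: "'k set \<Rightarrow> real" where
  "noise_power U = 1 + (\<Sum>l\<in>U. (cmod (h l))\<^sup>2 * v)"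

definition residual :: "'k set \<Rightarrow> 'k codebooks \<Rightarrow> ('k \<Rightarrow> nat) \<Rightarrow> (nat \<Rightarrow> complex) \<Rightarrow> nat \<Rightarrow> complex" where
  "residual U x w y i = y i - (\<Sum>l\<in>-U. h l * x (l, w l, i))"

definition energy :: "'k set \<Rightarrow> 'k codebooks \<Rightarrow> ('k \<Rightarrow> nat) \<Rightarrow> (nat \<Rightarrow> complex) \<Rightarrow> real" where
  "energy U x w y = (\<Sum>i<n. (cmod (residual U x w y i))\<^sup>2 / noise_power U)"

text \<open>Likelihood of the messages of the users outside \<open>U\<close> when the users in \<open>U\<close> are treated as
  Gaussian noise.\<close>

definition lik :: "'k set \<Rightarrow> 'k codebooks \<Rightarrow> ('k \<Rightarrow> nat) \<Rightarrow> (nat \<Rightarrow> complex) \<Rightarrow> real" where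
  "lik U x w y = (\<Prod>i<n. cgauss_density (noise_power U) (residual U x w y i))"

abbreviation joint :: "('k codebooks \<times> (nat \<Rightarrow> complex)) measure" where
  "joint \<equiv> codebook \<Otimes>\<^sub>M noise n"

lemma noise_power_ge_1: "noise_power U \<ge> 1"
  using v_pos by (simp add: noise_power_def sum_nonneg)

lemma noise_power_pos [simp]: "noise_power U > 0"
  using noise_power_ge_1[of U] by linarith

lemma noise_power_union: "U \<subseteq> V \<Longrightarrow> noise_power V = noise_power U + (\<Sum>l\<in>V - U. (cmod (h l))\<^sup>2 * v)"
  by (simp add: noise_power_def sum.subset_diff[of U V])

lemma lik_pos: "lik U x w y > 0"
  unfolding lik_def by (intro prod_pos ballI cgauss_density_pos) simp

lemma lik_eq_exp_energy: "lik U x w y = exp (- energy U x w y) / (pi * noise_power U) ^ n"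
  by (simp add: lik_def energy_def cgauss_density_def prod_dividef exp_sum[symmetric] sum_negf)

lemma finite_msgs [simp]: "finite msgs"
proof -
  have "msgs = PiE UNIV (\<lambda>l. {1..N l})" by (auto simp: msgs_def PiE_UNIV_domain)
  then show ?thesis by (simp add: finite_PiE)
qed

lemma residual_cong: "(\<And>l. l \<notin> U \<Longrightarrow> w l = w' l) \<Longrightarrow> residual U x w y = residual U x w' y"
  by (auto simp: residual_def fun_eq_iff intro!: sum.cong)

lemma lik_cong: "(\<And>l. l \<notin> U \<Longrightarrow> w l = w' l) \<Longrightarrow> lik U x w y = lik U x w' y"
  using residual_cong[of U w w' x y] by (simp add: lik_def)

lemma prob_space_codebook: "prob_space codebook"
  unfolding codebook_def using v_pos by (intro prob_space_PiM prob_space_complex_gaussian)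

lemma prob_space_noise: "prob_space (noise n)"
  unfolding noise_def by (intro prob_space_PiM prob_space_complex_gaussian) simp

sublocale CB: prob_space codebook by (rule prob_space_codebook)
sublocale NZ: prob_space "noise n" by (rule prob_space_noise)
sublocale J: pair_prob_space codebook "noise n" ..

section \<open>Measurability of outputs, likelihoods and energies\<close>

lemma measurable_coordinate [measurable]:
  assumes "w \<in> msgs" "i < n"
  shows "(\<lambda>x. x (l, w l, i)) \<in> borel_measurable codebook"
proof -
  have "(\<lambda>x. x (l, w l, i)) \<in> codebook \<rightarrow>\<^sub>M complex_gaussian v"
    unfolding codebook_def by (rule measurable_component_singleton) (use assms in \<open>auto simp: msgs_def\<close>)
  then show ?thesis by (simp cong: measurable_cong_sets)
qed

lemma measurable_noise_coordinate [measurable]: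
  assumes "i < n"
  shows "(\<lambda>z. z i) \<in> borel_measurable (noise n)"
proof -
  have "(\<lambda>z. z i) \<in> noise n \<rightarrow>\<^sub>M complex_gaussian 1"
    unfolding noise_def by (rule measurable_component_singleton) (use assms in auto)
  then show ?thesis by (simp cong: measurable_cong_sets)
qed

lemma measurable_output [measurable]:
  assumes w [measurable]: "w \<in> msgs"
  shows "(\<lambda>p. chan_out (fst p) w (snd p)) \<in> joint \<rightarrow>\<^sub>M PiM {..<n} (\<lambda>_. borel)"
  unfolding chan_out_def
proof (rule measurable_restrict)
  fix i assume "i \<in> {..<n}"
  then have [measurable]: "i < n" by simp
  show "(\<lambda>p. (\<Sum>l\<in>UNIV. h l * fst p (l, w l, i)) + snd p i) \<in> borel_measurable joint"
    by measurable
qed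

lemma measurable_residual [measurable]:
  assumes w [measurable]: "w \<in> msgs" and i [measurable]: "i < n"
  shows "(\<lambda>p. residual U (fst p) w (snd p) i) \<in> borel_measurable (codebook \<Otimes>\<^sub>M PiM {..<n} (\<lambda>_. borel))"
proof -
  have [measurable]: "(\<lambda>y. y i) \<in> borel_measurable (PiM {..<n} (\<lambda>_. borel :: complex measure))"
    using i by (intro measurable_component_singleton) auto
  show ?thesis unfolding residual_def by measurable
qed

lemma measurable_lik [measurable]:
  assumes w [measurable]: "w \<in> msgs"
  shows "(\<lambda>p. lik U (fst p) w (snd p)) \<in> borel_measurable (codebook \<Otimes>\<^sub>M PiM {..<n} (\<lambda>_. borel))"
  unfolding lik_def
proof (intro borel_measurable_prod)
  fix i assume "i \<in> {..<n}"
  then have [measurable]: "i < n" by simp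
  show "(\<lambda>p. cgauss_density (noise_power U) (residual U (fst p) w (snd p) i)) \<in> borel_measurable (codebook \<Otimes>\<^sub>M PiM {..<n} (\<lambda>_. borel))"
    by measurable
qed

lemma measurable_energy [measurable]:
  assumes w [measurable]: "w \<in> msgs"
  shows "(\<lambda>p. energy U (fst p) w (snd p)) \<in> borel_measurable (codebook \<Otimes>\<^sub>M PiM {..<n} (\<lambda>_. borel))"
  unfolding energy_def
proof (intro borel_measurable_sum)
  fix i assume "i \<in> {..<n}"
  then have [measurable]: "i < n" by simp
  show "(\<lambda>p. (cmod (residual U (fst p) w (snd p) i))\<^sup>2 / noise_power U) \<in> borel_measurable (codebook \<Otimes>\<^sub>M PiM {..<n} (\<lambda>_. borel))"
    by measurable
qed

lemma measurable_pair_output [measurable]: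
  assumes [measurable]: "w \<in> msgs"
  shows "(\<lambda>p. (fst p, chan_out (fst p) w (snd p))) \<in> joint \<rightarrow>\<^sub>M codebook \<Otimes>\<^sub>M PiM {..<n} (\<lambda>_. borel)"
  by measurable

lemma measurable_lik_output [measurable]:
  assumes "w \<in> msgs" "w' \<in> msgs"
  shows "(\<lambda>p. lik U (fst p) w' (chan_out (fst p) w (snd p))) \<in> borel_measurable joint"
  using measurable_compose[OF measurable_pair_output[OF assms(1)] measurable_lik[OF assms(2), of U]] by simp

lemma measurable_energy_output [measurable]:
  assumes "w \<in> msgs" "w' \<in> msgs"
  shows "(\<lambda>p. energy U (fst p) w' (chan_out (fst p) w (snd p))) \<in> borel_measurable joint"
  using measurable_compose[OF measurable_pair_output[OF assms(1)] measurable_energy[OF assms(2), of U]] by simp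

text \<open>Single-letterization. The symbols at different times are independent and identically
  distributed, which gives the n-th power; \<open>L1\<close> and \<open>L2\<close> name disjoint
  sets of codewords, so within one symbol the two sums are independent and the integral becomes
  iterated.\<close>

lemma nn_integral_joint_prod:
  assumes L: "L1 \<subseteq> (SIGMA l:UNIV. {1..N l})" "L2 \<subseteq> (SIGMA l:UNIV. {1..N l})" "L1 \<inter> L2 = {}"
    and H [measurable]: "case_prod H \<in> borel_measurable (borel \<Otimes>\<^sub>M borel)"
  shows "(\<integral>\<^sup>+p. (\<Prod>i<n. H ((\<Sum>k\<in>L1. h (fst k) * fst p (fst k, snd k, i)) + snd p i)
              (\<Sum>k\<in>L2. h (fst k) * fst p (fst k, snd k, i))) \<partial>joint)
    = (\<integral>\<^sup>+z. \<integral>\<^sup>+u. \<integral>\<^sup>+u'. H ((\<Sum>k\<in>L1. h (fst k) * u k) + z) (\<Sum>k\<in>L2. h (fst k) * u' k)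
        \<partial>PiM L2 (\<lambda>_. complex_gaussian v) \<partial>PiM L1 (\<lambda>_. complex_gaussian v) \<partial>complex_gaussian 1) ^ n"
proof -
  interpret V: prob_space "complex_gaussian v" by (rule prob_space_complex_gaussian[OF v_pos])
  interpret U: prob_space "complex_gaussian 1" by (rule prob_space_complex_gaussian) simp
  interpret PV: product_prob_space "\<lambda>_. complex_gaussian v" by unfold_locales
  interpret PU: product_sigma_finite "\<lambda>_::nat. complex_gaussian 1" by unfold_locales
  define L where "L = L1 \<union> L2"
  have "finite (SIGMA l:(UNIV::'k set). {1..N l})" by simp
  then have fin [simp]: "finite L1" "finite L2" "finite L"
    using L by (auto simp: L_def intro: finite_subset)
  interpret FL1: finite_product_sigma_finite "\<lambda>_. complex_gaussian v" L1 by unfold_locales simp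
  interpret FL2: finite_product_sigma_finite "\<lambda>_. complex_gaussian v" L2 by unfold_locales simp
  interpret FL: finite_product_sigma_finite "\<lambda>_. complex_gaussian v" L by unfold_locales simp
  define c where "c k = h (fst k)" for k :: "'k \<times> nat"
  have lin [measurable]: "(\<lambda>u. \<Sum>k\<in>L1. c k * u k) \<in> borel_measurable (PiM L (\<lambda>_. complex_gaussian v))"
    "(\<lambda>u. \<Sum>k\<in>L2. c k * u k) \<in> borel_measurable (PiM L (\<lambda>_. complex_gaussian v))"
    "(\<lambda>u. \<Sum>k\<in>L1. c k * u k) \<in> borel_measurable (PiM L1 (\<lambda>_. complex_gaussian v))"
    "(\<lambda>u. \<Sum>k\<in>L2. c k * u k) \<in> borel_measurable (PiM L2 (\<lambda>_. complex_gaussian v))"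
    by (rule borel_measurable_linear_PiM; simp add: L_def)+
  have Hm [measurable (raw)]: "(\<lambda>p. H (f p) (g p)) \<in> borel_measurable M"
    if "f \<in> borel_measurable M" "g \<in> borel_measurable M" for M :: "'z measure" and f g
  proof -
    have "(\<lambda>p. case_prod H (f p, g p)) \<in> borel_measurable M" using that by measurable
    then show ?thesis by simp
  qed
  have coord: "(\<lambda>p. fst p (fst k, snd k, i)) \<in> borel_measurable joint" if "k \<in> L" "i < n" for k i
  proof -
    have "(\<lambda>x. x (fst k, snd k, i)) \<in> codebook \<rightarrow>\<^sub>M complex_gaussian v"
      unfolding codebook_def by (rule measurable_component_singleton) (use that L in \<open>auto simp: L_def\<close>)
    then show ?thesis by (auto cong: measurable_cong_sets intro: measurable_compose[OF measurable_fst])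
  qed
  let ?f = "\<lambda>x (z :: nat \<Rightarrow> complex). \<Prod>i<n. H ((\<Sum>k\<in>L1. c k * x (fst k, snd k, i)) + z i) (\<Sum>k\<in>L2. c k * x (fst k, snd k, i))"
  define \<Psi> where "\<Psi> z = (\<integral>\<^sup>+u. H ((\<Sum>k\<in>L1. c k * u k) + z) (\<Sum>k\<in>L2. c k * u k) \<partial>PiM L (\<lambda>_. complex_gaussian v))" for z
  have [measurable]: "\<Psi> \<in> borel_measurable borel"
    unfolding \<Psi>_def by measurable
  then have \<Psi>_meas: "\<Psi> \<in> borel_measurable (complex_gaussian 1)"
    by (simp cong: measurable_cong_sets)
  have meas: "(\<lambda>p. ?f (fst p) (snd p)) \<in> borel_measurable joint"
  proof (intro borel_measurable_prod_ennreal Hm borel_measurable_add borel_measurable_sum borel_measurable_times borel_measurable_const)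
    fix i k assume *: "i \<in> {..<n}"
    show "k \<in> L1 \<Longrightarrow> (\<lambda>p. fst p (fst k, snd k, i)) \<in> borel_measurable joint"
      "k \<in> L2 \<Longrightarrow> (\<lambda>p. fst p (fst k, snd k, i)) \<in> borel_measurable joint"
      using * by (auto intro!: coord simp: L_def)
    have [measurable]: "i < n" using * by simp
    show "(\<lambda>p. snd p i) \<in> borel_measurable joint" by measurable
  qed
  have "(\<integral>\<^sup>+p. ?f (fst p) (snd p) \<partial>joint) = (\<integral>\<^sup>+z. \<integral>\<^sup>+x. ?f x z \<partial>codebook \<partial>noise n)"
    using meas by (subst J.nn_integral_snd[symmetric]) (auto simp: case_prod_beta')
  also have "\<dots> = (\<integral>\<^sup>+z. (\<Prod>i<n. \<Psi> (z i)) \<partial>noise n)"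
  proof (intro nn_integral_cong)
    fix z :: "nat \<Rightarrow> complex"
    let ?F = "\<lambda>i u. H ((\<Sum>k\<in>L1. c k * u k) + z i) (\<Sum>k\<in>L2. c k * u k)"
    \<comment> \<open>The codebook is transposed: the time index, last in a codebook entry, becomes
      the row index.\<close>
    have "(\<integral>\<^sup>+x. ?f x z \<partial>codebook) = (\<integral>\<^sup>+x. (\<Prod>i<n. ?F i (\<lambda>k\<in>L. x ((\<lambda>(i, k). (fst k, snd k, i)) (i, k)))) \<partial>codebook)"
      by (intro nn_integral_cong prod.cong refl arg_cong2[where f=H] arg_cong2[where f="(+)"] sum.cong) (auto simp: L_def)
    also have "\<dots> = (\<Prod>i<n. \<Psi> (z i))"
      unfolding codebook_def \<Psi>_def
      by (rule nn_integral_PiM_rows[OF prob_space_complex_gaussian[OF v_pos]])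
         (use L in \<open>auto simp: inj_on_def L_def[symmetric]\<close>, use L in \<open>auto simp: L_def\<close>)
    finally show "(\<integral>\<^sup>+x. ?f x z \<partial>codebook) = (\<Prod>i<n. \<Psi> (z i))" .
  qed
  also have "\<dots> = (\<integral>\<^sup>+z. \<Psi> z \<partial>complex_gaussian 1) ^ n"
    unfolding noise_def by (subst PU.product_nn_integral_prod[of "{..<n}" "\<lambda>_. \<Psi>"]) (simp_all add: \<Psi>_meas)
  also have "\<Psi> = (\<lambda>z. \<integral>\<^sup>+u. \<integral>\<^sup>+u'. H ((\<Sum>k\<in>L1. c k * u k) + z) (\<Sum>k\<in>L2. c k * u' k)
        \<partial>PiM L2 (\<lambda>_. complex_gaussian v) \<partial>PiM L1 (\<lambda>_. complex_gaussian v))"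
  proof
    fix z
    have m: "(\<lambda>u. H ((\<Sum>k\<in>L1. c k * u k) + z) (\<Sum>k\<in>L2. c k * u k)) \<in> borel_measurable (PiM (L1 \<union> L2) (\<lambda>_. complex_gaussian v))"
      unfolding L_def[symmetric] by measurable
    have "(\<Sum>k\<in>L1. c k * merge L1 L2 (u, u') k) = (\<Sum>k\<in>L1. c k * u k)"
      "(\<Sum>k\<in>L2. c k * merge L1 L2 (u, u') k) = (\<Sum>k\<in>L2. c k * u' k)" for u u'
      using L(3) by (auto intro!: sum.cong simp: merge_def)
    then show "\<Psi> z = (\<integral>\<^sup>+u. \<integral>\<^sup>+u'. H ((\<Sum>k\<in>L1. c k * u k) + z) (\<Sum>k\<in>L2. c k * u' k)
        \<partial>PiM L2 (\<lambda>_. complex_gaussian v) \<partial>PiM L1 (\<lambda>_. complex_gaussian v))"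
      unfolding \<Psi>_def L_def by (subst PV.product_nn_integral_fold[OF L(3) fin(1,2) m]) simp
  qed
  finally show ?thesis by (simp add: c_def)
qed

text \<open>Users outside \<open>V\<close> cancel, since \<open>w'\<close> is right about them. What
  remains is the residual of the true tuple with \<open>V\<close> as noise, minus the false
  codewords on \<open>V - U\<close>.\<close>

lemma residual_output:
  assumes "i < n" "U \<subseteq> V" "\<And>l. l \<notin> V - U \<Longrightarrow> w' l = w l"
  shows "residual U x w' (chan_out x w z) i
    = (\<Sum>l\<in>V. h l * x (l, w l, i)) + z i - (\<Sum>l\<in>V - U. h l * x (l, w' l, i))"
proof -
  have "(\<Sum>l\<in>UNIV. h l * x (l, w l, i)) = (\<Sum>l\<in>V. h l * x (l, w l, i)) + (\<Sum>l\<in>-V. h l * x (l, w l, i))"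
    using sum.subset_diff[of V UNIV "\<lambda>l. h l * x (l, w l, i)"] by (simp add: Compl_eq_Diff_UNIV)
  moreover have "- U = - V \<union> (V - U)" using assms(2) by auto
  then have "(\<Sum>l\<in>-U. h l * x (l, w' l, i)) = (\<Sum>l\<in>-V. h l * x (l, w' l, i)) + (\<Sum>l\<in>V - U. h l * x (l, w' l, i))"
    by (simp only:) (rule sum.union_disjoint, auto)
  moreover have "(\<Sum>l\<in>-V. h l * x (l, w' l, i)) = (\<Sum>l\<in>-V. h l * x (l, w l, i))"
    using assms(3) by (intro sum.cong) auto
  ultimately show ?thesis using assms(1) by (simp add: residual_def chan_out_def)
qed

lemma residual_output_self:
  "i < n \<Longrightarrow> residual V x w (chan_out x w z) i = (\<Sum>l\<in>V. h l * x (l, w l, i)) + z i"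
  using residual_output[of i V V w w] by simp

text \<open>Integrating out the independent codewords of \<open>w'\<close> turns the numerator into the denominator.\<close>

lemma nn_integral_lik_ratio:
  assumes w: "w \<in> msgs" "w' \<in> msgs" and UV: "U \<subseteq> V"
    and eq: "\<And>l. l \<notin> V - U \<Longrightarrow> w' l = w l" and neq: "\<And>l. l \<in> V - U \<Longrightarrow> w' l \<noteq> w l"
  shows "(\<integral>\<^sup>+p. ennreal (lik U (fst p) w' (chan_out (fst p) w (snd p)) / lik V (fst p) w (chan_out (fst p) w (snd p))) \<partial>joint) = 1"
proof -
  let ?H = "\<lambda>b a. ennreal (cgauss_density (noise_power U) (b - a) / cgauss_density (noise_power V) b)"
  interpret V: prob_space "complex_gaussian v" by (rule prob_space_complex_gaussian[OF v_pos])
  interpret U: prob_space "complex_gaussian 1" by (rule prob_space_complex_gaussian) simp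
  define L1 where "L1 = (\<lambda>l. (l, w l)) ` V"
  interpret PL: prob_space "PiM L1 (\<lambda>_. complex_gaussian v)"
    by (intro prob_space_PiM V.prob_space_axioms)
  define L2 where "L2 = (\<lambda>l. (l, w' l)) ` (V - U)"
  have sumL: "(\<Sum>k\<in>L1. f k) = (\<Sum>l\<in>V. f (l, w l))" "(\<Sum>k\<in>L2. f k) = (\<Sum>l\<in>V - U. f (l, w' l))"
    for f :: "'k \<times> nat \<Rightarrow> 'z::comm_monoid_add"
    unfolding L1_def L2_def by (subst sum.reindex; auto simp: inj_on_def)+
  \<comment> \<open>Exact disagreement on \<open>V - U\<close> enters here: the false codewords are
    other entries of the codebook than the true ones, hence independent of them.\<close>
  have disj: "L1 \<inter> L2 = {}"
  proof (rule equals0I)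
    fix k assume "k \<in> L1 \<inter> L2"
    then obtain l where "l \<in> V - U" "w' l = w l" by (auto simp: L1_def L2_def)
    with neq show False by blast
  qed
  have sub: "L1 \<subseteq> (SIGMA l:UNIV. {1..N l})" "L2 \<subseteq> (SIGMA l:UNIV. {1..N l})"
    using w by (auto simp: L1_def L2_def msgs_def)
  have res: "residual U x w' (chan_out x w z) i
      = (\<Sum>l\<in>V. h l * x (l, w l, i)) + z i - (\<Sum>l\<in>V - U. h l * x (l, w' l, i))" if "i < n" for x z i
    using that UV eq by (rule residual_output)
  have inner: "(\<integral>\<^sup>+u'. ?H b (\<Sum>k\<in>L2. h (fst k) * u' k) \<partial>PiM L2 (\<lambda>_. complex_gaussian v)) = 1" for b
  proof -
    have [measurable]: "(\<lambda>u. \<Sum>k\<in>L2. h (fst k) * u k) \<in> borel_measurable (PiM L2 (\<lambda>_. complex_gaussian v))"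
      by (rule borel_measurable_linear_PiM) simp
    have pos: "cgauss_density (noise_power V) b > 0" by (rule cgauss_density_pos) simp
    have "(\<integral>\<^sup>+u'. ?H b (\<Sum>k\<in>L2. h (fst k) * u' k) \<partial>PiM L2 (\<lambda>_. complex_gaussian v))
      = (\<integral>\<^sup>+u'. ennreal (1 / cgauss_density (noise_power V) b) * ennreal (cgauss_density (noise_power U) (b - (\<Sum>k\<in>L2. h (fst k) * u' k))) \<partial>PiM L2 (\<lambda>_. complex_gaussian v))"
      using pos by (simp add: ennreal_mult[symmetric] less_imp_le)
    also have "\<dots> = ennreal (1 / cgauss_density (noise_power V) b)
        * ennreal (cgauss_density (noise_power U + (\<Sum>k\<in>L2. (cmod (h (fst k)))\<^sup>2 * v)) b)"
      by (subst nn_integral_cmult, simp, subst nn_integral_PiM_cgauss_density) (auto simp: v_pos L2_def)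
    also have "noise_power U + (\<Sum>k\<in>L2. (cmod (h (fst k)))\<^sup>2 * v) = noise_power V"
      by (simp add: sumL noise_power_union[OF UV])
    also have "ennreal (1 / cgauss_density (noise_power V) b) * ennreal (cgauss_density (noise_power V) b) = 1"
      using pos by (simp add: ennreal_mult[symmetric])
    finally show ?thesis .
  qed
  have "ennreal (lik U x w' (chan_out x w z) / lik V x w (chan_out x w z))
     = (\<Prod>i<n. ?H ((\<Sum>k\<in>L1. h (fst k) * x (fst k, snd k, i)) + z i) (\<Sum>k\<in>L2. h (fst k) * x (fst k, snd k, i)))" for x z
    unfolding lik_def prod_dividef[symmetric]
    by (subst prod_ennreal[symmetric])
       (auto intro!: divide_nonneg_nonneg cgauss_density_nonneg less_imp_le[OF noise_power_pos] prod.cong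
             simp: sumL residual_output_self res)
  then have "(\<integral>\<^sup>+p. ennreal (lik U (fst p) w' (chan_out (fst p) w (snd p)) / lik V (fst p) w (chan_out (fst p) w (snd p))) \<partial>joint)
     = (\<integral>\<^sup>+p. (\<Prod>i<n. ?H ((\<Sum>k\<in>L1. h (fst k) * fst p (fst k, snd k, i)) + snd p i) (\<Sum>k\<in>L2. h (fst k) * fst p (fst k, snd k, i))) \<partial>joint)"
    by simp
  also have "\<dots> = (\<integral>\<^sup>+z. \<integral>\<^sup>+u. \<integral>\<^sup>+u'. ?H ((\<Sum>k\<in>L1. h (fst k) * u k) + z) (\<Sum>k\<in>L2. h (fst k) * u' k)
        \<partial>PiM L2 (\<lambda>_. complex_gaussian v) \<partial>PiM L1 (\<lambda>_. complex_gaussian v) \<partial>complex_gaussian 1) ^ n"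
    by (rule nn_integral_joint_prod[where H = ?H, OF sub disj]) measurable
  also have "\<dots> = (\<integral>\<^sup>+z. \<integral>\<^sup>+u. 1 \<partial>PiM L1 (\<lambda>_. complex_gaussian v) \<partial>complex_gaussian 1) ^ n"
    by (simp only: inner)
  also have "(\<integral>\<^sup>+z. \<integral>\<^sup>+u. 1 \<partial>PiM L1 (\<lambda>_. complex_gaussian v) \<partial>complex_gaussian 1) ^ n = 1"
    using PL.emeasure_space_1 U.emeasure_space_1 by simp
  finally show ?thesis .
qed

text \<open>At the true messages the residual is Gaussian with variance
  \<open>noise_power V\<close>, so the energy is a sum of \<open>n\<close> independent unit
  exponential variables.\<close>

lemma nn_integral_exp_energy:
  assumes w: "w \<in> msgs" and s: "s < 1"
  shows "(\<integral>\<^sup>+p. ennreal (exp (s * energy V (fst p) w (chan_out (fst p) w (snd p)))) \<partial>joint)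
    = ennreal ((1 / (1 - s)) ^ n)"
proof -
  interpret V: prob_space "complex_gaussian v" by (rule prob_space_complex_gaussian[OF v_pos])
  interpret PL0: prob_space "PiM ({} :: ('k \<times> nat) set) (\<lambda>_. complex_gaussian v)"
    by (intro prob_space_PiM V.prob_space_axioms)
  let ?H = "\<lambda>b a :: complex. ennreal (exp (s * (cmod b)\<^sup>2 / noise_power V))"
  define L1 where "L1 = (\<lambda>l. (l, w l)) ` V"
  have sumL: "(\<Sum>k\<in>L1. f k) = (\<Sum>l\<in>V. f (l, w l))"
    for f :: "'k \<times> nat \<Rightarrow> 'z::comm_monoid_add"
    unfolding L1_def by (subst sum.reindex; auto simp: inj_on_def)
  have "ennreal (exp (s * energy V x w (chan_out x w z)))
     = (\<Prod>i<n. ?H ((\<Sum>k\<in>L1. h (fst k) * x (fst k, snd k, i)) + z i) (\<Sum>k\<in>{}. h (fst k) * x (fst k, snd k, i)))" for x z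
    by (subst prod_ennreal) (simp_all add: sumL residual_output_self energy_def exp_sum[symmetric] sum_distrib_left)
  then have "(\<integral>\<^sup>+p. ennreal (exp (s * energy V (fst p) w (chan_out (fst p) w (snd p)))) \<partial>joint)
     = (\<integral>\<^sup>+p. (\<Prod>i<n. ?H ((\<Sum>k\<in>L1. h (fst k) * fst p (fst k, snd k, i)) + snd p i) (\<Sum>k\<in>{}. h (fst k) * fst p (fst k, snd k, i))) \<partial>joint)"
    by simp
  also have "\<dots> = (\<integral>\<^sup>+z. \<integral>\<^sup>+u. \<integral>\<^sup>+u'. ?H ((\<Sum>k\<in>L1. h (fst k) * u k) + z) (\<Sum>k\<in>({} :: ('k \<times> nat) set). h (fst k) * u' k)
        \<partial>PiM {} (\<lambda>_. complex_gaussian v) \<partial>PiM L1 (\<lambda>_. complex_gaussian v) \<partial>complex_gaussian 1) ^ n"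
    by (rule nn_integral_joint_prod[where H = ?H]) (use w in \<open>auto simp: L1_def msgs_def\<close>)
  also have "\<dots> = (\<integral>\<^sup>+z. \<integral>\<^sup>+u. ?H ((\<Sum>k\<in>L1. h (fst k) * u k) + z) 0 \<partial>PiM L1 (\<lambda>_. complex_gaussian v) \<partial>complex_gaussian 1) ^ n"
    using PL0.emeasure_space_1 by simp
  also have "(\<integral>\<^sup>+z. \<integral>\<^sup>+u. ?H ((\<Sum>k\<in>L1. h (fst k) * u k) + z) 0 \<partial>PiM L1 (\<lambda>_. complex_gaussian v) \<partial>complex_gaussian 1)
     = (\<integral>\<^sup>+z. ?H z 0 \<partial>complex_gaussian (noise_power V))"
    by (subst nn_integral_PiM_complex_gaussian_sum) (auto simp: v_pos L1_def noise_power_def sum.reindex inj_on_def)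
  also have "\<dots> = ennreal (1 / (1 - s))"
    by (rule nn_integral_exp_cgauss) (use s in auto)
  also have "ennreal (1 / (1 - s)) ^ n = ennreal ((1 / (1 - s)) ^ n)"
    using s by (intro ennreal_power) auto
  finally show ?thesis .
qed

text \<open>With \<open>s\<close> inside the event, one application of Markov's inequality serves
  both tails: positive \<open>s\<close> gives the upper tail, negative \<open>s\<close> the lower
  one.\<close>

lemma energy_chernoff:
  assumes w: "w \<in> msgs" and s: "s < 1"
  shows "measure joint {p \<in> space joint. t \<le> s * energy V (fst p) w (chan_out (fst p) w (snd p))}
    \<le> exp (- t) * (1 / (1 - s)) ^ n"
proof -
  let ?e = "\<lambda>p. s * energy V (fst p) w (chan_out (fst p) w (snd p))"
  have [measurable]: "?e \<in> borel_measurable joint"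
    by (intro borel_measurable_times borel_measurable_const measurable_energy_output w)
  have "emeasure joint {p \<in> space joint. t \<le> ?e p}
    = emeasure joint {p \<in> space joint. 1 \<le> ennreal (exp (- t)) * ennreal (exp (?e p))}"
    by (intro arg_cong2[where f=emeasure] refl Collect_cong)
       (auto simp: ennreal_mult[symmetric] exp_add[symmetric])
  also have "\<dots> \<le> ennreal (exp (- t)) * (\<integral>\<^sup>+p. ennreal (exp (?e p)) * indicator (space joint) p \<partial>joint)"
    by (rule nn_integral_Markov_inequality) measurable
  also have "(\<integral>\<^sup>+p. ennreal (exp (?e p)) * indicator (space joint) p \<partial>joint) = (\<integral>\<^sup>+p. ennreal (exp (?e p)) \<partial>joint)"
    by (intro nn_integral_cong) simp
  also have "\<dots> = ennreal ((1 / (1 - s)) ^ n)" by (rule nn_integral_exp_energy[OF w s])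
  finally show ?thesis
    using s by (simp add: J.P.emeasure_eq_measure ennreal_mult[symmetric])
qed

lemma energy_concentration:
  fixes \<delta> :: real
  assumes w: "w \<in> msgs" and \<delta>: "0 < \<delta>" "\<delta> < 1"
  shows "measure joint {p \<in> space joint. \<bar>energy V (fst p) w (chan_out (fst p) w (snd p)) - n\<bar> \<ge> n * \<delta>}
    \<le> 2 * chernoff_rate \<delta> ^ n"
proof -
  let ?e = "\<lambda>p. energy V (fst p) w (chan_out (fst p) w (snd p))"
  have [measurable]: "?e \<in> borel_measurable joint" by (rule measurable_energy_output[OF w w])
  \<comment> \<open>The optimal Chernoff parameters for the levels 1 + \<delta> and 1 - \<delta>; at
    these values the bounds are the n-th powers of the two entries of
    \<open>chernoff_rate\<close>.\<close>
  define s t where "s = \<delta> / (1 + \<delta>)" and "t = - \<delta> / (1 - \<delta>)"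
  have s: "1 - s = 1 / (1 + \<delta>)" "s > 0" "s * (1 + \<delta>) = \<delta>" using \<delta> by (simp_all add: s_def diff_divide_eq_iff)
  have t: "1 - t = 1 / (1 - \<delta>)" "t < 0" "t * (1 - \<delta>) = - \<delta>" using \<delta> by (simp_all add: t_def add_divide_eq_iff)
  have s1: "s < 1" using s(1) \<delta> by (simp add: s_def)
  have "{p \<in> space joint. \<bar>?e p - n\<bar> \<ge> n * \<delta>}
    \<subseteq> {p \<in> space joint. n * \<delta> \<le> s * ?e p} \<union> {p \<in> space joint. - n * \<delta> \<le> t * ?e p}"
  proof
    fix p assume p: "p \<in> {p \<in> space joint. \<bar>?e p - n\<bar> \<ge> n * \<delta>}"
    then consider "?e p \<ge> n * (1 + \<delta>)" | "?e p \<le> n * (1 - \<delta>)" by (auto simp: algebra_simps abs_if split: if_splits)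
    then show "p \<in> {p \<in> space joint. n * \<delta> \<le> s * ?e p} \<union> {p \<in> space joint. - n * \<delta> \<le> t * ?e p}"
    proof cases
      case 1
      then have "s * (n * (1 + \<delta>)) \<le> s * ?e p" using s by (intro mult_left_mono) auto
      moreover have "s * (n * (1 + \<delta>)) = n * (s * (1 + \<delta>))" by simp
      ultimately show ?thesis using p s(3) by auto
    next
      case 2
      then have "t * (n * (1 - \<delta>)) \<le> t * ?e p" using t by (intro mult_left_mono_neg) auto
      moreover have "t * (n * (1 - \<delta>)) = n * (t * (1 - \<delta>))" by simp
      ultimately show ?thesis using p t(3) by auto
    qed
  qed
  then have "measure joint {p \<in> space joint. \<bar>?e p - n\<bar> \<ge> n * \<delta>}
     \<le> measure joint ({p \<in> space joint. n * \<delta> \<le> s * ?e p} \<union> {p \<in> space joint. - n * \<delta> \<le> t * ?e p})"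
    by (intro J.P.finite_measure_mono) auto
  also have "\<dots> \<le> measure joint {p \<in> space joint. n * \<delta> \<le> s * ?e p} + measure joint {p \<in> space joint. - n * \<delta> \<le> t * ?e p}"
    by (intro measure_Un_le) auto
  also have "measure joint {p \<in> space joint. n * \<delta> \<le> s * ?e p} \<le> exp (- (n * \<delta>)) * (1 / (1 - s)) ^ n"
    by (rule energy_chernoff[OF w s1])
  also have "\<dots> = ((1 + \<delta>) * exp (- \<delta>)) ^ n"
    using exp_of_nat_mult[of n "- \<delta>"] by (simp add: s power_mult_distrib)
  also have "\<dots> \<le> chernoff_rate \<delta> ^ n"
    using \<delta> by (intro power_mono) (auto simp: chernoff_rate_def)
  also have "measure joint {p \<in> space joint. - n * \<delta> \<le> t * ?e p} \<le> exp (- (- n * \<delta>)) * (1 / (1 - t)) ^ n"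
    by (rule energy_chernoff[OF w]) (use t in auto)
  also have "\<dots> = ((1 - \<delta>) * exp \<delta>) ^ n"
    using exp_of_nat_mult[of n "\<delta>"] by (simp add: t power_mult_distrib)
  also have "\<dots> \<le> chernoff_rate \<delta> ^ n"
    using \<delta> by (intro power_mono) (auto simp: chernoff_rate_def)
  finally show ?thesis by simp
qed

text \<open>Here the codebook is averaged with the noise for each fixed message tuple, the order in
  which independence of codewords can be used.\<close>

definition mean_error :: "'k \<Rightarrow> ('k codebooks \<times> (nat \<Rightarrow> complex) \<Rightarrow> nat) \<Rightarrow> real" where
  "mean_error j D = (\<Sum>w\<in>msgs. measure joint {p \<in> space joint. D (fst p, chan_out (fst p) w (snd p)) \<noteq> w j}) / card msgs"

lemma msgs_nonempty: "msgs \<noteq> {}"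
proof -
  have "(\<lambda>_. 1) \<in> msgs" using N_pos by (simp add: msgs_def)
  then show ?thesis by blast
qed

lemma card_msgs_pos [simp]: "card msgs > 0"
  using msgs_nonempty by (simp add: card_gt_0_iff)

lemma mean_error_nonneg: "mean_error j D \<ge> 0"
  by (simp add: mean_error_def sum_nonneg)

text \<open>Exchanges the average over messages with the one over codebooks, linking the error of a
  realized code to \<open>mean_error\<close>. Integrability is carried along because sums over
  receivers follow.\<close>

lemma has_bochner_integral_mean_error:
  assumes D [measurable]: "D \<in> codebook \<Otimes>\<^sub>M PiM {..<n} (\<lambda>_. borel) \<rightarrow>\<^sub>M count_space {1..N j}"
  shows "has_bochner_integral codebook
    (\<lambda>x. measure (measure_pmf (pmf_of_set msgs) \<Otimes>\<^sub>M noise n) {(w, z) \<in> UNIV \<times> space (noise n). D (x, chan_out x w z) \<noteq> w j})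
    (mean_error j D)"
proof -
  have D' [measurable]: "D \<in> codebook \<Otimes>\<^sub>M PiM {..<n} (\<lambda>_. borel) \<rightarrow>\<^sub>M count_space UNIV"
    using D by (rule measurable_compose) simp
  \<comment> \<open>Needed for every \<open>w\<close>, also outside \<open>msgs\<close>: with the
    codebook fixed, the codeword symbols are mere constants, whatever their values.\<close>
  have z_meas: "Measurable.pred (noise n) (\<lambda>z. D (x, chan_out x w z) \<noteq> w j)" if x: "x \<in> space codebook" for x w
  proof -
    have "(\<lambda>z. (\<Sum>l\<in>UNIV. h l * x (l, w l, i)) + z i) \<in> borel_measurable (noise n)" if "i < n" for i
      using measurable_noise_coordinate[OF that] by measurable
    then have "(\<lambda>z. chan_out x w z) \<in> noise n \<rightarrow>\<^sub>M PiM {..<n} (\<lambda>_. borel)"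
      unfolding chan_out_def by (intro measurable_restrict) auto
    then have "(\<lambda>z. (x, chan_out x w z)) \<in> noise n \<rightarrow>\<^sub>M codebook \<Otimes>\<^sub>M PiM {..<n} (\<lambda>_. borel)"
      using x by (intro measurable_Pair) auto
    then have [measurable]: "(\<lambda>z. D (x, chan_out x w z)) \<in> noise n \<rightarrow>\<^sub>M count_space UNIV"
      by (rule measurable_compose) simp
    show ?thesis by measurable
  qed
  have sets: "{p \<in> space joint. D (fst p, chan_out (fst p) w (snd p)) \<noteq> w j} \<in> sets joint" if w: "w \<in> msgs" for w
  proof -
    have [measurable]: "(\<lambda>p. D (fst p, chan_out (fst p) w (snd p))) \<in> joint \<rightarrow>\<^sub>M count_space UNIV"
      by (rule measurable_compose[OF measurable_pair_output[OF w]]) simp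
    show ?thesis by measurable
  qed
  have "has_bochner_integral codebook
    (\<lambda>x. (\<Sum>w\<in>msgs. measure (noise n) (Pair x -` {p \<in> space joint. D (fst p, chan_out (fst p) w (snd p)) \<noteq> w j})) / card msgs)
    (mean_error j D)"
    unfolding mean_error_def
    by (intro has_bochner_integral_divide_zero has_bochner_integral_sum
       has_bochner_integral_pair_section prob_space_codebook prob_space_noise sets)
  also have "?this \<longleftrightarrow> ?thesis"
  proof (rule has_bochner_integral_cong)
    fix x assume x: "x \<in> space codebook"
    then have "Pair x -` {p \<in> space joint. D (fst p, chan_out (fst p) w (snd p)) \<noteq> w j}
      = {z \<in> space (noise n). D (x, chan_out x w z) \<noteq> w j}" for w
      by (auto simp: space_pair_measure)
    then show "(\<Sum>w\<in>msgs. measure (noise n) (Pair x -` {p \<in> space joint. D (fst p, chan_out (fst p) w (snd p)) \<noteq> w j})) / card msgs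
      = measure (measure_pmf (pmf_of_set msgs) \<Otimes>\<^sub>M noise n) {(w, z) \<in> UNIV \<times> space (noise n). D (x, chan_out x w z) \<noteq> w j}"
      by (subst measure_pair_pmf_of_set[OF prob_space_noise finite_msgs msgs_nonempty z_meas[OF x]]) simp
  qed auto
  finally show ?thesis .
qed

section \<open>Classes of message tuples and the Markov bound on likelihood ratios\<close>

definition class_off :: "'k set \<Rightarrow> ('k \<Rightarrow> nat) \<Rightarrow> ('k \<Rightarrow> nat) set" where
  "class_off A w = {w' \<in> msgs. \<forall>l. l \<notin> A \<longrightarrow> w' l = w l}"

definition differ_on :: "'k set \<Rightarrow> ('k \<Rightarrow> nat) \<Rightarrow> ('k \<Rightarrow> nat) set" where
  "differ_on T w = {w' \<in> msgs. {l. w' l \<noteq> w l} = T}"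

lemma finite_class_off [simp]: "finite (class_off A w)"
  by (simp add: class_off_def)

lemma finite_differ_on [simp]: "finite (differ_on A w)"
  by (simp add: differ_on_def)

lemma card_class_off:
  assumes w: "w \<in> msgs"
  shows "card (class_off A w) = (\<Prod>l\<in>A. N l)"
proof -
  have "bij_betw (\<lambda>w'. restrict w' A) (class_off A w) (PiE A (\<lambda>l. {1..N l}))"
  proof (rule bij_betw_byWitness[where f' = "\<lambda>u l. if l \<in> A then u l else w l"])
    show "\<forall>a\<in>class_off A w. (\<lambda>l. if l \<in> A then restrict a A l else w l) = a"
      by (auto simp: class_off_def fun_eq_iff)
    show "\<forall>a'\<in>PiE A (\<lambda>l. {1..N l}). restrict (\<lambda>l. if l \<in> A then a' l else w l) A = a'"
      by (auto simp: fun_eq_iff PiE_def extensional_def)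
    show "(\<lambda>w'. restrict w' A) ` class_off A w \<subseteq> PiE A (\<lambda>l. {1..N l})"
      by (auto simp: class_off_def msgs_def)
    show "(\<lambda>u l. if l \<in> A then u l else w l) ` PiE A (\<lambda>l. {1..N l}) \<subseteq> class_off A w"
      using w by (auto simp: class_off_def msgs_def PiE_def Pi_def)
  qed
  then have "card (class_off A w) = card (PiE A (\<lambda>l. {1..N l}))" by (rule bij_betw_same_card)
  then show ?thesis by (simp add: card_PiE)
qed

lemma card_differ_on: "w \<in> msgs \<Longrightarrow> card (differ_on T w) \<le> (\<Prod>l\<in>T. N l)"
  unfolding card_class_off[symmetric]
  by (intro card_mono) (auto simp: class_off_def differ_on_def)

text \<open>Sorts a class by the exact set of disagreement, the only form in which the mean-one
  property of likelihood ratios applies.\<close>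

lemma sum_class_off:
  fixes f :: "('k \<Rightarrow> nat) \<Rightarrow> real"
  shows "(\<Sum>w'\<in>class_off A w. f w') = (\<Sum>T\<in>Pow A. \<Sum>w'\<in>differ_on T w. f w')"
proof -
  have "(\<Sum>T\<in>Pow A. \<Sum>w'\<in>{w' \<in> class_off A w. {l. w' l \<noteq> w l} = T}. f w') = (\<Sum>w'\<in>class_off A w. f w')"
    by (rule sum.group) (auto simp: class_off_def)
  moreover have "{w' \<in> class_off A w. {l. w' l \<noteq> w l} = T} = differ_on T w" if "T \<subseteq> A" for T
    using that by (auto simp: class_off_def differ_on_def)
  ultimately show ?thesis by simp
qed

text \<open>Double counting: agreement outside \<open>A\<close> is a symmetric relation, so the
  roles of \<open>w\<close> and \<open>w'\<close> can be exchanged.\<close>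

lemma sum_class_off_swap:
  fixes a b :: "('k \<Rightarrow> nat) \<Rightarrow> real"
  shows "(\<Sum>w\<in>msgs. a w * (\<Sum>w'\<in>class_off A w. b w')) = (\<Sum>w\<in>msgs. (\<Sum>w'\<in>class_off A w. a w') * b w)"
proof -
  have "(\<Sum>w\<in>msgs. a w * (\<Sum>w'\<in>class_off A w. b w')) = (\<Sum>w\<in>msgs. \<Sum>w'\<in>{w' \<in> msgs. \<forall>l. l \<notin> A \<longrightarrow> w' l = w l}. a w * b w')"
    by (simp add: sum_distrib_left class_off_def)
  also have "\<dots> = (\<Sum>w'\<in>msgs. \<Sum>w\<in>{w \<in> msgs. \<forall>l. l \<notin> A \<longrightarrow> w' l = w l}. a w * b w')"
    by (rule sum.swap_restrict) auto
  also have "\<dots> = (\<Sum>w\<in>msgs. (\<Sum>w'\<in>class_off A w. a w') * b w)"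
    by (simp add: sum_distrib_right class_off_def eq_commute)
  finally show ?thesis .
qed

text \<open>Divided by the positive \<open>lik V\<close>, each summand has mean one, so the sum has
  mean \<open>card D\<close> by linearity; dependence among the candidates does not matter.\<close>

lemma markov_lik_ratio:
  assumes w: "w \<in> msgs" and UV: "U \<subseteq> V" and D: "D \<subseteq> differ_on (V - U) w" and t: "t > 0"
  shows "measure joint {p \<in> space joint. t * lik V (fst p) w (chan_out (fst p) w (snd p))
       \<le> (\<Sum>w'\<in>D. lik U (fst p) w' (chan_out (fst p) w (snd p)))} \<le> card D / t"
proof -
  let ?r = "\<lambda>w' p. lik U (fst p) w' (chan_out (fst p) w (snd p)) / lik V (fst p) w (chan_out (fst p) w (snd p))"
  have w': "w' \<in> msgs" if "w' \<in> D" for w' using that D by (auto simp: differ_on_def)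
  have lik_m [measurable]: "(\<lambda>p. lik U' (fst p) w' (chan_out (fst p) w (snd p))) \<in> borel_measurable joint"
    if "w' \<in> insert w D" for U' w'
    using w w' that by (intro measurable_lik_output) auto
  have [measurable]: "?r w' \<in> borel_measurable joint" if "w' \<in> D" for w'
    using lik_m[of w'] lik_m[of w] that by (intro borel_measurable_divide) auto
  have nonneg: "?r w' p \<ge> 0" for w' p by (simp add: less_imp_le lik_pos)
  have "emeasure joint {p \<in> space joint. t * lik V (fst p) w (chan_out (fst p) w (snd p))
       \<le> (\<Sum>w'\<in>D. lik U (fst p) w' (chan_out (fst p) w (snd p)))}
    = emeasure joint {p \<in> space joint. 1 \<le> ennreal (1 / t) * (\<Sum>w'\<in>D. ennreal (?r w' p))}"
  proof (intro arg_cong2[where f=emeasure] refl Collect_cong conj_cong)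
    fix p
    have "1 \<le> ennreal (1 / t) * (\<Sum>w'\<in>D. ennreal (?r w' p)) \<longleftrightarrow> 1 \<le> 1 / t * (\<Sum>w'\<in>D. ?r w' p)"
      using t nonneg by (simp add: sum_ennreal ennreal_mult[symmetric] sum_nonneg del: times_divide_eq_left)
    also have "\<dots> \<longleftrightarrow> t * lik V (fst p) w (chan_out (fst p) w (snd p))
       \<le> (\<Sum>w'\<in>D. lik U (fst p) w' (chan_out (fst p) w (snd p)))"
      using t lik_pos[of V "fst p" w "chan_out (fst p) w (snd p)"]
      by (simp add: sum_divide_distrib[symmetric] field_simps)
    finally show "(t * lik V (fst p) w (chan_out (fst p) w (snd p))
       \<le> (\<Sum>w'\<in>D. lik U (fst p) w' (chan_out (fst p) w (snd p)))) = (1 \<le> ennreal (1 / t) * (\<Sum>w'\<in>D. ennreal (?r w' p)))"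
      by simp
  qed
  also have "\<dots> \<le> ennreal (1 / t) * (\<integral>\<^sup>+p. (\<Sum>w'\<in>D. ennreal (?r w' p)) * indicator (space joint) p \<partial>joint)"
    by (rule nn_integral_Markov_inequality) (auto intro!: borel_measurable_times borel_measurable_sum)
  also have "(\<integral>\<^sup>+p. (\<Sum>w'\<in>D. ennreal (?r w' p)) * indicator (space joint) p \<partial>joint) = (\<integral>\<^sup>+p. (\<Sum>w'\<in>D. ennreal (?r w' p)) \<partial>joint)"
    by (intro nn_integral_cong) simp
  also have "\<dots> = (\<Sum>w'\<in>D. \<integral>\<^sup>+p. ennreal (?r w' p) \<partial>joint)"
    by (rule nn_integral_sum) auto
  also have "\<dots> = (\<Sum>w'\<in>D. 1)"
    by (intro sum.cong refl nn_integral_lik_ratio w w' UV) (use D in \<open>auto simp: differ_on_def\<close>)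
  also have "ennreal (1 / t) * (\<Sum>w'\<in>D. 1) = ennreal (card D / t)"
    using t by (simp add: ennreal_of_nat_eq_real_of_nat ennreal_mult[symmetric])
  finally show ?thesis
    using t by (simp add: J.P.emeasure_eq_measure)
qed

section \<open>Atypical and confusable outcomes\<close>

definition atypical :: "real \<Rightarrow> 'k set \<Rightarrow> ('k \<Rightarrow> nat) \<Rightarrow> ('k codebooks \<times> (nat \<Rightarrow> complex)) set" where
  "atypical \<delta> V w = {p \<in> space joint. \<bar>energy V (fst p) w (chan_out (fst p) w (snd p)) - n\<bar> \<ge> real n * \<delta>}"

lemma sets_atypical [measurable]: "w \<in> msgs \<Longrightarrow> atypical \<delta> V w \<in> sets joint"
  unfolding atypical_def using measurable_energy_output[of w w V] by measurable

lemma typical_lik_bounds: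
  fixes \<delta> :: real
  assumes "p \<in> space joint" "p \<notin> atypical \<delta> V w"
  shows "exp (- (n * (1 + \<delta>))) / (pi * noise_power V) ^ n \<le> lik V (fst p) w (chan_out (fst p) w (snd p))"
    and "lik V (fst p) w (chan_out (fst p) w (snd p)) \<le> exp (- (n * (1 - \<delta>))) / (pi * noise_power V) ^ n"
proof -
  have "\<bar>energy V (fst p) w (chan_out (fst p) w (snd p)) - n\<bar> < n * \<delta>"
    using assms by (auto simp: atypical_def)
  then have "- (n * (1 + \<delta>)) \<le> - energy V (fst p) w (chan_out (fst p) w (snd p))"
    "- energy V (fst p) w (chan_out (fst p) w (snd p)) \<le> - (n * (1 - \<delta>))"
    by (auto simp: algebra_simps abs_less_iff)
  then show "exp (- (n * (1 + \<delta>))) / (pi * noise_power V) ^ n \<le> lik V (fst p) w (chan_out (fst p) w (snd p))"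
    and "lik V (fst p) w (chan_out (fst p) w (snd p)) \<le> exp (- (n * (1 - \<delta>))) / (pi * noise_power V) ^ n"
    unfolding lik_eq_exp_energy by (intro divide_right_mono; simp add: less_imp_le)+
qed

text \<open>The false tuples on \<open>V - U\<close> jointly look too likely. Achievability takes
  \<open>U = - S\<close> and \<open>V = - S \<union> T\<close>, the converse \<open>U = {}\<close>
  and \<open>V = T\<close>.\<close>

definition confusable :: "real \<Rightarrow> 'k set \<Rightarrow> 'k set \<Rightarrow> ('k \<Rightarrow> nat) \<Rightarrow> ('k codebooks \<times> (nat \<Rightarrow> complex)) set" where
  "confusable t U V w = {p \<in> space joint. t * lik V (fst p) w (chan_out (fst p) w (snd p))
       \<le> (\<Sum>w'\<in>differ_on (V - U) w. lik U (fst p) w' (chan_out (fst p) w (snd p)))}"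

lemma sets_confusable [measurable]:
  assumes w: "w \<in> msgs"
  shows "confusable t U V w \<in> sets joint"
proof -
  have [measurable]: "(\<lambda>p. lik V (fst p) w (chan_out (fst p) w (snd p))) \<in> borel_measurable joint"
    using w w by (rule measurable_lik_output)
  have [measurable]: "(\<lambda>p. \<Sum>w'\<in>differ_on (V - U) w. lik U (fst p) w' (chan_out (fst p) w (snd p))) \<in> borel_measurable joint"
    by (intro borel_measurable_sum measurable_lik_output w) (simp add: differ_on_def)
  show ?thesis unfolding confusable_def by measurable
qed

lemma measure_confusable:
  assumes w: "w \<in> msgs" and UV: "U \<subseteq> V"
  shows "measure joint (confusable ((\<Prod>l\<in>V - U. real (N l)) * exp (real n * \<gamma>)) U V w) \<le> exp (- (real n * \<gamma>))"
proof -
  have pos: "(\<Prod>l\<in>V - U. real (N l)) > 0" using N_pos by (intro prod_pos) (simp add: Suc_le_eq)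
  have "measure joint (confusable ((\<Prod>l\<in>V - U. real (N l)) * exp (real n * \<gamma>)) U V w)
    \<le> card (differ_on (V - U) w) / ((\<Prod>l\<in>V - U. real (N l)) * exp (real n * \<gamma>))"
    unfolding confusable_def by (rule markov_lik_ratio[OF w UV order_refl]) (use pos in simp)
  also have "\<dots> \<le> (\<Prod>l\<in>V - U. real (N l)) / ((\<Prod>l\<in>V - U. real (N l)) * exp (real n * \<gamma>))"
    using card_differ_on[OF w, of "V - U"] pos
    by (intro divide_right_mono mult_nonneg_nonneg less_imp_le[OF pos] exp_ge_zero) (simp flip: of_nat_prod)
  also have "\<dots> = exp (- (real n * \<gamma>))"
  proof -
    have "a / (a * exp t) = exp (- t)" if "a > 0" for a t :: real
      using that by (simp add: exp_minus field_simps)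
    from this[OF pos] show ?thesis .
  qed
  finally show ?thesis .
qed

text \<open>Outside it, the likelihood for \<open>V\<close> obeys its upper typical bound and the
  one for \<open>V'\<close> its lower bound, which are the directions both arguments need.\<close>

definition bad_event :: "real \<Rightarrow> real \<Rightarrow> 'k set \<Rightarrow> 'k set \<Rightarrow> 'k set \<Rightarrow> ('k \<Rightarrow> nat) \<Rightarrow> ('k codebooks \<times> (nat \<Rightarrow> complex)) set" where
  "bad_event \<gamma> \<delta> U V V' w = atypical \<delta> V w \<union> atypical \<delta> V' w \<union>
     confusable ((\<Prod>l\<in>V - U. real (N l)) * exp (real n * \<gamma>)) U V w"

lemma sets_bad_event [measurable]: "w \<in> msgs \<Longrightarrow> bad_event \<gamma> \<delta> U V V' w \<in> sets joint"
  unfolding bad_event_def by (intro sets.Un sets_atypical sets_confusable)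

text \<open>The 4 collects two concentration bounds with factor 2 each; \<open>2 ^ CARD('k)\<close>
  bounds the number of sets \<open>T\<close>.\<close>

lemma measure_UN_bad_event:
  fixes F :: "'k set set"
  assumes w: "w \<in> msgs" and \<delta>: "0 < \<delta>" "\<delta> < 1" and UV: "\<And>T. T \<in> F \<Longrightarrow> U \<subseteq> V T"
  shows "measure joint (\<Union>T\<in>F. bad_event \<gamma> \<delta> U (V T) V' w)
    \<le> 2 ^ CARD('k) * (4 * chernoff_rate \<delta> ^ n + exp (- (real n * \<gamma>)))"
proof -
  let ?b = "4 * chernoff_rate \<delta> ^ n + exp (- (real n * \<gamma>))"
  have "measure joint (\<Union>T\<in>F. bad_event \<gamma> \<delta> U (V T) V' w) \<le> (\<Sum>T\<in>F. measure joint (bad_event \<gamma> \<delta> U (V T) V' w))"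
    by (rule measure_UNION_le) (auto intro: sets_bad_event w finite_subset[OF subset_UNIV])
  also have "\<dots> \<le> (\<Sum>T\<in>F. ?b)"
  proof (rule sum_mono)
    fix T assume T: "T \<in> F"
    let ?A = "atypical \<delta> (V T) w" and ?B = "atypical \<delta> V' w"
    let ?C = "confusable ((\<Prod>l\<in>V T - U. real (N l)) * exp (real n * \<gamma>)) U (V T) w"
    have "measure joint (bad_event \<gamma> \<delta> U (V T) V' w) \<le> measure joint (?A \<union> ?B) + measure joint ?C"
      unfolding bad_event_def by (rule measure_Un_le) (auto intro: sets_atypical sets_confusable w)
    also have "measure joint (?A \<union> ?B) \<le> measure joint ?A + measure joint ?B"
      by (rule measure_Un_le) (auto intro: sets_atypical w)
    also have "measure joint ?A \<le> 2 * chernoff_rate \<delta> ^ n"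
      unfolding atypical_def by (rule energy_concentration[OF w \<delta>])
    also have "measure joint ?B \<le> 2 * chernoff_rate \<delta> ^ n"
      unfolding atypical_def by (rule energy_concentration[OF w \<delta>])
    also have "measure joint ?C \<le> exp (- (real n * \<gamma>))"
      by (rule measure_confusable[OF w UV[OF T]])
    finally show "measure joint (bad_event \<gamma> \<delta> U (V T) V' w) \<le> ?b" by simp
  qed
  also have "\<dots> = card F * ?b" by simp
  also have "\<dots> \<le> 2 ^ CARD('k) * ?b"
  proof (rule mult_right_mono)
    have "card F \<le> card (Pow (UNIV :: 'k set))" by (intro card_mono) auto
    then show "real (card F) \<le> 2 ^ CARD('k)" by (simp add: card_Pow del: Pow_UNIV)
  qed (use chernoff_rate_nonneg[OF \<delta>(1)] in simp)
  finally show ?thesis .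
qed

subsection \<open>Achievability for a single receiver\<close>

text \<open>A false tuple that is wrong exactly on \<open>T\<close> within \<open>S\<close> fails
  its own test for \<open>T\<close>: \<open>lik (- S \<union> T)\<close> reads only the messages in
  \<open>S - T\<close>, so it is the same for the false and the true tuple, and the Markov bound for
  the truth keeps \<open>lik (- S)\<close> of the false tuple below the threshold. Sets
  \<open>T\<close> containing a user with a single message cannot occur and are left out of the
  tests.\<close>

lemma achievability_bound:
  fixes \<gamma> \<delta> :: real
  assumes j: "j \<in> S" and \<delta>: "0 < \<delta>" "\<delta> < 1"
    and sep: "\<And>T. T \<subseteq> S \<Longrightarrow> T \<noteq> {} \<Longrightarrow> (\<And>l. l \<in> T \<Longrightarrow> N l \<ge> 2) \<Longrightarrow>
      (\<Prod>l\<in>T. real (N l)) * exp (real n * \<gamma>) * exp (real n * (2 * \<delta>)) * noise_power (- S) ^ n < noise_power (- S \<union> T) ^ n"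
  shows "\<exists>D \<in> codebook \<Otimes>\<^sub>M PiM {..<n} (\<lambda>_. borel) \<rightarrow>\<^sub>M count_space {1..N j}.
    mean_error j D \<le> 2 ^ CARD('k) * (4 * chernoff_rate \<delta> ^ n + exp (- (real n * \<gamma>)))"
proof -
  let ?b = "2 ^ CARD('k) * (4 * chernoff_rate \<delta> ^ n + exp (- (real n * \<gamma>)))"
  let ?X = "codebook \<Otimes>\<^sub>M PiM {..<n} (\<lambda>_. borel :: complex measure)"
  define F where "F = {T. T \<subseteq> S \<and> T \<noteq> {} \<and> (\<forall>l\<in>T. N l \<ge> 2)}"
  define \<tau> where "\<tau> T = (\<Prod>l\<in>T. real (N l)) * exp (real n * \<gamma>)" for T
  define ok where "ok w q \<longleftrightarrow> (\<forall>T\<in>F. \<tau> T * lik (- S \<union> T) (fst q) w (snd q) < lik (- S) (fst q) w (snd q))" for w q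
  \<comment> \<open>The default \<open>N j\<close> makes the least index exist and stay in range. It
    does no harm because it is the largest message.\<close>
  define P where "P m q \<longleftrightarrow> 1 \<le> m \<and> (m = N j \<or> (\<exists>w\<in>msgs. w j = m \<and> ok w q))" for m q
  define D where "D q = (LEAST m. P m q)" for q
  have ok_meas: "Measurable.pred ?X (ok w)" if w: "w \<in> msgs" for w
  proof -
    have [measurable]: "(\<lambda>q. lik V (fst q) w (snd q)) \<in> borel_measurable ?X" for V
      by (rule measurable_lik[OF w])
    show ?thesis unfolding ok_def by (intro pred_intros_finite) (simp, measurable)
  qed
  have "Measurable.pred ?X (P m)" for m
    unfolding P_def
    by (intro pred_intros_logic pred_intros_finite finite_msgs ok_meas) auto
  then have D_nat: "D \<in> ?X \<rightarrow>\<^sub>M count_space UNIV"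
    unfolding D_def by (rule measurable_Least)
  have PN: "P (N j) q" for q using N_pos by (simp add: P_def)
  have PD: "P (D q) q" for q unfolding D_def using PN[of q] by (rule LeastI[of "\<lambda>m. P m q"])
  have D_le: "D q \<le> N j" for q unfolding D_def using PN[of q] by (rule Least_le[of "\<lambda>m. P m q"])
  have D_range: "D q \<in> {1..N j}" for q using PD[of q] D_le[of q] by (simp add: P_def)
  have D_meas: "D \<in> ?X \<rightarrow>\<^sub>M count_space {1..N j}"
    by (rule measurable_count_space_extend[OF _ _ D_nat]) (use D_range in auto)
  have err: "measure joint {p \<in> space joint. D (fst p, chan_out (fst p) w (snd p)) \<noteq> w j} \<le> ?b" if w: "w \<in> msgs" for w
  proof -
    have "{p \<in> space joint. D (fst p, chan_out (fst p) w (snd p)) \<noteq> w j}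
      \<subseteq> (\<Union>T\<in>F. bad_event \<gamma> \<delta> (- S) (- S \<union> T) (- S) w)"
    proof (rule subsetI, rule ccontr)
      fix p assume p: "p \<in> {p \<in> space joint. D (fst p, chan_out (fst p) w (snd p)) \<noteq> w j}"
        and "p \<notin> (\<Union>T\<in>F. bad_event \<gamma> \<delta> (- S) (- S \<union> T) (- S) w)"
      then have notbad: "p \<notin> bad_event \<gamma> \<delta> (- S) (- S \<union> T) (- S) w" if "T \<in> F" for T
        using that by blast
      let ?x = "fst p" and ?y = "chan_out (fst p) w (snd p)"
      have diff: "(- S \<union> T) - - S = T" if "T \<in> F" for T using that by (auto simp: F_def)
      have small: "lik (- S) ?x w' ?y < \<tau> T * lik (- S \<union> T) ?x w ?y" if T: "T \<in> F" and w': "w' \<in> differ_on T w" for T w'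
      proof -
        have "p \<notin> confusable (\<tau> T) (- S) (- S \<union> T) w"
          using notbad[OF T] diff[OF T] by (simp add: bad_event_def \<tau>_def)
        then have "(\<Sum>w'\<in>differ_on T w. lik (- S) ?x w' ?y) < \<tau> T * lik (- S \<union> T) ?x w ?y"
          using p diff[OF T] by (simp add: confusable_def)
        moreover have "lik (- S) ?x w' ?y \<le> (\<Sum>w'\<in>differ_on T w. lik (- S) ?x w' ?y)"
          by (rule member_le_sum[OF w']) (auto simp: less_imp_le lik_pos)
        ultimately show ?thesis by simp
      qed
      have "ok w (?x, ?y)"
        unfolding ok_def
      proof
        fix T assume T: "T \<in> F"
        have "p \<notin> atypical \<delta> (- S \<union> T) w" "p \<notin> atypical \<delta> (- S) w"
          using notbad[OF T] by (auto simp: bad_event_def)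
        then have "lik (- S \<union> T) ?x w ?y \<le> exp (- (n * (1 - \<delta>))) / (pi * noise_power (- S \<union> T)) ^ n"
          and lo: "exp (- (n * (1 + \<delta>))) / (pi * noise_power (- S)) ^ n \<le> lik (- S) ?x w ?y"
          using p by (auto intro: typical_lik_bounds)
        then have "\<tau> T * lik (- S \<union> T) ?x w ?y \<le> \<tau> T * (exp (- (n * (1 - \<delta>))) / (pi * noise_power (- S \<union> T)) ^ n)"
          by (elim mult_left_mono) (auto simp: \<tau>_def intro!: mult_nonneg_nonneg prod_nonneg)
        also have "\<dots> < exp (- (n * (1 + \<delta>))) / (pi * noise_power (- S)) ^ n"
          by (rule exp_threshold_less) (use sep[of T] T in \<open>auto simp: F_def \<tau>_def\<close>)
        also note lo
        finally show "\<tau> T * lik (- S \<union> T) (fst (?x, ?y)) w (snd (?x, ?y)) < lik (- S) (fst (?x, ?y)) w (snd (?x, ?y))"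
          by simp
      qed
      moreover have wj: "1 \<le> w j" "w j \<le> N j" using w by (auto simp: msgs_def)
      ultimately have "P (w j) (?x, ?y)" using w by (auto simp: P_def)
      then have "D (?x, ?y) \<le> w j" unfolding D_def by (rule Least_le[of "\<lambda>m. P m (?x, ?y)"])
      moreover have "D (?x, ?y) \<noteq> w j" using p by simp
      \<comment> \<open>A decision strictly below \<open>w j\<close> is also below
        \<open>N j\<close>, so it does not stem from the default but from a false tuple that passed
        all tests.\<close>
      ultimately have "D (?x, ?y) < w j" by simp
      then obtain w' where w': "w' \<in> msgs" "w' j \<noteq> w j" "ok w' (?x, ?y)"
        using PD[of "(?x, ?y)"] wj by (auto simp: P_def)
      \<comment> \<open>The decoder may have found \<open>w'\<close> with arbitrary messages outside
        \<open>S\<close>. Replacing these by the true ones changes no likelihood used in the tests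
        and makes the disagreement exactly \<open>T\<close>.\<close>
      define w'' where "w'' l = (if l \<in> S then w' l else w l)" for l
      define T where "T = {l \<in> S. w' l \<noteq> w l}"
      have w''m: "w'' \<in> msgs" using w w' by (auto simp: w''_def msgs_def)
      have "N l \<ge> 2" if "l \<in> T" for l
      proof -
        have "w l \<in> {1..N l}" "w' l \<in> {1..N l}" "w' l \<noteq> w l" using w w' that by (auto simp: msgs_def T_def)
        then show ?thesis by auto
      qed
      then have T: "T \<in> F" using j w'(2) by (auto simp: F_def T_def)
      have "w'' \<in> differ_on T w" using w''m by (auto simp: differ_on_def T_def w''_def)
      with T have "lik (- S) ?x w'' ?y < \<tau> T * lik (- S \<union> T) ?x w ?y" by (rule small)
      moreover have "lik (- S) ?x w'' ?y = lik (- S) ?x w' ?y" by (rule lik_cong) (simp add: w''_def)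
      moreover have "lik (- S \<union> T) ?x w ?y = lik (- S \<union> T) ?x w' ?y" by (rule lik_cong) (simp add: T_def)
      ultimately show False using w'(3) T by (auto simp: ok_def)
    qed
    then have "measure joint {p \<in> space joint. D (fst p, chan_out (fst p) w (snd p)) \<noteq> w j}
      \<le> measure joint (\<Union>T\<in>F. bad_event \<gamma> \<delta> (- S) (- S \<union> T) (- S) w)"
      by (intro J.P.finite_measure_mono sets.finite_UN sets_bad_event w) auto
    also have "\<dots> \<le> ?b"
      by (rule measure_UN_bad_event[OF w \<delta>]) auto
    finally show ?thesis .
  qed
  have "mean_error j D \<le> (\<Sum>w\<in>msgs. ?b) / card msgs"
    unfolding mean_error_def by (intro divide_right_mono sum_mono err) auto
  also have "\<dots> = ?b" using msgs_nonempty by simp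
  finally show ?thesis using D_meas by blast
qed

subsection \<open>Converse for a single receiver\<close>

abbreviation lebesgue_out :: "(nat \<Rightarrow> complex) measure" where
  "lebesgue_out \<equiv> PiM {..<n} (\<lambda>_. lborel)"

lemma nn_integral_chan_out:
  assumes "f \<in> borel_measurable (PiM {..<n} (\<lambda>_. borel))"
  shows "(\<integral>\<^sup>+z. f (chan_out x w z) \<partial>noise n) = (\<integral>\<^sup>+y. ennreal (lik {} x w y) * f y \<partial>lebesgue_out)"
  using nn_integral_gaussian_noise_shift[OF assms, of "\<lambda>i. \<Sum>l\<in>UNIV. h l * x (l, w l, i)"]
  by (simp add: chan_out_def lik_def residual_def noise_power_def)

text \<open>So \<open>lik U\<close> is a probability density in the output, usable as auxiliary
  output law in the converse.\<close>

lemma nn_integral_lik: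
  "(\<integral>\<^sup>+y. ennreal (lik U x w y) \<partial>lebesgue_out) = 1"
proof -
  interpret PL: product_sigma_finite "\<lambda>_::nat. lborel :: complex measure" by unfold_locales
  let ?c = "\<lambda>i. \<Sum>l\<in>-U. h l * x (l, w l, i)"
  interpret G: prob_space "complex_gaussian (noise_power U)" by (rule prob_space_complex_gaussian) simp
  have "(\<integral>\<^sup>+y. ennreal (lik U x w y) \<partial>lebesgue_out)
    = (\<integral>\<^sup>+y. (\<Prod>i<n. ennreal (cgauss_density (noise_power U) (y i - ?c i))) \<partial>lebesgue_out)"
    by (simp add: lik_def residual_def prod_ennreal less_imp_le)
  also have "\<dots> = (\<Prod>i<n. \<integral>\<^sup>+y. ennreal (cgauss_density (noise_power U) (y - ?c i)) \<partial>lborel)"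
    by (rule PL.product_nn_integral_prod) auto
  also have "(\<integral>\<^sup>+y. ennreal (cgauss_density (noise_power U) (y - a)) \<partial>lborel) = 1" for a
  proof -
    have "(\<integral>\<^sup>+y. ennreal (cgauss_density (noise_power U) (y - a)) \<partial>lborel)
       = (\<integral>\<^sup>+y. ennreal (cgauss_density (noise_power U) y) * 1 \<partial>lborel)"
      by (subst nn_integral_lborel_translate) auto
    also have "\<dots> = (\<integral>\<^sup>+y. 1 \<partial>complex_gaussian (noise_power U))"
      by (rule nn_integral_complex_gaussian[symmetric]) auto
    finally show ?thesis using G.emeasure_space_1 by simp
  qed
  then have "(\<Prod>i<n. \<integral>\<^sup>+y. ennreal (cgauss_density (noise_power U) (y - ?c i)) \<partial>lborel) = 1" by simp
  finally show ?thesis .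
qed

text \<open>Up to the size of the class, the left side is the output density given the message of
  \<open>j\<close> and those outside \<open>U\<close>; for \<open>j\<close> in \<open>U\<close>, the
  right side is a multiple of a density that ignores the message of \<open>j\<close>.\<close>

definition good_lik :: "real \<Rightarrow> 'k \<Rightarrow> 'k set \<Rightarrow> ('k \<Rightarrow> nat) \<Rightarrow> 'k codebooks \<times> (nat \<Rightarrow> complex) \<Rightarrow> bool" where
  "good_lik \<theta> j U w q \<longleftrightarrow> (\<Sum>w'\<in>class_off (U - {j}) w. lik {} (fst q) w' (snd q)) \<le> \<theta> * lik U (fst q) w (snd q)"

lemma measurable_good_lik:
  assumes w: "w \<in> msgs"
  shows "Measurable.pred (codebook \<Otimes>\<^sub>M PiM {..<n} (\<lambda>_. borel)) (good_lik \<theta> j U w)"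
proof -
  have [measurable]: "(\<lambda>q. lik V (fst q) w' (snd q)) \<in> borel_measurable (codebook \<Otimes>\<^sub>M PiM {..<n} (\<lambda>_. borel))"
    if "w' \<in> insert w (class_off (U - {j}) w)" for V w'
    using that w by (intro measurable_lik) (auto simp: class_off_def)
  show ?thesis unfolding good_lik_def by measurable
qed

text \<open>A meta-converse: whatever the decoder does, it can be correct with \<open>good_lik\<close> only with
  small probability.  Both sums over the class of \<open>w\<close> are exchanged by double counting.\<close>

lemma sum_correct_good_le:
  assumes j: "j \<in> U" and \<theta>: "\<theta> \<ge> 0" and D: "D q \<in> {1..N j}"
  shows "(\<Prod>l\<in>U. real (N l)) * (\<Sum>w\<in>msgs. of_bool (D q = w j \<and> good_lik \<theta> j U w q) * lik {} (fst q) w (snd q))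
    \<le> \<theta> * (\<Sum>w\<in>msgs. lik U (fst q) w (snd q))"
proof -
  let ?L = "\<lambda>U w. lik U (fst q) w (snd q)"
  let ?a = "\<lambda>w. of_bool (D q = w j \<and> good_lik \<theta> j U w q) :: real"
  have Lpos: "?L V w \<ge> 0" for V w by (simp add: less_imp_le lik_pos)
  have class_eq: "class_off A w' = class_off A w" if "w' \<in> class_off A w" for A w w'
    using that by (auto simp: class_off_def)
  \<comment> \<open>All tuples of a class share the message of \<open>j\<close> and the messages
    outside \<open>U\<close>, so correctness and \<open>good_lik\<close> are constant on it.\<close>
  have a_class: "?a w' = ?a w" if "w' \<in> class_off (U - {j}) w" for w w'
  proof -
    have "w' j = w j" using that by (simp add: class_off_def)
    moreover have "?L U w' = ?L U w" using that by (intro lik_cong) (auto simp: class_off_def)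
    ultimately show ?thesis by (simp add: good_lik_def class_eq[OF that])
  qed
  have "(\<Prod>l\<in>U - {j}. real (N l)) * (\<Sum>w\<in>msgs. ?a w * ?L {} w)
    = (\<Sum>w\<in>msgs. (\<Sum>w'\<in>class_off (U - {j}) w. ?a w') * ?L {} w)"
    unfolding sum_distrib_left
  proof (intro sum.cong refl)
    fix w assume w: "w \<in> msgs"
    have "(\<Sum>w'\<in>class_off (U - {j}) w. ?a w') = (\<Sum>w'\<in>class_off (U - {j}) w. ?a w)"
      by (intro sum.cong refl a_class)
    then show "(\<Prod>l\<in>U - {j}. real (N l)) * (?a w * ?L {} w) = (\<Sum>w'\<in>class_off (U - {j}) w. ?a w') * ?L {} w"
      by (simp add: card_class_off[OF w])
  qed
  also have "\<dots> = (\<Sum>w\<in>msgs. ?a w * (\<Sum>w'\<in>class_off (U - {j}) w. ?L {} w'))"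
    by (rule sum_class_off_swap[symmetric])
  also have "\<dots> \<le> (\<Sum>w\<in>msgs. of_bool (D q = w j) * (\<theta> * ?L U w))"
    using \<theta> Lpos by (intro sum_mono) (auto simp: good_lik_def)
  also have "\<dots> = \<theta> * (\<Sum>w\<in>msgs. of_bool (D q = w j) * ?L U w)"
    by (simp only: sum_distrib_left mult.left_commute)
  finally have 1: "(\<Prod>l\<in>U - {j}. real (N l)) * (\<Sum>w\<in>msgs. ?a w * ?L {} w) \<le> \<theta> * (\<Sum>w\<in>msgs. of_bool (D q = w j) * ?L U w)" .
  \<comment> \<open>The likelihood \<open>lik U\<close> does not depend on the message of
    \<open>j\<close>. Among the \<open>N j\<close> tuples that differ only there, the decision is
    correct for at most one: under the auxiliary law a decoder can only guess.\<close>
  have "real (N j) * (\<Sum>w\<in>msgs. of_bool (D q = w j) * ?L U w) = (\<Sum>w\<in>msgs. of_bool (D q = w j) * (\<Sum>w'\<in>class_off {j} w. ?L U w'))"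
  proof (subst sum_distrib_left, intro sum.cong refl)
    fix w assume w: "w \<in> msgs"
    have "(\<Sum>w'\<in>class_off {j} w. ?L U w') = (\<Sum>w'\<in>class_off {j} w. ?L U w)"
      using j by (intro sum.cong refl lik_cong) (auto simp: class_off_def)
    then show "real (N j) * (of_bool (D q = w j) * ?L U w) = of_bool (D q = w j) * (\<Sum>w'\<in>class_off {j} w. ?L U w')"
      by (simp add: card_class_off[OF w])
  qed
  also have "\<dots> = (\<Sum>w\<in>msgs. (\<Sum>w'\<in>class_off {j} w. of_bool (D q = w' j)) * ?L U w)"
    by (rule sum_class_off_swap)
  also have "\<dots> \<le> (\<Sum>w\<in>msgs. 1 * ?L U w)"
  proof (intro sum_mono mult_right_mono Lpos)
    fix w assume w: "w \<in> msgs"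
    have "{w' \<in> class_off {j} w. D q = w' j} \<subseteq> {w(j := D q)}" by (auto simp: class_off_def fun_eq_iff)
    then have "card {w' \<in> class_off {j} w. D q = w' j} \<le> card {w(j := D q)}" by (intro card_mono) auto
    then show "(\<Sum>w'\<in>class_off {j} w. of_bool (D q = w' j)) \<le> (1 :: real)"
      by (simp add: sum.If_cases of_bool_def Int_def)
  qed
  finally have 2: "real (N j) * (\<Sum>w\<in>msgs. of_bool (D q = w j) * ?L U w) \<le> (\<Sum>w\<in>msgs. ?L U w)" by simp
  have "(\<Prod>l\<in>U. real (N l)) = real (N j) * (\<Prod>l\<in>U - {j}. real (N l))"
    using j by (subst prod.remove[of U j]) auto
  then have "(\<Prod>l\<in>U. real (N l)) * (\<Sum>w\<in>msgs. ?a w * ?L {} w)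
     = real (N j) * ((\<Prod>l\<in>U - {j}. real (N l)) * (\<Sum>w\<in>msgs. ?a w * ?L {} w))" by simp
  also have "\<dots> \<le> real (N j) * (\<theta> * (\<Sum>w\<in>msgs. of_bool (D q = w j) * ?L U w))"
    by (intro mult_left_mono 1) simp
  also have "\<dots> = \<theta> * (real (N j) * (\<Sum>w\<in>msgs. of_bool (D q = w j) * ?L U w))" by simp
  also have "\<dots> \<le> \<theta> * (\<Sum>w\<in>msgs. ?L U w)" by (intro mult_left_mono 2 \<theta>)
  finally show ?thesis .
qed

text \<open>The pointwise bound is integrated over outputs and codebooks. On the left
  \<open>lik {}\<close> is the true output density and produces probabilities; on the right each
  \<open>lik U\<close> integrates to one.\<close>

lemma sum_measure_correct_good_le:
  assumes j: "j \<in> U" and \<theta>: "\<theta> \<ge> 0"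
    and D: "D \<in> codebook \<Otimes>\<^sub>M PiM {..<n} (\<lambda>_. borel) \<rightarrow>\<^sub>M count_space {1..N j}"
  shows "(\<Prod>l\<in>U. real (N l)) * (\<Sum>w\<in>msgs. measure joint {p \<in> space joint.
      D (fst p, chan_out (fst p) w (snd p)) = w j \<and> good_lik \<theta> j U w (fst p, chan_out (fst p) w (snd p))})
    \<le> \<theta> * card msgs"
proof -
  let ?X = "codebook \<Otimes>\<^sub>M PiM {..<n} (\<lambda>_. borel :: complex measure)"
  let ?Y = "codebook \<Otimes>\<^sub>M lebesgue_out"
  let ?PN = "\<Prod>l\<in>U. real (N l)"
  interpret PL: product_sigma_finite "\<lambda>_::nat. lborel :: complex measure" by unfold_locales
  interpret FL: finite_product_sigma_finite "\<lambda>_::nat. lborel :: complex measure" "{..<n}" by unfold_locales simp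
  define c where "c w q \<longleftrightarrow> D q = w j \<and> good_lik \<theta> j U w q" for w q
  define f where "f w q = of_bool (c w q) * lik {} (fst q) w (snd q)" for w q
  have f_nonneg: "f w q \<ge> 0" for w q by (simp add: f_def less_imp_le lik_pos)
  have sets_Y: "sets ?Y = sets ?X" by (intro sets_pair_measure_cong sets_PiM_cong) auto
  have sets_out: "sets lebesgue_out = sets (PiM {..<n} (\<lambda>_. borel :: complex measure))"
    by (intro sets_PiM_cong) auto
  have D_nat [measurable]: "D \<in> ?X \<rightarrow>\<^sub>M count_space UNIV" using D by (rule measurable_compose) simp
  have c_meas: "Measurable.pred ?X (c w)" if "w \<in> msgs" for w
    unfolding c_def using measurable_good_lik[OF that] by measurable
  have f_meas: "f w \<in> borel_measurable ?X" if "w \<in> msgs" for w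
  proof -
    have [measurable]: "Measurable.pred ?X (c w)" by (rule c_meas[OF that])
    have [measurable]: "(\<lambda>q. lik {} (fst q) w (snd q)) \<in> borel_measurable ?X" by (rule measurable_lik[OF that])
    have "f w = (\<lambda>q. if c w q then lik {} (fst q) w (snd q) else 0)" by (auto simp: f_def)
    then show ?thesis by simp
  qed
  have f_meas_Y: "(\<lambda>q. ennreal (f w q)) \<in> borel_measurable ?Y" if "w \<in> msgs" for w
    using f_meas[OF that] by (subst measurable_cong_sets[OF sets_Y refl]) simp
  have lik_meas_Y: "(\<lambda>q. ennreal (lik U (fst q) w (snd q))) \<in> borel_measurable ?Y" if "w \<in> msgs" for w
    using measurable_lik[OF that, of U] by (subst measurable_cong_sets[OF sets_Y refl]) simp
  have sec: "(\<lambda>y. F (x, y)) \<in> borel_measurable lebesgue_out"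
    if "F \<in> borel_measurable ?Y" "x \<in> space codebook" for F :: "_ \<Rightarrow> ennreal" and x
    using that by (intro measurable_compose[OF measurable_Pair1']) auto
  have int: "emeasure joint {p \<in> space joint. c w (fst p, chan_out (fst p) w (snd p))}
      = (\<integral>\<^sup>+x. \<integral>\<^sup>+y. ennreal (f w (x, y)) \<partial>lebesgue_out \<partial>codebook)" if w: "w \<in> msgs" for w
  proof -
    have cm: "(\<lambda>q. indicator {q. c w q} q :: ennreal) \<in> borel_measurable ?X"
      using c_meas[OF w] by simp
    have cm': "(\<lambda>p. indicator {q. c w q} (fst p, chan_out (fst p) w (snd p)) :: ennreal) \<in> borel_measurable joint"
      by (rule measurable_compose[OF measurable_pair_output[OF w] cm])
    have E: "{p \<in> space joint. c w (fst p, chan_out (fst p) w (snd p))} \<in> sets joint"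
    proof -
      have "Measurable.pred joint (\<lambda>p. c w (fst p, chan_out (fst p) w (snd p)))"
        by (rule measurable_compose[OF measurable_pair_output[OF w] c_meas[OF w]])
      then show ?thesis by measurable
    qed
    have "emeasure joint {p \<in> space joint. c w (fst p, chan_out (fst p) w (snd p))}
      = (\<integral>\<^sup>+p. indicator {p \<in> space joint. c w (fst p, chan_out (fst p) w (snd p))} p \<partial>joint)"
      using E by simp
    also have "\<dots> = (\<integral>\<^sup>+p. indicator {q. c w q} (fst p, chan_out (fst p) w (snd p)) \<partial>joint)"
      by (intro nn_integral_cong) (auto simp: indicator_def)
    also have "\<dots> = (\<integral>\<^sup>+x. \<integral>\<^sup>+z. indicator {q. c w q} (x, chan_out x w z) \<partial>noise n \<partial>codebook)"
      using cm' by (subst NZ.nn_integral_fst[symmetric]) (auto simp: case_prod_beta')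
    also have "\<dots> = (\<integral>\<^sup>+x. \<integral>\<^sup>+y. ennreal (f w (x, y)) \<partial>lebesgue_out \<partial>codebook)"
    proof (intro nn_integral_cong)
      fix x assume x: "x \<in> space codebook"
      have "(\<lambda>y. indicator {q. c w q} (x, y) :: ennreal) \<in> borel_measurable (PiM {..<n} (\<lambda>_. borel))"
        by (rule measurable_compose[OF measurable_Pair1'[OF x] cm])
      then have "(\<integral>\<^sup>+z. indicator {q. c w q} (x, chan_out x w z) \<partial>noise n)
        = (\<integral>\<^sup>+y. ennreal (lik {} x w y) * indicator {q. c w q} (x, y) \<partial>lebesgue_out)"
        by (rule nn_integral_chan_out)
      also have "\<dots> = (\<integral>\<^sup>+y. ennreal (f w (x, y)) \<partial>lebesgue_out)"
        by (intro nn_integral_cong) (auto simp: f_def indicator_def)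
      finally show "(\<integral>\<^sup>+z. indicator {q. c w q} (x, chan_out x w z) \<partial>noise n)
        = (\<integral>\<^sup>+y. ennreal (f w (x, y)) \<partial>lebesgue_out)" .
    qed
    finally show ?thesis .
  qed
  let ?E = "\<lambda>w. {p \<in> space joint. c w (fst p, chan_out (fst p) w (snd p))}"
  have inner_meas: "(\<lambda>x. \<integral>\<^sup>+y. F (x, y) \<partial>lebesgue_out) \<in> borel_measurable codebook"
    if "F \<in> borel_measurable ?Y" for F :: "_ \<Rightarrow> ennreal"
    by (rule FL.borel_measurable_nn_integral_fst[OF that])
  have "ennreal (?PN * (\<Sum>w\<in>msgs. measure joint (?E w))) = ennreal ?PN * (\<Sum>w\<in>msgs. emeasure joint (?E w))"
    by (simp add: J.P.emeasure_eq_measure sum_ennreal ennreal_mult prod_nonneg sum_nonneg)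
  also have "\<dots> = ennreal ?PN * (\<integral>\<^sup>+x. (\<Sum>w\<in>msgs. \<integral>\<^sup>+y. ennreal (f w (x, y)) \<partial>lebesgue_out) \<partial>codebook)"
    by (subst nn_integral_sum) (auto simp: int intro!: inner_meas f_meas_Y)
  also have "\<dots> = (\<integral>\<^sup>+x. ennreal ?PN * (\<Sum>w\<in>msgs. \<integral>\<^sup>+y. ennreal (f w (x, y)) \<partial>lebesgue_out) \<partial>codebook)"
    by (rule nn_integral_cmult[symmetric]) (auto intro!: borel_measurable_sum inner_meas f_meas_Y)
  also have "\<dots> \<le> (\<integral>\<^sup>+x. (\<Sum>w\<in>msgs. ennreal \<theta> * 1) \<partial>codebook)"
  proof (rule nn_integral_mono)
    fix x assume x: "x \<in> space codebook"
    have "ennreal ?PN * (\<Sum>w\<in>msgs. \<integral>\<^sup>+y. ennreal (f w (x, y)) \<partial>lebesgue_out)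
      = ennreal ?PN * (\<integral>\<^sup>+y. (\<Sum>w\<in>msgs. ennreal (f w (x, y))) \<partial>lebesgue_out)"
      by (subst nn_integral_sum) (auto intro!: sec f_meas_Y x)
    also have "\<dots> = (\<integral>\<^sup>+y. ennreal ?PN * (\<Sum>w\<in>msgs. ennreal (f w (x, y))) \<partial>lebesgue_out)"
      by (rule nn_integral_cmult[symmetric]) (auto intro!: borel_measurable_sum sec f_meas_Y x)
    also have "\<dots> \<le> (\<integral>\<^sup>+y. (\<Sum>w\<in>msgs. ennreal \<theta> * ennreal (lik U x w y)) \<partial>lebesgue_out)"
    proof (rule nn_integral_mono)
      fix y :: "nat \<Rightarrow> complex" assume "y \<in> space lebesgue_out"
      then have q: "(x, y) \<in> space ?X" using x by (simp add: space_pair_measure space_PiM)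
      have "?PN * (\<Sum>w\<in>msgs. f w (x, y)) \<le> \<theta> * (\<Sum>w\<in>msgs. lik U x w y)"
        using sum_correct_good_le[OF j \<theta>, of D "(x, y)"] measurable_space[OF D q]
        by (simp add: f_def c_def)
      moreover have "ennreal ?PN * (\<Sum>w\<in>msgs. ennreal (f w (x, y))) = ennreal (?PN * (\<Sum>w\<in>msgs. f w (x, y)))"
        by (simp add: f_nonneg sum_ennreal ennreal_mult prod_nonneg sum_nonneg)
      moreover have "(\<Sum>w\<in>msgs. ennreal \<theta> * ennreal (lik U x w y)) = ennreal (\<theta> * (\<Sum>w\<in>msgs. lik U x w y))"
        using \<theta> by (simp add: sum_distrib_left[symmetric] sum_ennreal ennreal_mult sum_nonneg less_imp_le lik_pos)
      ultimately show "ennreal ?PN * (\<Sum>w\<in>msgs. ennreal (f w (x, y))) \<le> (\<Sum>w\<in>msgs. ennreal \<theta> * ennreal (lik U x w y))"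
        by (simp add: ennreal_leI)
    qed
    also have "\<dots> = (\<Sum>w\<in>msgs. \<integral>\<^sup>+y. ennreal \<theta> * ennreal (lik U x w y) \<partial>lebesgue_out)"
      using sec[OF lik_meas_Y x] by (intro nn_integral_sum) auto
    also have "\<dots> = (\<Sum>w\<in>msgs. ennreal \<theta> * 1)"
      using sec[OF lik_meas_Y x] by (intro sum.cong refl) (subst nn_integral_cmult, auto simp: nn_integral_lik)
    finally show "ennreal ?PN * (\<Sum>w\<in>msgs. \<integral>\<^sup>+y. ennreal (f w (x, y)) \<partial>lebesgue_out) \<le> (\<Sum>w\<in>msgs. ennreal \<theta> * 1)" .
  qed
  also have "\<dots> = ennreal (\<theta> * card msgs)"
    using \<theta> CB.emeasure_space_1 by (simp add: ennreal_of_nat_eq_real_of_nat ennreal_mult mult.commute)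
  finally have "?PN * (\<Sum>w\<in>msgs. measure joint (?E w)) \<le> \<theta> * card msgs"
    using \<theta> by (subst (asm) ennreal_le_iff) auto
  then show ?thesis by (simp add: c_def)
qed

text \<open>The hypothesis \<open>sep\<close> is the gap between the values of \<phi> at
  \<open>U\<close> and \<open>T\<close> in exponential form. Its extra factors pay for the number of
  sets \<open>T\<close>, for two factors \<open>exp (real n * \<gamma>)\<close>, and for the typical
  windows.\<close>

lemma converse_bound:
  fixes \<gamma> \<delta> :: real
  assumes j: "j \<in> U" and \<delta>: "0 < \<delta>" "\<delta> < 1"
    and D: "D \<in> codebook \<Otimes>\<^sub>M PiM {..<n} (\<lambda>_. borel) \<rightarrow>\<^sub>M count_space {1..N j}"
    and sep: "\<And>T. T \<subseteq> U - {j} \<Longrightarrow>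
      2 ^ CARD('k) * exp (real n * (2 * \<gamma>)) * exp (real n * (2 * \<delta>)) * noise_power U ^ n
        \<le> (\<Prod>l\<in>U - T. real (N l)) * noise_power T ^ n"
  shows "1 - exp (- (real n * \<gamma>)) - 2 ^ CARD('k) * (4 * chernoff_rate \<delta> ^ n + exp (- (real n * \<gamma>))) \<le> mean_error j D"
proof -
  let ?b = "2 ^ CARD('k) * (4 * chernoff_rate \<delta> ^ n + exp (- (real n * \<gamma>)))"
  let ?q = "\<lambda>w p. (fst p, chan_out (fst p) w (snd p))"
  \<comment> \<open>Chosen so that \<open>sum_measure_correct_good_le\<close> bounds the average
    probability of a correct decision together with \<open>good_lik\<close> by
    \<open>exp (- (real n * \<gamma>))\<close>.\<close>
  define \<theta> where "\<theta> = exp (- (real n * \<gamma>)) * (\<Prod>l\<in>U. real (N l))"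
  have Npos: "(\<Prod>l\<in>A. real (N l)) > 0" for A using N_pos by (intro prod_pos) (simp add: Suc_le_eq)
  have \<theta>: "\<theta> > 0" using Npos by (simp add: \<theta>_def)
  have D_nat: "D \<in> codebook \<Otimes>\<^sub>M PiM {..<n} (\<lambda>_. borel) \<rightarrow>\<^sub>M count_space UNIV"
    using D by (rule measurable_compose) simp
  have good_meas: "Measurable.pred joint (\<lambda>p. good_lik \<theta> j U w (?q w p))" if "w \<in> msgs" for w
    by (rule measurable_compose[OF measurable_pair_output[OF that] measurable_good_lik[OF that]])
  have D_meas: "(\<lambda>p. D (?q w p)) \<in> joint \<rightarrow>\<^sub>M count_space UNIV" if "w \<in> msgs" for w
    by (rule measurable_compose[OF measurable_pair_output[OF that] D_nat])
  have bad_le: "measure joint {p \<in> space joint. \<not> good_lik \<theta> j U w (?q w p)} \<le> ?b" if w: "w \<in> msgs" for w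
  proof -
    have "{p \<in> space joint. \<not> good_lik \<theta> j U w (?q w p)} \<subseteq> (\<Union>T\<in>Pow (U - {j}). bad_event \<gamma> \<delta> {} T U w)"
    proof (rule subsetI, rule ccontr)
      fix p assume p: "p \<in> {p \<in> space joint. \<not> good_lik \<theta> j U w (?q w p)}"
        and "p \<notin> (\<Union>T\<in>Pow (U - {j}). bad_event \<gamma> \<delta> {} T U w)"
      then have notbad: "p \<notin> bad_event \<gamma> \<delta> {} T U w" if "T \<subseteq> U - {j}" for T
        using that by blast
      let ?x = "fst p" and ?y = "chan_out (fst p) w (snd p)"
      have "(\<Sum>w'\<in>class_off (U - {j}) w. lik {} ?x w' ?y) = (\<Sum>T\<in>Pow (U - {j}). \<Sum>w'\<in>differ_on T w. lik {} ?x w' ?y)"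
        by (rule sum_class_off)
      also have "\<dots> \<le> (\<Sum>T\<in>Pow (U - {j}). \<theta> * lik U ?x w ?y / 2 ^ CARD('k))"
      proof (rule sum_mono)
        fix T assume "T \<in> Pow (U - {j})"
        \<comment> \<open>The case of empty \<open>T\<close> is the transmitted tuple itself, whose
          own likelihood also has to stay below the bound.\<close>
        then have T: "T \<subseteq> U - {j}" by simp
        let ?t = "(\<Prod>l\<in>T. real (N l)) * exp (real n * \<gamma>)"
        have t: "?t > 0" using Npos by simp
        have typl: "p \<notin> atypical \<delta> T w" "p \<notin> atypical \<delta> U w" and conf: "p \<notin> confusable ?t {} T w"
          using notbad[OF T] by (auto simp: bad_event_def)
        have "(\<Sum>w'\<in>differ_on T w. lik {} ?x w' ?y) \<le> ?t * lik T ?x w ?y"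
          using conf p by (simp add: confusable_def)
        also have "\<dots> \<le> ?t * (exp (- (real n * (1 - \<delta>))) / (pi * noise_power T) ^ n)"
          using typical_lik_bounds(2)[of p \<delta> T w] typl p t by (intro mult_left_mono) auto
        also have "\<dots> \<le> \<theta> / 2 ^ CARD('k) * (exp (- (real n * (1 + \<delta>))) / (pi * noise_power U) ^ n)"
        proof -
          let ?J = "2 ^ CARD('k) :: real"
          define a b e where "a = (\<Prod>l\<in>U - T. real (N l))" and "b = (\<Prod>l\<in>T. real (N l))"
            and "e = exp (real n * \<gamma>)"
          have pos: "a > 0" "b > 0" "e > 0" using Npos by (simp_all add: a_def b_def e_def)
          have "(\<Prod>l\<in>U. real (N l)) = a * b"
            unfolding a_def b_def using T by (intro prod.subset_diff) auto
          then have \<theta>_eq: "\<theta> = a * b / e" by (simp add: \<theta>_def e_def exp_minus inverse_eq_divide)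
          \<comment> \<open>One factor \<open>e\<close> belongs to the Markov threshold, the other
            to the exponential in \<theta>.\<close>
          have "exp (real n * (2 * \<gamma>)) = e * e" by (simp add: e_def exp_add[symmetric])
          then have "?J * (e * e) * exp (real n * (2 * \<delta>)) * noise_power U ^ n \<le> a * noise_power T ^ n"
            using sep[OF T] by (simp add: a_def)
          then have "b * e * ?J / \<theta> * exp (real n * (2 * \<delta>)) * noise_power U ^ n \<le> noise_power T ^ n"
            using pos unfolding \<theta>_eq by (simp add: field_simps)
          then have "?t * ?J / \<theta> * exp (real n * (2 * \<delta>)) * noise_power U ^ n \<le> noise_power T ^ n"
            by (simp add: b_def e_def)
          then have "?t * ?J / \<theta> * (exp (- (real n * (1 - \<delta>))) / (pi * noise_power T) ^ n)
             \<le> exp (- (real n * (1 + \<delta>))) / (pi * noise_power U) ^ n"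
            by (intro exp_threshold_le) simp_all
          from mult_left_mono[OF this, of "\<theta> / ?J"] show ?thesis using \<theta> by simp
        qed
        also have "\<dots> \<le> \<theta> / 2 ^ CARD('k) * lik U ?x w ?y"
          using typical_lik_bounds(1)[of p \<delta> U w] typl p \<theta> by (intro mult_left_mono) auto
        finally show "(\<Sum>w'\<in>differ_on T w. lik {} ?x w' ?y) \<le> \<theta> * lik U ?x w ?y / 2 ^ CARD('k)" by simp
      qed
      also have "\<dots> = card (Pow (U - {j})) * (\<theta> * lik U ?x w ?y / 2 ^ CARD('k))" by simp
      also have "\<dots> \<le> 2 ^ CARD('k) * (\<theta> * lik U ?x w ?y / 2 ^ CARD('k))"
      proof (rule mult_right_mono)
        have "card (Pow (U - {j})) \<le> card (Pow (UNIV :: 'k set))" by (intro card_mono) auto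
        then show "real (card (Pow (U - {j}))) \<le> 2 ^ CARD('k)" by (simp add: card_Pow del: Pow_UNIV)
      qed (use \<theta> lik_pos in \<open>simp add: less_imp_le\<close>)
      finally have "good_lik \<theta> j U w (?q w p)" by (simp add: good_lik_def)
      then show False using p by simp
    qed
    then have "measure joint {p \<in> space joint. \<not> good_lik \<theta> j U w (?q w p)}
      \<le> measure joint (\<Union>T\<in>Pow (U - {j}). bad_event \<gamma> \<delta> {} T U w)"
      by (intro J.P.finite_measure_mono sets.finite_UN sets_bad_event w) auto
    also have "\<dots> \<le> ?b" by (rule measure_UN_bad_event[OF w \<delta>]) auto
    finally show ?thesis .
  qed
  let ?e = "\<lambda>w. measure joint {p \<in> space joint. D (?q w p) \<noteq> w j}"
  let ?g = "\<lambda>w. measure joint {p \<in> space joint. D (?q w p) = w j \<and> good_lik \<theta> j U w (?q w p)}"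
  have event_cover: "1 \<le> ?e w + ?g w + ?b" if w: "w \<in> msgs" for w
  proof -
    note [measurable] = good_meas[OF w] D_meas[OF w]
    have "1 = measure joint (space joint)" by (simp add: J.P.prob_space)
    also have "space joint = ({p \<in> space joint. D (?q w p) \<noteq> w j} \<union> {p \<in> space joint. D (?q w p) = w j \<and> good_lik \<theta> j U w (?q w p)})
       \<union> {p \<in> space joint. \<not> good_lik \<theta> j U w (?q w p)}" (is "_ = (?A \<union> ?B) \<union> ?C")
      by auto
    also have "measure joint \<dots> \<le> measure joint (?A \<union> ?B) + measure joint ?C"
      by (rule measure_Un_le) measurable
    also have "measure joint (?A \<union> ?B) \<le> ?e w + ?g w"
      by (rule measure_Un_le) measurable
    also have "measure joint ?C \<le> ?b" by (rule bad_le[OF w])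
    finally show ?thesis by simp
  qed
  have "(\<Prod>l\<in>U. real (N l)) * (\<Sum>w\<in>msgs. ?g w) \<le> \<theta> * card msgs"
    by (rule sum_measure_correct_good_le[OF j less_imp_le[OF \<theta>] D])
  then have g: "(\<Sum>w\<in>msgs. ?g w) \<le> exp (- (real n * \<gamma>)) * card msgs"
    using Npos[of U] unfolding \<theta>_def by (simp add: mult.assoc mult.left_commute)
  have "(\<Sum>w\<in>msgs. 1) \<le> (\<Sum>w\<in>msgs. ?e w + ?g w + ?b)" by (intro sum_mono event_cover)
  also have "\<dots> = card msgs * mean_error j D + (\<Sum>w\<in>msgs. ?g w) + card msgs * ?b"
    using msgs_nonempty by (simp add: sum.distrib mean_error_def)
  also note g
  finally have "real (card msgs) * 1 \<le> real (card msgs) * (mean_error j D + exp (- (real n * \<gamma>)) + ?b)"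
    by (simp add: algebra_simps)
  then have "1 \<le> mean_error j D + exp (- (real n * \<gamma>)) + ?b"
    using card_msgs_pos by (subst (asm) mult_le_cancel_left_pos) auto
  then show ?thesis by simp
qed

end

section \<open>From single receivers to the average error probability\<close>

lemma num_messages_pos: "num_messages n r \<ge> 1"
proof -
  have "(0::real) < 2 powr (real n * r)" by simp
  then have "0 < \<lceil>2 powr (real n * r)\<rceil>" by linarith
  then show ?thesis unfolding num_messages_def by linarith
qed

lemma receiver_num_messages: "v > 0 \<Longrightarrow> receiver v (\<lambda>l. num_messages n (R $ l))"
  by unfold_locales (assumption, rule num_messages_pos)

text \<open>Independent uniform messages are jointly uniform on \<open>msgs\<close>, and the
  codebook law is the same for all receivers, so the per-receiver averages simply add up.\<close>

lemma avg_error_prob_eq: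
  fixes g :: "'k::finite \<Rightarrow> 'k \<Rightarrow> complex"
  assumes v: "v > 0" and d: "d \<in> decoders n R v"
  shows "avg_error_prob g n R v d
    = (\<Sum>j\<in>UNIV. receiver.mean_error (g j) v n (\<lambda>l. num_messages n (R $ l)) j (d j)) / CARD('k)"
proof -
  let ?N = "\<lambda>l. num_messages n (R $ l)"
  interpret receiver "g j" v n ?N for j using v by (rule receiver_num_messages)
  have cb: "gptp_codebooks n R v = codebook"
    by (simp add: gptp_codebooks_def codebook_def)
  have pmf: "message_pmf n R = pmf_of_set msgs"
    unfolding message_pmf_def
    by (subst Pi_pmf_of_set)
       (auto simp: PiE_dflt_def msgs_def Suc_le_eq intro!: arg_cong[where f=pmf_of_set] num_messages_pos[unfolded One_nat_def Suc_le_eq])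
  have out: "received g n x j w z = chan_out j x w z" for x j w z
    by (simp add: received_def chan_out_def)
  have "has_bochner_integral codebook (error_prob g n R d) ((\<Sum>j\<in>UNIV. mean_error j j (d j)) / CARD('k))"
    unfolding error_prob_def pmf out
    by (intro has_bochner_integral_divide_zero has_bochner_integral_sum has_bochner_integral_mean_error)
       (use d in \<open>simp add: decoders_def cb\<close>)
  then show ?thesis
    by (simp add: avg_error_prob_def cb has_bochner_integral_integral_eq)
qed

subsection \<open>The rate region\<close>

definition rx_noise :: "('k::finite \<Rightarrow> 'k \<Rightarrow> complex) \<Rightarrow> real \<Rightarrow> 'k \<Rightarrow> 'k set \<Rightarrow> real" where
  "rx_noise g v j U = 1 + (\<Sum>l\<in>U. rx_power g v j l)"

lemma receiver_noise_power:
  fixes N :: "'k::finite \<Rightarrow> nat" and g :: "'k \<Rightarrow> 'k \<Rightarrow> complex"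
  assumes "receiver v N"
  shows "receiver.noise_power (g j) v U = rx_noise g v j U"
  by (simp add: receiver.noise_power_def[OF assms] rx_noise_def rx_power_def)

lemma rx_noise_ge_1: "v \<ge> 0 \<Longrightarrow> rx_noise g v j U \<ge> 1"
  by (simp add: rx_noise_def rx_power_def sum_nonneg)

lemma rx_noise_pos: "v \<ge> 0 \<Longrightarrow> rx_noise g v j U > 0"
  using rx_noise_ge_1[of v g j U] by linarith

lemma rx_noise_mult: "rx_noise g v j U = 1 + (\<Sum>l\<in>U. (cmod (g j l))\<^sup>2) * v"
  by (simp add: rx_noise_def rx_power_def sum_distrib_right)

text \<open>One plus the signal-to-noise ratio is the quotient of two noise powers, so a rate
  constraint becomes a difference of logarithms, comparable with \<phi>.\<close>

lemma cap_eq_ln: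
  assumes v: "v \<ge> 0" and T: "T \<subseteq> S"
  shows "cap ((\<Sum>l\<in>T. rx_power g v j l) / (1 + (\<Sum>l\<in>- S. rx_power g v j l)))
    = (ln (rx_noise g v j (- S \<union> T)) - ln (rx_noise g v j (- S))) / ln 2"
proof -
  have "rx_noise g v j (- S \<union> T) = rx_noise g v j (- S) + (\<Sum>l\<in>T. rx_power g v j l)"
    using T by (simp add: rx_noise_def, subst sum.union_disjoint) auto
  then have "1 + (\<Sum>l\<in>T. rx_power g v j l) / rx_noise g v j (- S) = rx_noise g v j (- S \<union> T) / rx_noise g v j (- S)"
    using rx_noise_pos[OF v, of g j "- S"] by (simp add: field_simps)
  then show ?thesis
    using rx_noise_pos[OF v, of g j "- S"] rx_noise_pos[OF v, of g j "- S \<union> T"]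
    by (simp add: cap_def rx_noise_def[symmetric] log_def ln_div)
qed

lemma receiver_region_iff:
  assumes Q: "Q \<ge> 0"
  shows "R \<in> receiver_region g Q j \<longleftrightarrow> (\<forall>l. 0 \<le> R $ l) \<and> (\<exists>S. j \<in> S \<and> (\<forall>T\<subseteq>S.
    ln 2 * (\<Sum>l\<in>T. R $ l) \<le> ln (rx_noise g Q j (- S \<union> T)) - ln (rx_noise g Q j (- S))))"
proof -
  have "(\<lambda>l\<in>S. R $ l) \<in> mac_region g Q j S \<longleftrightarrow> (\<forall>T\<subseteq>S.
    ln 2 * (\<Sum>l\<in>T. R $ l) \<le> ln (rx_noise g Q j (- S \<union> T)) - ln (rx_noise g Q j (- S)))"
    if "\<forall>l. 0 \<le> R $ l" for S
  proof -
    have "(\<Sum>l\<in>T. (\<lambda>l\<in>S. R $ l) l) = (\<Sum>l\<in>T. R $ l)" if "T \<subseteq> S" for T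
      using that by (intro sum.cong) auto
    moreover have "(\<lambda>l\<in>S. R $ l) \<in> S \<rightarrow>\<^sub>E {0..}" using that by auto
    ultimately show ?thesis
      unfolding mac_region_def using Q by (auto simp: cap_eq_ln pos_le_divide_eq mult.commute)
  qed
  then show ?thesis by (auto simp: receiver_region_def)
qed

lemma closed_receiver_region:
  fixes g :: "'k::finite \<Rightarrow> 'k \<Rightarrow> complex"
  assumes Q: "Q \<ge> 0"
  shows "closed (receiver_region g Q j)"
proof -
  have "receiver_region g Q j = (\<Inter>l. {R. 0 \<le> R $ l}) \<inter> (\<Union>S\<in>{S. j \<in> S}. \<Inter>T\<in>{T. T \<subseteq> S}.
     {R. ln 2 * (\<Sum>l\<in>T. R $ l) \<le> ln (rx_noise g Q j (- S \<union> T)) - ln (rx_noise g Q j (- S))})"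
    by (simp add: set_eq_iff receiver_region_iff[OF Q])
  moreover have "closed \<dots>"
    by (intro closed_Int closed_INT ballI closed_UN closed_Collect_le continuous_intros) auto
  ultimately show ?thesis by simp
qed

subsection \<open>Achievable rates lie in the region\<close>

text \<open>The function \<open>\<phi>\<close> of the introduction, in nats and for codebook variance \<open>v\<close>.\<close>

definition exponent :: "('k::finite \<Rightarrow> 'k \<Rightarrow> complex) \<Rightarrow> real ^ 'k \<Rightarrow> 'k \<Rightarrow> real \<Rightarrow> 'k set \<Rightarrow> real" where
  "exponent g R j v U = ln 2 * (\<Sum>l\<in>- U. R $ l) + ln (rx_noise g v j U)"

text \<open>Less power never helps: for \<open>a \<le> b\<close> the quotient of
  \<open>1 + b * v\<close> by \<open>1 + a * v\<close> increases with \<open>v\<close>. After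
  cross-multiplying, the claim is that \<open>(b - a) * (Q - v)\<close> is nonnegative.\<close>

lemma rx_noise_ratio_mono:
  assumes v: "0 \<le> v" "v \<le> Q"
  shows "ln (rx_noise g v j (U \<union> T)) - ln (rx_noise g v j U) \<le> ln (rx_noise g Q j (U \<union> T)) - ln (rx_noise g Q j U)"
proof -
  have Q: "Q \<ge> 0" using v by simp
  define a b where "a = (\<Sum>l\<in>U. (cmod (g j l))\<^sup>2)" and "b = (\<Sum>l\<in>U \<union> T. (cmod (g j l))\<^sup>2)"
  have ab: "a \<le> b" unfolding a_def b_def by (intro sum_mono2) auto
  have "a * Q + b * v \<le> a * v + b * Q"
    using mult_nonneg_nonneg[of "b - a" "Q - v"] ab v by (simp add: algebra_simps)
  then have "rx_noise g v j (U \<union> T) * rx_noise g Q j U \<le> rx_noise g Q j (U \<union> T) * rx_noise g v j U"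
    by (simp add: rx_noise_mult a_def[symmetric] b_def[symmetric] algebra_simps)
  then have "ln (rx_noise g v j (U \<union> T) * rx_noise g Q j U) \<le> ln (rx_noise g Q j (U \<union> T) * rx_noise g v j U)"
    by (subst ln_le_cancel_iff) (simp_all add: rx_noise_pos v Q)
  moreover have "ln (rx_noise g v j A * rx_noise g Q j B) = ln (rx_noise g v j A) + ln (rx_noise g Q j B)" for A B
    by (rule ln_mult_pos) (simp_all add: rx_noise_pos v Q)
  ultimately show ?thesis by (simp add: mult.commute[of "rx_noise g Q j _"])
qed

text \<open>Comparing \<open>V\<close> with \<open>V \<union> T\<close> gives the constraint for
  \<open>T\<close> at variance \<open>v\<close>, where \<open>- V\<close> is decoded; raising the
  variance to \<open>Q\<close> only relaxes it.\<close>

lemma receiver_region_if_min_exponent: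
  assumes R: "\<forall>l. 0 \<le> R $ l" and v: "0 \<le> v" "v \<le> Q" and j: "j \<notin> V"
    and min: "\<And>U. exponent g R j v V \<le> exponent g R j v U"
  shows "R \<in> receiver_region g Q j"
proof -
  have "ln 2 * (\<Sum>l\<in>T. R $ l) \<le> ln (rx_noise g Q j (V \<union> T)) - ln (rx_noise g Q j V)" if T: "T \<subseteq> - V" for T
  proof -
    have "(\<Sum>l\<in>- V. R $ l) = (\<Sum>l\<in>- (V \<union> T). R $ l) + (\<Sum>l\<in>T. R $ l)"
    proof -
      have "- V - T = - (V \<union> T)" by auto
      then show ?thesis using sum.subset_diff[OF T, of "\<lambda>l. R $ l"] by simp
    qed
    then have "ln 2 * (\<Sum>l\<in>T. R $ l) \<le> ln (rx_noise g v j (V \<union> T)) - ln (rx_noise g v j V)"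
      using min[of "V \<union> T"] by (simp add: exponent_def algebra_simps)
    also have "\<dots> \<le> ln (rx_noise g Q j (V \<union> T)) - ln (rx_noise g Q j V)"
      by (rule rx_noise_ratio_mono[OF v])
    finally show ?thesis .
  qed
  then show ?thesis
    using v R j by (subst receiver_region_iff) (auto intro!: exI[of _ "- V"])
qed

lemma ex_less_exponent:
  assumes R: "\<forall>l. 0 \<le> R $ l" and v: "0 \<le> v" "v \<le> Q" and nR: "R \<notin> receiver_region g Q j"
  shows "\<exists>U. j \<in> U \<and> (\<forall>T. j \<notin> T \<longrightarrow> exponent g R j v U < exponent g R j v T)"
proof -
  have "finite {T. j \<notin> T}" "{T. j \<notin> T} \<noteq> {}" by auto
  then obtain V where V: "j \<notin> V" "\<And>T. j \<notin> T \<Longrightarrow> exponent g R j v V \<le> exponent g R j v T"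
    using ex_is_arg_min_if_finite[of "{T. j \<notin> T}" "exponent g R j v"] by (auto simp: is_arg_min_linorder)
  \<comment> \<open>As \<open>V\<close> is best among the sets avoiding \<open>j\<close> but not a
    global minimizer, anything strictly better must contain \<open>j\<close>.\<close>
  obtain U where U: "exponent g R j v U < exponent g R j v V"
    using receiver_region_if_min_exponent[OF R v V(1)] nR by (meson not_le)
  then show ?thesis using V by (intro exI[of _ U]) (meson le_less_trans less_le_not_le not_le)
qed

text \<open>The codebook variance may vary with the block length, so the gap has to be uniform in it.\<close>

lemma uniform_exponent_gap:
  assumes R: "\<forall>l. 0 \<le> R $ l" and nR: "R \<notin> receiver_region g Q j"
  shows "\<exists>\<epsilon>>0. \<forall>v. 0 \<le> v \<longrightarrow> v \<le> Q \<longrightarrow>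
    (\<exists>U. j \<in> U \<and> (\<forall>T. j \<notin> T \<longrightarrow> exponent g R j v U + \<epsilon> \<le> exponent g R j v T))"
proof (rule ccontr)
  assume contra: "\<not> ?thesis"
  have "\<exists>v. v \<in> {0..Q} \<and> (\<forall>U. j \<in> U \<longrightarrow> (\<exists>T. j \<notin> T \<and> exponent g R j v T < exponent g R j v U + 1 / real (Suc k)))" for k
    using contra by (auto simp: not_le dest!: spec[of _ "1 / real (Suc k)"])
  then obtain v where v: "\<And>k. v k \<in> {0..Q}"
    and small: "\<And>k U. j \<in> U \<Longrightarrow> \<exists>T. j \<notin> T \<and> exponent g R j (v k) T < exponent g R j (v k) U + 1 / real (Suc k)"
    by metis
  \<comment> \<open>The limit variance may be 0 although all codebook variances are positive, which
    is why the preceding facts admit \<open>v = 0\<close>.\<close>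
  obtain v0 r where v0: "v0 \<in> {0..Q}" and r: "strict_mono r" and lim: "(v \<circ> r) \<longlonglongrightarrow> v0"
    using compact_Icc[of 0 Q] v unfolding compact_def by metis
  obtain U where U: "j \<in> U" "\<And>T. j \<notin> T \<Longrightarrow> exponent g R j v0 U < exponent g R j v0 T"
    using ex_less_exponent[OF R _ _ nR, of v0] v0 by auto
  have cont: "(\<lambda>k. exponent g R j (v (r k)) T) \<longlonglongrightarrow> exponent g R j v0 T" for T
  proof -
    have "(\<lambda>k. rx_noise g (v (r k)) j T) \<longlonglongrightarrow> rx_noise g v0 j T"
      unfolding rx_noise_mult using lim by (intro tendsto_intros) (simp add: comp_def)
    then show ?thesis
      unfolding exponent_def using rx_noise_pos[of v0 g j T] v0 by (intro tendsto_intros) auto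
  qed
  have zero: "(\<lambda>k. 1 / real (Suc (r k))) \<longlonglongrightarrow> 0"
    using LIMSEQ_subseq_LIMSEQ[OF LIMSEQ_inverse_real_of_nat r] by (simp add: comp_def inverse_eq_divide)
  have "eventually (\<lambda>k. exponent g R j (v (r k)) U + 1 / real (Suc (r k)) < exponent g R j (v (r k)) T) sequentially"
    if T: "j \<notin> T" for T
  proof -
    have "(\<lambda>k. exponent g R j (v (r k)) T - exponent g R j (v (r k)) U - 1 / real (Suc (r k)))
        \<longlonglongrightarrow> exponent g R j v0 T - exponent g R j v0 U - 0"
      by (intro tendsto_diff cont zero)
    then have "eventually (\<lambda>k. 0 < exponent g R j (v (r k)) T - exponent g R j (v (r k)) U - 1 / real (Suc (r k))) sequentially"
      by (rule order_tendstoD) (use U(2)[OF T] in simp)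
    then show ?thesis by (rule eventually_mono) simp
  qed
  then have "eventually (\<lambda>k. \<forall>T\<in>{T. j \<notin> T}. exponent g R j (v (r k)) U + 1 / real (Suc (r k)) < exponent g R j (v (r k)) T) sequentially"
    by (intro eventually_ball_finite) auto
  then obtain k where "\<And>T. j \<notin> T \<Longrightarrow> exponent g R j (v (r k)) U + 1 / real (Suc (r k)) < exponent g R j (v (r k)) T"
    using eventually_happens'[OF sequentially_bot] by blast
  then show False using small[OF U(1), of "r k"] by (meson less_asym)
qed

section \<open>Rounded message counts and limits of the error bounds\<close>

lemma num_messages_ge: "exp (real n * (ln 2 * r)) \<le> real (num_messages n r)"
proof -
  have "2 powr (real n * r) \<le> real (num_messages n r)"
    unfolding num_messages_def by linarith
  then show ?thesis by (simp add: powr_def mult_ac)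
qed

text \<open>For a nonnegative rate the unrounded count is at least 1, so rounding up at most doubles
  it.\<close>

lemma num_messages_le:
  assumes "r \<ge> 0"
  shows "real (num_messages n r) \<le> 2 * exp (real n * (ln 2 * r))"
proof -
  have "(1::real) \<le> 2 powr (real n * r)" using assms by (intro ge_one_powr_ge_zero) auto
  then have "real (num_messages n r) \<le> 2 * 2 powr (real n * r)"
    unfolding num_messages_def by linarith
  then show ?thesis by (simp add: powr_def mult_ac)
qed

lemma bound_tendsto_0:
  fixes d :: real
  assumes d: "0 < d"
  shows "(\<lambda>n. c * (4 * chernoff_rate d ^ n + exp (- (real n * d)))) \<longlonglongrightarrow> 0"
    and "(\<lambda>n. exp (- (real n * d))) \<longlonglongrightarrow> 0"
proof -
  have "(\<lambda>n. exp (- d) ^ n) \<longlonglongrightarrow> 0" using d by (intro LIMSEQ_power_zero) simp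
  then show 1: "(\<lambda>n. exp (- (real n * d))) \<longlonglongrightarrow> 0" by (simp add: exp_of_nat_mult[symmetric])
  have "norm (chernoff_rate d) < 1"
    using chernoff_rate_nonneg[OF d] chernoff_rate_less_1[of d] d by simp
  then have 2: "(\<lambda>n. chernoff_rate d ^ n) \<longlonglongrightarrow> 0" by (rule LIMSEQ_power_zero)
  have "(\<lambda>n. c * (4 * chernoff_rate d ^ n + exp (- (real n * d)))) \<longlonglongrightarrow> c * (4 * 0 + 0)"
    by (intro tendsto_mult tendsto_add tendsto_const 1 2)
  then show "(\<lambda>n. c * (4 * chernoff_rate d ^ n + exp (- (real n * d)))) \<longlonglongrightarrow> 0" by simp
qed

lemma power_eq_exp: "(x::real) > 0 \<Longrightarrow> x ^ n = exp (real n * ln x)"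
  by (simp add: exp_of_nat_mult)

lemma gptp_codebooks_eq: "v > 0 \<Longrightarrow> gptp_codebooks n R v = receiver.codebook v n (\<lambda>l. num_messages n (R $ l))"
  by (simp add: gptp_codebooks_def receiver.codebook_def[OF receiver_num_messages])

lemma achievable_imp_receiver_region:
  fixes g :: "'k::finite \<Rightarrow> 'k \<Rightarrow> complex"
  assumes "achievable g Q R"
  shows "R \<in> receiver_region g Q j"
proof (rule ccontr)
  assume nR: "R \<notin> receiver_region g Q j"
  from assms obtain v d where R: "\<forall>l. 0 \<le> R $ l" and v: "\<And>n. 0 < v n" "\<And>n. v n \<le> Q"
    and dec: "\<And>n. d n \<in> decoders n R (v n)"
    and lim: "(\<lambda>n. avg_error_prob g n R (v n) (d n)) \<longlonglongrightarrow> 0"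
    by (auto simp: achievable_def)
  from uniform_exponent_gap[OF R nR] obtain \<epsilon> where \<epsilon>: "\<epsilon> > 0"
    and gap: "\<And>v. 0 \<le> v \<Longrightarrow> v \<le> Q \<Longrightarrow> \<exists>U. j \<in> U \<and> (\<forall>T. j \<notin> T \<longrightarrow> exponent g R j v U + \<epsilon> \<le> exponent g R j v T)"
    by blast
  \<comment> \<open>With \<gamma> = \<delta> = \<open>t\<close> the exponential losses of
    \<open>converse_bound\<close> are 4 \<open>t\<close> per symbol, at most half of \<epsilon>; the
    other half absorbs \<open>2 ^ CARD('k)\<close> for large \<open>n\<close>. The cap 1/2 keeps
    \<open>t < 1\<close> for the concentration bound.\<close>
  define t where "t = min (1/2) (\<epsilon> / 8)"
  have t: "0 < t" "t < 1" "8 * t \<le> \<epsilon>" using \<epsilon> by (auto simp: t_def)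
  define M where "M = real CARD('k)"
  have two: "2 ^ CARD('k) = exp (M * ln 2)" unfolding M_def by (rule power_eq_exp) simp
  define err where "err n = 1 - exp (- (real n * t)) - 2 ^ CARD('k) * (4 * chernoff_rate t ^ n + exp (- (real n * t)))" for n
  have lower: "err n \<le> M * avg_error_prob g n R (v n) (d n)" if n: "2 * M * ln 2 \<le> real n * \<epsilon>" for n
  proof -
    let ?N = "\<lambda>l. num_messages n (R $ l)"
    interpret receiver "g i" "v n" n ?N for i using v(1) by (rule receiver_num_messages)
    have np: "receiver.noise_power (g j) (v n) A = rx_noise g (v n) j A" for A
      by (rule receiver_noise_power[OF receiver_num_messages[OF v(1)]])
    obtain U where U: "j \<in> U" and U_gap: "\<And>T. j \<notin> T \<Longrightarrow> exponent g R j (v n) U + \<epsilon> \<le> exponent g R j (v n) T"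
      using gap[of "v n"] v[of n] by auto
    have pos: "rx_noise g (v n) j A > 0" for A using v(1)[of n] by (intro rx_noise_pos) simp
    have "err n \<le> mean_error j j (d n j)"
      unfolding err_def
    proof (rule converse_bound[OF U t(1,2)])
      show "d n j \<in> codebook \<Otimes>\<^sub>M PiM {..<n} (\<lambda>_. borel) \<rightarrow>\<^sub>M count_space {1..?N j}"
        using dec[of n] by (simp add: decoders_def gptp_codebooks_eq[OF v(1)])
      fix T assume T: "T \<subseteq> U - {j}"
      have "(\<Sum>l\<in>- T. R $ l) = (\<Sum>l\<in>- U. R $ l) + (\<Sum>l\<in>U - T. R $ l)"
      proof -
        have "- T - - U = U - T" "- U \<subseteq> - T" using T by auto
        then show ?thesis using sum.subset_diff[of "- U" "- T" "\<lambda>l. R $ l"] by simp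
      qed
      then have g1: "ln (rx_noise g (v n) j U) + \<epsilon> \<le> ln 2 * (\<Sum>l\<in>U - T. R $ l) + ln (rx_noise g (v n) j T)"
        using U_gap[of T] T by (auto simp: exponent_def algebra_simps)
      have "M * ln 2 + real n * (4 * t) + real n * ln (rx_noise g (v n) j U)
        \<le> real n * (ln (rx_noise g (v n) j U) + \<epsilon>)"
        using n mult_left_mono[OF t(3), of "real n"] by (simp add: algebra_simps)
      also have "\<dots> \<le> real n * (ln 2 * (\<Sum>l\<in>U - T. R $ l) + ln (rx_noise g (v n) j T))"
        by (intro mult_left_mono g1) simp
      finally have g2: "M * ln 2 + real n * (2 * t) + real n * (2 * t) + real n * ln (rx_noise g (v n) j U)
        \<le> (\<Sum>l\<in>U - T. real n * (ln 2 * R $ l)) + real n * ln (rx_noise g (v n) j T)"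
        by (simp add: sum_distrib_left algebra_simps)
      have "2 ^ CARD('k) * exp (real n * (2 * t)) * exp (real n * (2 * t)) * rx_noise g (v n) j U ^ n
        = exp (M * ln 2 + real n * (2 * t) + real n * (2 * t) + real n * ln (rx_noise g (v n) j U))"
        by (simp only: two exp_add power_eq_exp[OF pos])
      also have "\<dots> \<le> exp ((\<Sum>l\<in>U - T. real n * (ln 2 * R $ l)) + real n * ln (rx_noise g (v n) j T))"
        using g2 by simp
      also have "\<dots> = (\<Prod>l\<in>U - T. exp (real n * (ln 2 * R $ l))) * rx_noise g (v n) j T ^ n"
        by (simp add: exp_add exp_sum power_eq_exp[OF pos])
      also have "\<dots> \<le> (\<Prod>l\<in>U - T. real (?N l)) * rx_noise g (v n) j T ^ n"
        using pos[of T] by (intro mult_right_mono prod_mono conjI num_messages_ge) auto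
      finally show "2 ^ CARD('k) * exp (real n * (2 * t)) * exp (real n * (2 * t)) * noise_power j U ^ n
        \<le> (\<Prod>l\<in>U - T. real (?N l)) * noise_power j T ^ n"
        by (simp add: np)
    qed
    \<comment> \<open>One failing receiver suffices: its error is at most \<open>CARD('k)\<close>
      times the average, which would tend to 0 while \<open>err\<close> tends to 1.\<close>
    also have "\<dots> \<le> (\<Sum>i\<in>UNIV. mean_error i i (d n i))"
      by (rule member_le_sum) (auto intro: mean_error_nonneg)
    also have "\<dots> = M * avg_error_prob g n R (v n) (d n)"
      by (simp add: avg_error_prob_eq[OF v(1) dec] M_def)
    finally show ?thesis .
  qed
  have "err \<longlonglongrightarrow> 1 - 0 - 0"
    unfolding err_def by (intro tendsto_diff tendsto_const bound_tendsto_0 t)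
  moreover have "(\<lambda>n. M * avg_error_prob g n R (v n) (d n)) \<longlonglongrightarrow> M * 0"
    by (intro tendsto_intros lim)
  moreover have "eventually (\<lambda>n. 2 * M * ln 2 \<le> real n * \<epsilon>) sequentially"
  proof -
    have "filterlim (\<lambda>n. real n * \<epsilon>) at_top sequentially"
      using \<epsilon> by (intro filterlim_at_top_mult_tendsto_pos[OF tendsto_const] filterlim_real_sequentially)
    then show ?thesis by (simp add: filterlim_at_top)
  qed
  then have "eventually (\<lambda>n. err n \<le> M * avg_error_prob g n R (v n) (d n)) sequentially"
    by (rule eventually_mono) (rule lower)
  ultimately have "(1::real) - 0 - 0 \<le> M * 0"
    by (intro tendsto_le[OF sequentially_bot]) auto
  then show False by simp
qed

subsection \<open>Scaled points of the region are achievable\<close>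

text \<open>Full power \<open>Q\<close> is used at every block length. Scaling gains the slack
  \<open>(1 - c)\<close> times the sum rate, bounded away from zero over all sets of users with
  positive rate.\<close>

lemma achievable_scaled:
  fixes g :: "'k::finite \<Rightarrow> 'k \<Rightarrow> complex"
  assumes Q: "Q > 0" and R: "\<And>j. R \<in> receiver_region g Q j" and c: "0 \<le> c" "c < 1"
  shows "achievable g Q (c *\<^sub>R R)"
proof -
  have R0: "0 \<le> R $ l" for l using R by (auto simp: receiver_region_def)
  have "\<exists>S. \<forall>j. j \<in> S j \<and> (\<forall>T\<subseteq>S j. ln 2 * (\<Sum>l\<in>T. R $ l) \<le> ln (rx_noise g Q j (- S j \<union> T)) - ln (rx_noise g Q j (- S j)))"
    using R Q by (intro choice allI) (auto simp: receiver_region_iff)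
  then obtain S where S: "\<And>j. j \<in> S j"
    and mac: "\<And>j T. T \<subseteq> S j \<Longrightarrow> ln 2 * (\<Sum>l\<in>T. R $ l) \<le> ln (rx_noise g Q j (- S j \<union> T)) - ln (rx_noise g Q j (- S j))"
    by blast
  \<comment> \<open>The least slack contributed by a single user of positive rate; the inserted 1
    keeps the minimum defined when all rates vanish.\<close>
  define \<epsilon> where "\<epsilon> = Min (insert 1 ((\<lambda>l. (1 - c) * (ln 2 * R $ l)) ` {l. R $ l > 0}))"
  have \<epsilon>: "\<epsilon> > 0" using c by (auto simp: \<epsilon>_def)
  have \<epsilon>_le: "\<epsilon> \<le> (1 - c) * (ln 2 * R $ l)" if "R $ l > 0" for l
    unfolding \<epsilon>_def by (rule Min_le) (use that in auto)
  define t where "t = min (1/2) (\<epsilon> / 8)"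
  have t: "0 < t" "t < 1" "8 * t \<le> \<epsilon>" using \<epsilon> by (auto simp: t_def)
  define M where "M = real CARD('k)"
  have two: "2 ^ CARD('k) = exp (M * ln 2)" unfolding M_def by (rule power_eq_exp) simp
  define err where "err n = 2 ^ CARD('k) * (4 * chernoff_rate t ^ n + exp (- (real n * t)))" for n
  let ?R = "c *\<^sub>R R"
  let ?large = "\<lambda>n. 2 * M * ln 2 < real n * \<epsilon>"
  have "\<exists>D. D \<in> gptp_codebooks n ?R Q \<Otimes>\<^sub>M PiM {..<n} (\<lambda>_. borel) \<rightarrow>\<^sub>M count_space {1..num_messages n (?R $ j)} \<and>
      (?large n \<longrightarrow> receiver.mean_error (g j) Q n (\<lambda>l. num_messages n (?R $ l)) j D \<le> err n)" for n j
  proof (cases "?large n")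
    case False
    \<comment> \<open>For small \<open>n\<close> any decoder will do; the constant 1 is always a
      valid message.\<close>
    then show ?thesis using num_messages_pos[of n "?R $ j"] by (intro exI[of _ "\<lambda>_. 1"]) simp
  next
    case n: True
    let ?N = "\<lambda>l. num_messages n (?R $ l)"
    interpret receiver "g j" Q n ?N using Q by (rule receiver_num_messages)
    have np: "noise_power A = rx_noise g Q j A" for A
      by (rule receiver_noise_power[OF receiver_num_messages[OF Q]])
    have pos: "rx_noise g Q j A > 0" for A using Q by (intro rx_noise_pos) simp
    have "\<exists>D \<in> codebook \<Otimes>\<^sub>M PiM {..<n} (\<lambda>_. borel) \<rightarrow>\<^sub>M count_space {1..?N j}. mean_error j D \<le> err n"
      unfolding err_def
    proof (rule achievability_bound[OF S t(1,2)])
      fix T assume T: "T \<subseteq> S j" "T \<noteq> {}" and N2: "\<And>l. l \<in> T \<Longrightarrow> 2 \<le> ?N l"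
      \<comment> \<open>A user of rate 0 has exactly one message, so having at least two forces a
        positive rate and hence slack.\<close>
      have Rpos: "R $ l > 0" if "l \<in> T" for l
      proof (rule ccontr)
        assume "\<not> 0 < R $ l"
        then have "?N l = 1" using R0[of l] by (simp add: num_messages_def)
        then show False using N2[OF that] by simp
      qed
      obtain l0 where l0: "l0 \<in> T" using T by blast
      have "\<epsilon> \<le> (1 - c) * (ln 2 * R $ l0)" by (rule \<epsilon>_le[OF Rpos[OF l0]])
      also have "\<dots> \<le> (1 - c) * (ln 2 * (\<Sum>l\<in>T. R $ l))"
        using c R0 l0 by (intro mult_left_mono member_le_sum) auto
      finally have "c * (ln 2 * (\<Sum>l\<in>T. R $ l)) + \<epsilon> \<le> ln 2 * (\<Sum>l\<in>T. R $ l)"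
        by (simp add: algebra_simps)
      also note mac[OF T(1)]
      finally have g1: "c * (ln 2 * (\<Sum>l\<in>T. R $ l)) + \<epsilon> + ln (rx_noise g Q j (- S j)) \<le> ln (rx_noise g Q j (- S j \<union> T))"
        by simp
      \<comment> \<open>The 3 \<open>t\<close> are \<gamma> + 2 \<delta> from
        \<open>achievability_bound\<close>; \<open>M * ln 2\<close> pays for rounding, a factor of
        at most 2 per user in \<open>T\<close>.\<close>
      have "M * ln 2 + real n * (3 * t) < real n * \<epsilon>"
      proof -
        define a b where "a = real n * t" and "b = real n * \<epsilon>"
        have "8 * a \<le> b" using mult_left_mono[OF t(3), of "real n"] by (simp add: a_def b_def)
        moreover have "0 \<le> a" using t(1) by (simp add: a_def)
        moreover have "2 * (M * ln 2) < b" using n by (simp add: b_def)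
        moreover have "real n * (3 * t) = 3 * a" by (simp add: a_def)
        ultimately show ?thesis unfolding b_def[symmetric] by linarith
      qed
      moreover have "(\<Sum>l\<in>T. real n * (ln 2 * ?R $ l)) = real n * (c * (ln 2 * (\<Sum>l\<in>T. R $ l)))"
        unfolding sum_distrib_left by (intro sum.cong refl) simp
      ultimately have g2: "M * ln 2 + (\<Sum>l\<in>T. real n * (ln 2 * ?R $ l)) + real n * t + real n * (2 * t) + real n * ln (rx_noise g Q j (- S j))
         < real n * ln (rx_noise g Q j (- S j \<union> T))"
        using mult_left_mono[OF g1, of "real n"] by (simp add: algebra_simps)
      have "(\<Prod>l\<in>T. real (?N l)) \<le> (\<Prod>l\<in>T. 2 * exp (real n * (ln 2 * ?R $ l)))"
        using c R0 by (intro prod_mono conjI num_messages_le) auto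
      also have "\<dots> = 2 ^ card T * exp (\<Sum>l\<in>T. real n * (ln 2 * ?R $ l))"
        by (simp add: prod.distrib exp_sum)
      also have "\<dots> \<le> 2 ^ CARD('k) * exp (\<Sum>l\<in>T. real n * (ln 2 * ?R $ l))"
        by (intro mult_right_mono power_increasing card_mono) auto
      also have "\<dots> = exp (M * ln 2 + (\<Sum>l\<in>T. real n * (ln 2 * ?R $ l)))"
        by (simp only: two exp_add)
      finally have "(\<Prod>l\<in>T. real (?N l)) * exp (real n * t) * exp (real n * (2 * t)) * rx_noise g Q j (- S j) ^ n
        \<le> exp (M * ln 2 + (\<Sum>l\<in>T. real n * (ln 2 * ?R $ l))) * exp (real n * t) * exp (real n * (2 * t)) * rx_noise g Q j (- S j) ^ n"
        using pos[of "- S j"] by (intro mult_right_mono) auto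
      also have "\<dots> = exp (M * ln 2 + (\<Sum>l\<in>T. real n * (ln 2 * ?R $ l)) + real n * t + real n * (2 * t) + real n * ln (rx_noise g Q j (- S j)))"
        by (simp only: exp_add power_eq_exp[OF pos])
      also have "\<dots> < exp (real n * ln (rx_noise g Q j (- S j \<union> T)))"
        using g2 by simp
      also have "\<dots> = rx_noise g Q j (- S j \<union> T) ^ n" by (simp only: power_eq_exp[OF pos])
      finally show "(\<Prod>l\<in>T. real (?N l)) * exp (real n * t) * exp (real n * (2 * t)) * noise_power (- S j) ^ n < noise_power (- S j \<union> T) ^ n"
        by (simp only: np)
    qed
    then show ?thesis by (auto simp: gptp_codebooks_eq[OF Q])
  qed
  then obtain d where d: "\<And>n j. d n j \<in> gptp_codebooks n ?R Q \<Otimes>\<^sub>M PiM {..<n} (\<lambda>_. borel) \<rightarrow>\<^sub>M count_space {1..num_messages n (?R $ j)}"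
    and d_err: "\<And>n j. ?large n \<Longrightarrow> receiver.mean_error (g j) Q n (\<lambda>l. num_messages n (?R $ l)) j (d n j) \<le> err n"
    by metis
  have dec: "d n \<in> decoders n ?R Q" for n using d by (simp add: decoders_def)
  have "(\<lambda>n. avg_error_prob g n ?R Q (d n)) \<longlonglongrightarrow> 0"
  proof (rule tendsto_sandwich[of "\<lambda>_. 0" _ _ err])
    have nonneg: "0 \<le> receiver.mean_error (g j) Q n (\<lambda>l. num_messages n (?R $ l)) j (d n j)" for n j
      by (rule receiver.mean_error_nonneg[OF receiver_num_messages[OF Q]])
    show "\<forall>\<^sub>F n in sequentially. 0 \<le> avg_error_prob g n ?R Q (d n)"
      unfolding avg_error_prob_eq[OF Q dec]
      by (intro always_eventually allI divide_nonneg_nonneg sum_nonneg nonneg) simp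
    have "filterlim (\<lambda>n. real n * \<epsilon>) at_top sequentially"
      using \<epsilon> by (intro filterlim_at_top_mult_tendsto_pos[OF tendsto_const] filterlim_real_sequentially)
    then have "eventually ?large sequentially" by (simp add: filterlim_at_top_dense)
    then show "\<forall>\<^sub>F n in sequentially. avg_error_prob g n ?R Q (d n) \<le> err n"
    proof (rule eventually_mono)
      fix n assume n: "?large n"
      have "avg_error_prob g n ?R Q (d n) \<le> (\<Sum>j\<in>(UNIV :: 'k set). err n) / CARD('k)"
        unfolding avg_error_prob_eq[OF Q dec] by (intro divide_right_mono sum_mono d_err n) simp
      then show "avg_error_prob g n ?R Q (d n) \<le> err n" by simp
    qed
    show "err \<longlonglongrightarrow> 0" unfolding err_def by (rule bound_tendsto_0[OF t(1)])
  qed simp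
  then show ?thesis
    unfolding achievable_def using R0 c Q dec by (auto intro!: exI[of _ "\<lambda>_. Q"] exI[of _ d])
qed

theorem theorem1:
  fixes g :: "'k::finite \<Rightarrow> 'k \<Rightarrow> complex" and Q :: real and K :: nat
  assumes "CARD('k) = K + 1" and "K \<ge> 1" and "Q > 0"
  shows "gptp_capacity_region g Q = (\<Inter>j. receiver_region g Q j)"
proof
  have "closed (\<Inter>j. receiver_region g Q j)"
    using assms(3) by (intro closed_INT ballI closed_receiver_region) simp
  then show "gptp_capacity_region g Q \<subseteq> (\<Inter>j. receiver_region g Q j)"
    unfolding gptp_capacity_region_def
    by (intro closure_minimal) (auto intro: achievable_imp_receiver_region)
next
  show "(\<Inter>j. receiver_region g Q j) \<subseteq> gptp_capacity_region g Q"
  proof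
    fix R assume "R \<in> (\<Inter>j. receiver_region g Q j)"
    then have R: "R \<in> receiver_region g Q j" for j by auto
    \<comment> \<open>Points of the region, including those on its boundary, are approached along
      the ray from the origin; the first factor is 0, which \<open>achievable_scaled\<close>
      allows.\<close>
    have "(\<lambda>m. (1 - inverse (real (Suc m))) *\<^sub>R R) \<longlonglongrightarrow> (1 - 0) *\<^sub>R R"
      by (intro tendsto_intros LIMSEQ_inverse_real_of_nat)
    moreover have "achievable g Q ((1 - inverse (real (Suc m))) *\<^sub>R R)" for m
      by (rule achievable_scaled[OF assms(3) R]) (auto simp: field_simps)
    ultimately show "R \<in> gptp_capacity_region g Q"
      unfolding gptp_capacity_region_def closure_sequential
      by (intro exI[of _ "\<lambda>m. (1 - inverse (real (Suc m))) *\<^sub>R R"]) auto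
  qed
qed

end
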